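(* Let $G$ be a locally finite connected graph and $\mathcal{F}G$ its Freudenthal compactification. For each $n \in \mathbb{N}$ the following are equivalent: (1) $\mathcal{F}G$ is $n$-ac; (2) $(G,\mathcal{F}G)$ is $n$-ac; (3) $G$ is $n$-ac.
   Context: Graphs are regarded as topological spaces via the 1-complex topology (each edge a copy of $[0,1]$ glued at its endpoints). The Freudenthal compactification $\mathcal{F}G$ of a locally finite connected graph $G$ is the maximal compactification of $G$ with zero-dimensional remainder; equivalently it is $G$ together with its ends (equivalence classes of rays, two rays being equivalent if no finite vertex set separates them), where a basic neighbourhood of an end $\omega$ is, for a finite vertex set $S$, the component $C(S,\omega)$ of $G-S$ containing a tail of every ray of $\omega$, together with all ends having rays in $C(S,\omega)$ and the interiors of the edges between $S$ and $C(S,\omega)$. A space $X$ is $n$-ac if any at most $n$ points of $X$ lie on a common arc in $X$. For $S\subseteq X$, $(S,X)$ is $n$-ac if any at most $n$ points of $S$ lie on a common arc in $X$. *)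

theory Defs
  imports "Graph_Theory.Digraph_Component" "HOL-Analysis.Analysis"
begin

text \<open>
  A graph (loops and parallel edges allowed, any cardinality) is given by a well-formed
  \<open>pre_digraph\<close>.  The direction of an arc \<open>e\<close> only fixes which end of its copy of \<open>[0,1]\<close> is glued
  to which endpoint; adjacency, connectedness and components are those of the underlying
  undirected graph \<open>mk_symmetric G\<close>.
\<close>

definition locally_finite :: "('v,'e) pre_digraph \<Rightarrow> bool" where
  "locally_finite G \<longleftrightarrow> (\<forall>v\<in>verts G. finite (in_arcs G v \<union> out_arcs G v))"

text \<open>The vertex sets of the components of \<open>G - S\<close>.\<close>

definition components_minus :: "('v,'e) pre_digraph \<Rightarrow> 'v set \<Rightarrow> 'v set set" where
  "components_minus G S =
     pre_digraph.sccs_verts (with_proj (mk_symmetric (G \<restriction> (verts G - S))))"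


section \<open>The 1-complex of a graph\<close>

text \<open>\<open>Inner e t\<close> is the point at parameter \<open>0 < t < 1\<close> of the edge \<open>e\<close>; \<open>End \<omega>\<close> is only used
  in the compactification.\<close>

datatype ('v,'e) point = Vertex 'v | Inner 'e real | End "(nat \<Rightarrow> 'v) set"

definition edge_point :: "('v,'e) pre_digraph \<Rightarrow> 'e \<Rightarrow> real \<Rightarrow> ('v,'e) point" where
  "edge_point G e t =
     (if t = 0 then Vertex (tail G e) else if t = 1 then Vertex (head G e) else Inner e t)"

definition graph_points :: "('v,'e) pre_digraph \<Rightarrow> ('v,'e) point set" where
  "graph_points G = Vertex ` verts G \<union> {Inner e t | e t. e \<in> arcs G \<and> 0 < t \<and> t < 1}"

text \<open>The quotient topology: final with respect to the vertices (discrete) and the maps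
  \<open>edge_point G e\<close> on \<open>[0,1]\<close>.\<close>

definition graph_space :: "('v,'e) pre_digraph \<Rightarrow> ('v,'e) point topology" where
  "graph_space G = topology (\<lambda>U. U \<subseteq> graph_points G \<and>
     (\<forall>e\<in>arcs G. openin (top_of_set {0..1}) {t \<in> {0..1}. edge_point G e t \<in> U}))"

lemma openin_graph_space:
  "openin (graph_space G) U \<longleftrightarrow> U \<subseteq> graph_points G \<and>
     (\<forall>e\<in>arcs G. openin (top_of_set {0..1}) {t \<in> {0..1}. edge_point G e t \<in> U})"
proof -
  let ?pre = "\<lambda>e U. {t \<in> {0..1::real}. edge_point G e t \<in> U}"
  have "?pre e (U \<inter> V) = ?pre e U \<inter> ?pre e V" for e U V by auto
  moreover have "?pre e (\<Union>K) = (\<Union>U\<in>K. ?pre e U)" for e K by auto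
  ultimately have "istopology (\<lambda>U. U \<subseteq> graph_points G \<and>
     (\<forall>e\<in>arcs G. openin (top_of_set {0..1}) (?pre e U)))"
    unfolding istopology_def by (intro conjI allI impI) (auto intro!: openin_Int openin_Union)
  then show ?thesis
    unfolding graph_space_def by (simp add: topology_inverse')
qed

lemma topspace_graph_space:
  assumes "wf_digraph G"
  shows "topspace (graph_space G) = graph_points G"
proof -
  have "{t \<in> {0..1}. edge_point G e t \<in> graph_points G} = {0..1}" if "e \<in> arcs G" for e
    using that wf_digraph.wellformed[OF assms that]
    by (auto simp: edge_point_def graph_points_def)
  then have "openin (graph_space G) (graph_points G)"
    by (auto simp: openin_graph_space)
  then show ?thesis
    by (metis openin_graph_space openin_subset openin_topspace subset_antisym)
qed


section \<open>Ends and the Freudenthal compactification\<close>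

text \<open>A ray is recorded by its sequence of vertices; the choice among parallel edges does not
  affect the end it belongs to.\<close>

definition ray :: "('v,'e) pre_digraph \<Rightarrow> (nat \<Rightarrow> 'v) \<Rightarrow> bool" where
  "ray G r \<longleftrightarrow> inj r \<and> (\<forall>i. r i \<rightarrow>\<^bsub>with_proj (mk_symmetric G)\<^esub> r (Suc i))"

definition tail_in :: "(nat \<Rightarrow> 'v) \<Rightarrow> 'v set \<Rightarrow> bool" where
  "tail_in r C \<longleftrightarrow> (\<exists>m. \<forall>i\<ge>m. r i \<in> C)"

text \<open>A finite \<open>S\<close> separates two rays if they have tails in different components of \<open>G - S\<close>.\<close>

definition separates_rays ::
    "('v,'e) pre_digraph \<Rightarrow> 'v set \<Rightarrow> (nat \<Rightarrow> 'v) \<Rightarrow> (nat \<Rightarrow> 'v) \<Rightarrow> bool" where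
  "separates_rays G S r r' \<longleftrightarrow>
     (\<exists>C\<in>components_minus G S. \<exists>C'\<in>components_minus G S. C \<noteq> C' \<and> tail_in r C \<and> tail_in r' C')"

definition ray_equiv :: "('v,'e) pre_digraph \<Rightarrow> (nat \<Rightarrow> 'v) rel" where
  "ray_equiv G = {(r, r'). ray G r \<and> ray G r' \<and>
     \<not> (\<exists>S. finite S \<and> S \<subseteq> verts G \<and> separates_rays G S r r')}"

definition graph_ends :: "('v,'e) pre_digraph \<Rightarrow> (nat \<Rightarrow> 'v) set set" where
  "graph_ends G = {r. ray G r} // ray_equiv G"

definition end_component :: "('v,'e) pre_digraph \<Rightarrow> 'v set \<Rightarrow> (nat \<Rightarrow> 'v) set \<Rightarrow> 'v set" where
  "end_component G S \<omega> = (THE C. C \<in> components_minus G S \<and> (\<forall>r\<in>\<omega>. tail_in r C))"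

text \<open>An edge with an endpoint in the component \<open>C\<close> of \<open>G - S\<close> has its other endpoint in \<open>C\<close> or
  in \<open>S\<close>; so the second set below consists of the interiors of the edges of \<open>C\<close> and of the edges
  between \<open>S\<close> and \<open>C\<close>.\<close>

definition end_nbhd ::
    "('v,'e) pre_digraph \<Rightarrow> 'v set \<Rightarrow> (nat \<Rightarrow> 'v) set \<Rightarrow> ('v,'e) point set" where
  "end_nbhd G S \<omega> = (let C = end_component G S \<omega> in
     Vertex ` C
     \<union> {Inner e t | e t. e \<in> arcs G \<and> (tail G e \<in> C \<or> head G e \<in> C) \<and> 0 < t \<and> t < 1}
     \<union> {End \<eta> | \<eta>. \<eta> \<in> graph_ends G \<and> (\<exists>r\<in>\<eta>. range r \<subseteq> C)})"

definition freudenthal :: "('v,'e) pre_digraph \<Rightarrow> ('v,'e) point topology" where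
  "freudenthal G = topology_generated_by
     ({U. openin (graph_space G) U} \<union>
      {end_nbhd G S \<omega> | S \<omega>. finite S \<and> S \<subseteq> verts G \<and> \<omega> \<in> graph_ends G})"


section \<open>Arcs and \<open>n\<close>-arc connectedness\<close>

definition arc_in :: "'a topology \<Rightarrow> 'a set \<Rightarrow> bool" where
  "arc_in X A \<longleftrightarrow>
     A \<subseteq> topspace X \<and> subtopology X A homeomorphic_space top_of_set {0..1::real}"

definition n_ac_pair :: "nat \<Rightarrow> 'a set \<Rightarrow> 'a topology \<Rightarrow> bool" where
  "n_ac_pair n S X \<longleftrightarrow>
     (\<forall>F. F \<subseteq> S \<and> finite F \<and> card F \<le> n \<longrightarrow> (\<exists>A. arc_in X A \<and> F \<subseteq> A))"

definition n_ac :: "nat \<Rightarrow> 'a topology \<Rightarrow> bool" where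
  "n_ac n X \<longleftrightarrow> n_ac_pair n (topspace X) X"

end

theory Submission
  imports Defs "HOL-Library.Transitive_Closure_Table"
begin

text \<open>
  For (2) \<open>\<Longrightarrow>\<close> (3), let an arc of the compactification contain finitely many points of \<open>G\<close>.  The ends
  on one of its segments are covered by finitely many connected basic neighbourhoods that avoid
  the other segments, and the part of the segment between its first and its last point in the
  closure of such a neighbourhood can be replaced by a path in \<open>G\<close>.

  For (3) \<open>\<Longrightarrow>\<close> (1), ends are added to an arc one by one.  Given an end \<open>\<omega>\<close>, choose a component \<open>D\<close>
  around \<open>\<omega>\<close> whose boundary has least size among all smaller such components; by Menger's theorem
  disjoint rays to \<open>\<omega>\<close> start at all its boundary vertices.  Take an arc through a vertex of \<open>D\<close> in
  place of \<open>\<omega>\<close>.  Each piece of the arc in \<open>D\<close>, except those containing an end point of the arc, uses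
  up two boundary vertices, so two of the rays leave the arc for the last time on the same piece,
  unless the last point of a ray lies on a piece with an end point of the arc.  In either case the
  arc can be rerouted through \<open>\<omega>\<close>.
\<close>


section \<open>Arcs in topological spaces\<close>

text \<open>An arc of the compactification can run through infinitely many ends, so it has no
  description as a sequence of vertices. It is handled as a parametrised set, and all surgery
  consists of cutting at the last point on a closed set and joining pieces that meet in one point.

  When an end is added, the count of pieces against rays needs a surplus. If every piece of the arc
  in \<open>D\<close> were a single boundary vertex, each could hold the last point of exactly one
  ray and nothing would follow. The vertex of \<open>D\<close> standing in for \<omega> forces a
  larger piece, which uses two boundary vertices or contains an end point of the arc.

  The rays have last points on the arc other than \<omega> only if \<omega> is not on the arc. The
  induction over the ends therefore carries the invariant that the arc contains no ends except the
  given ones. Exchanging an end for a vertex does not increase the number of points, so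
  \<open>n\<close> stays fixed throughout.\<close>

definition arc_from_to :: "'a topology \<Rightarrow> 'a \<Rightarrow> 'a \<Rightarrow> 'a set \<Rightarrow> bool" where
  "arc_from_to X p q A \<longleftrightarrow>
     (\<exists>f a b. a \<le> (b::real) \<and> continuous_map (top_of_set {a..b}) X f \<and> inj_on f {a..b} \<and>
        f a = p \<and> f b = q \<and> A = f ` {a..b})"

lemma arc_from_toI:
  assumes "continuous_map (top_of_set {a..b}) X f" "inj_on f {a..b}" "a \<le> (b::real)"
  shows "arc_from_to X (f a) (f b) (f ` {a..b})"
  using assms unfolding arc_from_to_def by blast

lemma arc_from_to_ends: "arc_from_to X p q A \<Longrightarrow> p \<in> A \<and> q \<in> A"
  unfolding arc_from_to_def by force

lemma arc_from_to_subset: "arc_from_to X p q A \<Longrightarrow> A \<subseteq> topspace X"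
  unfolding arc_from_to_def continuous_map_def by auto

lemma arc_from_to_subtopology:
  "arc_from_to (subtopology X S) p q A \<longleftrightarrow> arc_from_to X p q A \<and> A \<subseteq> S"
proof
  assume "arc_from_to (subtopology X S) p q A"
  then obtain f a b where f: "a \<le> (b::real)" "continuous_map (top_of_set {a..b}) (subtopology X S) f"
    "inj_on f {a..b}" "f a = p" "f b = q" "A = f ` {a..b}"
    unfolding arc_from_to_def by blast
  then have "continuous_map (top_of_set {a..b}) X f" "A \<subseteq> S"
    by (auto simp: continuous_map_in_subtopology)
  with arc_from_toI[OF _ f(3,1)] f show "arc_from_to X p q A \<and> A \<subseteq> S" by blast
next
  assume *: "arc_from_to X p q A \<and> A \<subseteq> S"
  then obtain f a b where f: "a \<le> (b::real)" "continuous_map (top_of_set {a..b}) X f"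
    "inj_on f {a..b}" "f a = p" "f b = q" "A = f ` {a..b}"
    unfolding arc_from_to_def by blast
  then have "continuous_map (top_of_set {a..b}) (subtopology X S) f"
    using * by (auto simp: continuous_map_in_subtopology)
  with arc_from_toI[OF _ f(3,1)] f show "arc_from_to (subtopology X S) p q A" by blast
qed

lemma continuous_map_affine:
  assumes "continuous_map (top_of_set S) X f" "\<And>u. u \<in> T \<Longrightarrow> m * u + c \<in> S"
  shows "continuous_map (top_of_set T) X (\<lambda>u::real. f (m * u + c))"
proof -
  have "continuous_map (top_of_set T) (top_of_set S) (\<lambda>u. m * u + c)"
    using assms(2) by (auto intro!: continuous_intros)
  from continuous_map_compose[OF this assms(1)] show ?thesis
    by (simp add: o_def)
qed

lemma arc_from_to_sym:
  assumes "arc_from_to X p q A" shows "arc_from_to X q p A"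
proof -
  obtain f a b where f: "a \<le> (b::real)" "continuous_map (top_of_set {a..b}) X f" "inj_on f {a..b}"
    "f a = p" "f b = q" "A = f ` {a..b}"
    using assms unfolding arc_from_to_def by blast
  let ?g = "\<lambda>u. f ((-1) * u + 0)"
  have 1: "continuous_map (top_of_set {-b..-a}) X ?g"
    by (rule continuous_map_affine[OF f(2)]) auto
  have 2: "inj_on ?g {-b..-a}"
  proof (rule inj_onI)
    fix x y assume "x \<in> {-b..-a}" "y \<in> {-b..-a}" "?g x = ?g y"
    then show "x = y" using inj_onD[OF f(3), of "-x" "-y"] by auto
  qed
  have "?g ` {-b..-a} = f ` (uminus ` {-b..-a})"
    unfolding image_image by simp
  also have "\<dots> = A" using f(6) by simp
  finally show ?thesis
    using arc_from_toI[OF 1 2] f by auto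
qed

lemma arc_from_to_unit:
  assumes "arc_from_to X p q A" "p \<noteq> q"
  obtains f where "continuous_map (top_of_set {0..1::real}) X f" "inj_on f {0..1}"
    "f 0 = p" "f 1 = q" "A = f ` {0..1}"
proof -
  obtain f a b where f: "a \<le> (b::real)" "continuous_map (top_of_set {a..b}) X f" "inj_on f {a..b}"
    "f a = p" "f b = q" "A = f ` {a..b}"
    using assms unfolding arc_from_to_def by blast
  then have ab: "a < b" using assms(2) by (cases "a = b") auto
  have im: "(\<lambda>u. (b - a) * u + a) ` {0..1} = {a..b}"
    using ab by (simp add: image_affinity_atLeastAtMost)
  show thesis
  proof
    show "continuous_map (top_of_set {0..1::real}) X (\<lambda>u. f ((b - a) * u + a))"
      by (rule continuous_map_affine[OF f(2)]) (use im in blast)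
    show "inj_on (\<lambda>u. f ((b - a) * u + a)) {0..1}"
    proof (rule inj_onI)
      fix x y assume xy: "x \<in> {0..1}" "y \<in> {0..1}" "f ((b - a) * x + a) = f ((b - a) * y + a)"
      then have "(b - a) * x + a = (b - a) * y + a"
        using im by (intro inj_onD[OF f(3)]) blast+
      then show "x = y" using ab by simp
    qed
    show "A = (\<lambda>u. f ((b - a) * u + a)) ` {0..1}"
      using f(6) im by (metis image_image)
  qed (use f in auto)
qed

lemma arc_from_to_refl: "p \<in> topspace X \<Longrightarrow> arc_from_to X p p {p}"
  unfolding arc_from_to_def by (intro exI[of _ "\<lambda>_. p"] exI[of _ 0]) auto

lemma arc_from_to_join:
  assumes "arc_from_to X p q A" "arc_from_to X q r B" "A \<inter> B \<subseteq> {q}"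
  shows "arc_from_to X p r (A \<union> B)"
proof -
  obtain f a b where f: "a \<le> (b::real)" "continuous_map (top_of_set {a..b}) X f" "inj_on f {a..b}"
    "f a = p" "f b = q" "A = f ` {a..b}"
    using assms unfolding arc_from_to_def by blast
  obtain g c d where g: "c \<le> (d::real)" "continuous_map (top_of_set {c..d}) X g" "inj_on g {c..d}"
    "g c = q" "g d = r" "B = g ` {c..d}"
    using assms unfolding arc_from_to_def by blast
  define e where "e = b + (d - c)"
  define g' where "g' u = g (1 * u + (c - b))" for u
  have be: "b \<le> e" using g(1) by (simp add: e_def)
  have g'c: "continuous_map (top_of_set {b..e}) X g'" unfolding g'_def
    by (rule continuous_map_affine[OF g(2)]) (auto simp: e_def)
  have g'i: "inj_on g' {b..e}" unfolding g'_def
  proof (rule inj_onI)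
    fix x y assume "x \<in> {b..e}" "y \<in> {b..e}" "g (1 * x + (c - b)) = g (1 * y + (c - b))"
    then show "x = y" using inj_onD[OF g(3), of "x + (c - b)" "y + (c - b)"] by (auto simp: e_def)
  qed
  have g'b: "g' b = q" "g' e = r" using g by (auto simp: g'_def e_def)
  have "(\<lambda>u. 1 * u + (c - b)) ` {b..e} = {c..d}"
    using be by (subst image_affinity_atLeastAtMost) (auto simp: e_def)
  then have g'B: "g' ` {b..e} = B"
    unfolding g'_def using g(6) by (metis image_image)
  define h where "h u = (if u \<le> b then f u else g' u)" for u
  have s1: "{x \<in> topspace (top_of_set {a..e}). x \<le> b} = {a..b}" "{x \<in> topspace (top_of_set {a..e}). b \<le> x} = {b..e}"
    using be f(1) by auto
  have s2: "{a..e} \<inter> {a..b} = {a..b}" "{a..e} \<inter> {b..e} = {b..e}" using be f(1) by auto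
  have "continuous_map (top_of_set {a..e}) X h"
    unfolding h_def
  proof (rule continuous_map_cases_le)
    show "continuous_map (subtopology (top_of_set {a..e}) {x \<in> topspace (top_of_set {a..e}). x \<le> b}) X f"
      unfolding s1 subtopology_subtopology s2 by (rule f(2))
    show "continuous_map (subtopology (top_of_set {a..e}) {x \<in> topspace (top_of_set {a..e}). b \<le> x}) X g'"
      unfolding s1 subtopology_subtopology s2 by (rule g'c)
  qed (use f g'b in auto)
  moreover have "inj_on h {a..e}"
  proof (rule linorder_inj_onI)
    fix x y assume xy: "x < y" "x \<in> {a..e}" "y \<in> {a..e}"
    consider "y \<le> b" | "x \<le> b" "b < y" | "b < x" using xy by linarith
    then show "h x \<noteq> h y"
    proof cases
      case 1 then show ?thesis using xy inj_onD[OF f(3), of x y] by (auto simp: h_def)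
    next
      case 3 then show ?thesis using xy inj_onD[OF g'i, of x y] by (auto simp: h_def)
    next
      case 2
      show ?thesis
      proof
        assume eq: "h x = h y"
        have "h x \<in> A" using 2 xy f(6) by (auto simp: h_def)
        moreover have "h y \<in> B" using 2 xy g'B by (auto simp: h_def)
        ultimately have "h y = q" using eq assms(3) by auto
        then have "g' y = g' b" using 2 g'b by (auto simp: h_def)
        then show False using inj_onD[OF g'i, of y b] 2 xy be by auto
      qed
    qed
  qed auto
  moreover have "h a = p" using f by (simp add: h_def)
  moreover have "h e = r" using be g'b f by (cases "e = b") (auto simp: h_def)
  moreover have "h ` {a..e} = A \<union> B"
  proof -
    have "{a..e} = {a..b} \<union> {b..e}" using be f(1) by auto
    moreover have "h ` {a..b} = A" using f(6) by (auto simp: h_def)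
    moreover have "h ` {b..e} = g' ` {b..e}"
      by (intro image_cong) (use f(5) g'b in \<open>auto simp: h_def\<close>)
    ultimately show ?thesis using g'B by (simp add: image_Un)
  qed
  ultimately show ?thesis
    using arc_from_toI[of a e X h] be f(1) by auto
qed

section \<open>Arcs as compact subspaces\<close>

lemma arc_from_to_compactin:
  assumes "arc_from_to X p q A" shows "compactin X A"
proof -
  obtain f a b where f: "continuous_map (top_of_set {a..b::real}) X f" "A = f ` {a..b}"
    using assms unfolding arc_from_to_def by blast
  have "compactin (top_of_set {a..b}) {a..b}"
    by (simp add: compactin_subtopology)
  from image_compactin[OF this f(1)] f(2) show ?thesis by simp
qed

lemma arc_from_to_closedin: "\<lbrakk>Hausdorff_space X; arc_from_to X p q A\<rbrakk> \<Longrightarrow> closedin X A"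
  by (rule compactin_imp_closedin[OF _ arc_from_to_compactin])

text \<open>A continuous injection of a compact space into a Hausdorff space is an
  embedding.\<close>

lemma arc_from_to_imp_arc_in:
  assumes "Hausdorff_space X" "arc_from_to X p q A" "p \<noteq> q"
  shows "arc_in X A"
proof -
  obtain f where f: "continuous_map (top_of_set {0..1::real}) X f" "inj_on f {0..1}"
    "f 0 = p" "f 1 = q" "A = f ` {0..1}"
    by (rule arc_from_to_unit[OF assms(2,3)])
  have A: "A \<subseteq> topspace X" using assms(2) by (rule arc_from_to_subset)
  have "homeomorphic_map (top_of_set {0..1::real}) (subtopology X A) f"
  proof (rule continuous_imp_homeomorphic_map)
    show "continuous_map (top_of_set {0..1}) (subtopology X A) f"
      using f by (auto simp: continuous_map_in_subtopology)
    show "f ` topspace (top_of_set {0..1}) = topspace (subtopology X A)"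
      using f(5) A by auto
    show "inj_on f (topspace (top_of_set {0..1}))" using f(2) by simp
    show "compact_space (top_of_set {0..1::real})" by (simp add: compact_space_subtopology)
    show "Hausdorff_space (subtopology X A)" by (rule Hausdorff_space_subtopology[OF assms(1)])
  qed
  then have "top_of_set {0..1::real} homeomorphic_space subtopology X A"
    by (rule homeomorphic_map_imp_homeomorphic_space)
  then show ?thesis
    using A unfolding arc_in_def by (subst homeomorphic_space_sym) simp
qed

lemma arc_in_imp_arc_from_to:
  assumes "arc_in X A"
  obtains p q where "p \<noteq> q" "arc_from_to X p q A"
proof -
  have A: "A \<subseteq> topspace X" and "top_of_set {0..1::real} homeomorphic_space subtopology X A"
    using assms unfolding arc_in_def by (auto simp only: homeomorphic_space_sym[of "top_of_set {0..1::real}"])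
  then obtain f where f: "homeomorphic_map (top_of_set {0..1::real}) (subtopology X A) f"
    unfolding homeomorphic_space by (elim exE)
  have g: "continuous_map (top_of_set {0..1::real}) X f" "inj_on f {0..1}" "f ` {0..1} = A"
    using A homeomorphic_imp_continuous_map[OF f] homeomorphic_imp_injective_map[OF f]
      homeomorphic_imp_surjective_map[OF f]
    by (simp_all add: continuous_map_in_subtopology inf.absorb2)
  have "arc_from_to X (f 0) (f 1) A"
    using arc_from_toI[OF g(1,2)] g(3) by simp
  moreover have "f 0 \<noteq> f 1" using inj_onD[OF g(2), of 0 1] by auto
  ultimately show thesis by (rule that[rotated])
qed

section \<open>Cutting and concatenating arcs\<close>

lemma arc_from_to_split:
  assumes "arc_from_to X p q A" "x \<in> A"
  obtains B C where "arc_from_to X p x B" "arc_from_to X x q C" "A = B \<union> C" "B \<inter> C = {x}"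
proof -
  obtain f a b where f: "a \<le> (b::real)" "continuous_map (top_of_set {a..b}) X f" "inj_on f {a..b}"
    "f a = p" "f b = q" "A = f ` {a..b}"
    using assms unfolding arc_from_to_def by blast
  obtain t where t: "t \<in> {a..b}" "f t = x" using assms(2) unfolding f(6) by (elim imageE) simp
  then have at: "a \<le> t" "t \<le> b" by auto
  have sub: "continuous_map (top_of_set {c..d}) X f" "inj_on f {c..d}" if "a \<le> c" "d \<le> b" for c d
  proof -
    have "{c..d} \<subseteq> {a..b}" using that by auto
    then show "continuous_map (top_of_set {c..d}) X f" "inj_on f {c..d}"
      by (rule continuous_map_from_subtopology_mono[OF f(2)], rule inj_on_subset[OF f(3)])
  qed
  have U: "{a..b} = {a..t} \<union> {t..b}" using t by auto
  show thesis
  proof (rule that)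
    show "arc_from_to X p x (f ` {a..t})" "arc_from_to X x q (f ` {t..b})"
      unfolding t(2)[symmetric] f(4,5)[symmetric]
      by (intro arc_from_toI sub order_refl at)+
    show "A = f ` {a..t} \<union> f ` {t..b}" using f(6) U by (simp add: image_Un)
    show "f ` {a..t} \<inter> f ` {t..b} = {x}"
      using t by (auto dest!: inj_onD[OF f(3)])
  qed
qed

text \<open>The parameters of the points in \<open>K\<close> form a nonempty compact set, so there
  is a greatest one. First points on \<open>K\<close> are found by applying this to the reversed
  arc.\<close>

lemma arc_from_to_last_hit:
  assumes "arc_from_to X p q A" "closedin X K" "A \<inter> K \<noteq> {}"
  obtains x B C where "arc_from_to X p x B" "arc_from_to X x q C" "A = B \<union> C" "B \<inter> C = {x}" "C \<inter> K = {x}"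
proof -
  obtain f a b where f: "a \<le> (b::real)" "continuous_map (top_of_set {a..b}) X f" "inj_on f {a..b}"
    "f a = p" "f b = q" "A = f ` {a..b}"
    using assms unfolding arc_from_to_def by blast
  define T where "T = {t \<in> {a..b}. f t \<in> K}"
  have "closedin (top_of_set {a..b}) T"
    using closedin_continuous_map_preimage[OF f(2) assms(2)] by (simp add: T_def)
  then have "compact T" by (rule closedin_compact[OF compact_Icc])
  moreover have "T \<noteq> {}" using assms(3) f(6) by (auto simp: T_def)
  ultimately obtain t where t: "t \<in> T" "\<And>s. s \<in> T \<Longrightarrow> s \<le> t"
    using compact_attains_sup[of T] by blast
  have tab: "a \<le> t" "t \<le> b" "f t \<in> K" using t by (auto simp: T_def)
  have sub: "continuous_map (top_of_set {c..d}) X f" "inj_on f {c..d}" if "a \<le> c" "d \<le> b" for c d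
  proof -
    have "{c..d} \<subseteq> {a..b}" using that by auto
    then show "continuous_map (top_of_set {c..d}) X f" "inj_on f {c..d}"
      by (rule continuous_map_from_subtopology_mono[OF f(2)], rule inj_on_subset[OF f(3)])
  qed
  have U: "{a..b} = {a..t} \<union> {t..b}" using tab by auto
  show thesis
  proof (rule that)
    show "arc_from_to X p (f t) (f ` {a..t})" "arc_from_to X (f t) q (f ` {t..b})"
      unfolding f(4,5)[symmetric] by (intro arc_from_toI sub order_refl tab)+
    show "A = f ` {a..t} \<union> f ` {t..b}" using f(6) U by (simp add: image_Un)
    show "f ` {a..t} \<inter> f ` {t..b} = {f t}"
      using tab by (auto dest!: inj_onD[OF f(3)])
    have "s = t" if "s \<in> {t..b}" "f s \<in> K" for s
      using t(2)[of s] that tab by (auto simp: T_def)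
    moreover have "t \<in> {t..b}" using tab by simp
    ultimately show "f ` {t..b} \<inter> K = {f t}" using tab(3) by blast
  qed
qed

text \<open>Follow \<open>A\<close> to the last point of \<open>B\<close> on it, then the rest of
  \<open>B\<close>.\<close>

lemma arc_from_to_trans:
  assumes "Hausdorff_space X" "arc_from_to X p q A" "arc_from_to X q r B"
  obtains C where "arc_from_to X p r C" "C \<subseteq> A \<union> B"
proof -
  have "B \<inter> A \<noteq> {}" using arc_from_to_ends[OF assms(2)] arc_from_to_ends[OF assms(3)] by auto
  then obtain x B1 B2 where B: "arc_from_to X x r B2" "B = B1 \<union> B2" "B2 \<inter> A = {x}"
    by (rule arc_from_to_last_hit[OF assms(3) arc_from_to_closedin[OF assms(1,2)]])
  then have "x \<in> A" by auto
  then obtain A1 A2 where A: "arc_from_to X p x A1" "A = A1 \<union> A2"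
    by (rule arc_from_to_split[OF assms(2)])
  have "A1 \<inter> B2 \<subseteq> {x}" using A(2) B(3) by auto
  from arc_from_to_join[OF A(1) B(1) this] have "arc_from_to X p r (A1 \<union> B2)" .
  moreover have "A1 \<union> B2 \<subseteq> A \<union> B" using A(2) B(2) by auto
  ultimately show thesis by (rule that)
qed


section \<open>Menger's theorem\<close>

lemma rtrancl_path_mono:
  assumes "rtrancl_path r x xs y" "\<And>u w. w \<in> set xs \<Longrightarrow> r u w \<Longrightarrow> r' u w"
  shows "rtrancl_path r' x xs y"
  using assms by (induction rule: rtrancl_path.induct) (auto intro: rtrancl_path.intros)

lemma augment_along_path:
  assumes "rtrancl_path (\<lambda>u w. w \<in> L \<and> \<phi> w \<in> M u) x xs u" "distinct (x # xs)" "x \<notin> L"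
    "inj_on \<phi> L" "\<And>v. v \<in> L \<Longrightarrow> \<phi> v \<in> M v" "z \<in> M u" "z \<notin> \<phi> ` L"
  shows "\<exists>\<phi>'. inj_on \<phi>' (insert x L) \<and> (\<forall>v\<in>insert x L. \<phi>' v \<in> M v) \<and>
           (\<forall>v. v \<notin> set (x # xs) \<longrightarrow> \<phi>' v = \<phi> v)"
  using assms
proof (induction xs arbitrary: x \<phi> L)
  case Nil
  then have "x = u" by (auto elim: rtrancl_path.cases)
  then show ?case
    using Nil by (intro exI[of _ "\<phi>(x := z)"]) (auto simp: inj_on_def)
next
  case (Cons y ys)
  from Cons.prems(1) have y: "y \<in> L" "\<phi> y \<in> M x" and
    path: "rtrancl_path (\<lambda>u w. w \<in> L \<and> \<phi> w \<in> M u) y ys u"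
    by (auto elim: rtrancl_path.cases)
  \<comment> \<open>After \<open>x\<close> has taken the image of \<open>y\<close>, the unmatched
    vertex is \<open>y\<close>. The rest of the path is still alternating because it avoids both
    \<open>x\<close> and \<open>y\<close>.\<close>
  define \<psi> where "\<psi> = \<phi>(x := \<phi> y)"
  define K where "K = insert x L - {y}"
  have xy: "x \<noteq> y" "x \<notin> set ys" "y \<notin> set ys" using Cons.prems(2) by auto
  have im: "\<psi> ` K = \<phi> ` L"
    using y(1) xy(1) Cons.prems(3) by (auto simp: \<psi>_def K_def)
  have "\<exists>\<phi>'. inj_on \<phi>' (insert y K) \<and> (\<forall>v\<in>insert y K. \<phi>' v \<in> M v) \<and>
           (\<forall>v. v \<notin> set (y # ys) \<longrightarrow> \<phi>' v = \<psi> v)"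
  proof (rule Cons.IH)
    show "rtrancl_path (\<lambda>u w. w \<in> K \<and> \<psi> w \<in> M u) y ys u"
      using path by (rule rtrancl_path_mono) (use xy in \<open>auto simp: \<psi>_def K_def\<close>)
    show "distinct (y # ys)" using Cons.prems(2) by simp
    show "y \<notin> K" by (simp add: K_def)
    show "inj_on \<psi> K"
      using Cons.prems(3,4) y(1) by (auto simp: \<psi>_def K_def inj_on_def)
    show "\<psi> v \<in> M v" if "v \<in> K" for v
      using that Cons.prems(5) y by (auto simp: \<psi>_def K_def)
    show "z \<in> M u" by fact
    show "z \<notin> \<psi> ` K" using im Cons.prems(7) by simp
  qed
  moreover have "insert y K = insert x L" using y(1) by (auto simp: K_def)
  ultimately obtain \<phi>' where "inj_on \<phi>' (insert x L)" "\<forall>v\<in>insert x L. \<phi>' v \<in> M v"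
    "\<forall>v. v \<notin> set (y # ys) \<longrightarrow> \<phi>' v = \<psi> v" by metis
  then show ?case
    by (intro exI[of _ \<phi>']) (auto simp: \<psi>_def)
qed

text \<open>
  Menger's theorem, with a linkage from \<open>X\<close> to \<open>Y\<close> encoded as an injection \<open>\<phi>\<close> of \<open>H - Y\<close> into
  \<open>H - X\<close>: the orbits of the points of \<open>X\<close> under \<open>\<phi>\<close> are disjoint paths, and unused vertices are
  fixed points.  In this form the theorem is the augmenting path argument for bipartite
  matchings, and \<open>H\<close> may be infinite.
\<close>

lemma menger_injection:
  fixes N :: "'v \<Rightarrow> 'v set"
  assumes X: "finite X" "X \<subseteq> H - Y"
    and cut: "\<And>R. \<lbrakk>R \<subseteq> H - Y; finite ((\<Union>v\<in>R. N v) \<inter> H - R - X)\<rbrakk>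
               \<Longrightarrow> card (X \<inter> R) \<le> card ((\<Union>v\<in>R. N v) \<inter> H - R - X)"
  obtains \<phi> where "inj_on \<phi> (H - Y)" "\<And>v. v \<in> H - Y \<Longrightarrow> \<phi> v \<in> insert v (N v) \<inter> (H - X)"
    "finite {v. \<phi> v \<noteq> v}"
proof -
  define M where "M v = insert v (N v) \<inter> (H - X)" for v
  \<comment> \<open>The vertices of \<open>X\<close> are matched one at a time, starting from the
    identity off \<open>X\<close>; those in \<open>X - X'\<close> are not yet in the domain.\<close>
  have "\<exists>\<phi>. inj_on \<phi> (H - Y - (X - X')) \<and> (\<forall>v\<in>H - Y - (X - X'). \<phi> v \<in> M v) \<and> finite {v. \<phi> v \<noteq> v}"
    if "finite X'" "X' \<subseteq> X" for X'
    using that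
  proof (induction X' rule: finite_induct)
    case empty
    show ?case
      by (intro exI[of _ id]) (auto simp: M_def)
  next
    case (insert x X')
    define L where "L = H - Y - (X - X')"
    have xL: "x \<notin> L" and L': "H - Y - (X - insert x X') = insert x L"
      using insert X by (auto simp: L_def)
    obtain \<phi> where \<phi>: "inj_on \<phi> L" "\<And>v. v \<in> L \<Longrightarrow> \<phi> v \<in> M v" "finite {v. \<phi> v \<noteq> v}"
      using insert unfolding L_def by auto
    define step where "step = (\<lambda>u w. w \<in> L \<and> \<phi> w \<in> M u)"
    define R where "R = {u. step\<^sup>*\<^sup>* x u}"
    show ?case
    proof (cases "\<exists>u\<in>R. \<exists>z\<in>M u. z \<notin> \<phi> ` L")
      case True
      then obtain u z where u: "step\<^sup>*\<^sup>* x u" "z \<in> M u" "z \<notin> \<phi> ` L" by (auto simp: R_def)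
      from u(1) obtain ys where "rtrancl_path step x ys u"
        by (auto simp: rtranclp_eq_rtrancl_path)
      then obtain xs where xs: "rtrancl_path step x xs u" "distinct (x # xs)"
        by (rule rtrancl_path_distinct)
      obtain \<phi>' where \<phi>': "inj_on \<phi>' (insert x L)" "\<forall>v\<in>insert x L. \<phi>' v \<in> M v"
        "\<forall>v. v \<notin> set (x # xs) \<longrightarrow> \<phi>' v = \<phi> v"
        using augment_along_path[OF xs(1)[unfolded step_def] xs(2) xL \<phi>(1,2) u(2,3)] by metis
      have "{v. \<phi>' v \<noteq> v} \<subseteq> {v. \<phi> v \<noteq> v} \<union> set (x # xs)" using \<phi>'(3) by auto
      then have "finite {v. \<phi>' v \<noteq> v}" using \<phi>(3) by (auto intro: finite_subset)
      then show ?thesis using \<phi>' unfolding L' by blast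
    next
      case False
      define D where "D = (\<Union>v\<in>R. N v) \<inter> H - R - X"
      \<comment> \<open>\<open>R\<close> may be infinite; the count is made finite by restricting it
        to the vertices that \<phi> moves.\<close>
      define Mv where "Mv = {w \<in> R - {x}. \<phi> w \<noteq> w}"
      have RL: "R - {x} \<subseteq> L"
      proof
        fix w assume "w \<in> R - {x}"
        then have "step\<^sup>*\<^sup>* x w" "w \<noteq> x" by (auto simp: R_def)
        then show "w \<in> L" by (cases rule: rtranclp.cases) (auto simp: step_def)
      qed
      have xR: "x \<in> R" by (auto simp: R_def)
      have closed: "\<exists>w\<in>R - {x}. \<phi> w = z" if z: "u \<in> R" "z \<in> M u" for u z
      proof -
        obtain w where w: "w \<in> L" "z = \<phi> w" using False z by blast
        then have "step u w" using z by (simp add: step_def)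
        then have "w \<in> R" using z(1) by (auto simp: R_def)
        then show ?thesis using w xL by auto
      qed
      have RH: "R \<subseteq> H - Y" using RL X insert.prems by (auto simp: L_def)
      have finM: "finite Mv" by (rule finite_subset[OF _ \<phi>(3)]) (auto simp: Mv_def)
      \<comment> \<open>All these points are allowed images of vertices in \<open>R\<close>, hence
        used by some \<open>w\<close> in \<open>R\<close>. This \<open>w\<close> is moved: a fixed
        one would lie in \<open>R\<close>, unlike the points of \<open>D\<close>, and be unmoved,
        unlike those of \<open>Mv\<close>.\<close>
      have "D \<union> (Mv - X) \<subseteq> \<phi> ` Mv"
      proof
        fix z assume z: "z \<in> D \<union> (Mv - X)"
        obtain u where u: "u \<in> R" "z \<in> M u"
          using z RH by (auto simp: D_def Mv_def M_def)
        obtain w where w: "w \<in> R - {x}" "\<phi> w = z" using closed[OF u] by blast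
        have "w \<noteq> z" using z w by (auto simp: D_def Mv_def)
        then show "z \<in> \<phi> ` Mv" using w by (auto simp: Mv_def)
      qed
      then have sub: "card (D \<union> (Mv - X)) \<le> card Mv"
        using finM card_image_le[OF finM, of \<phi>] card_mono[of "\<phi> ` Mv" "D \<union> (Mv - X)"] by simp
      have finD: "finite D"
        using finite_subset[OF \<open>D \<union> (Mv - X) \<subseteq> \<phi> ` Mv\<close>] finM by simp
      have "card D + card (Mv - X) = card (D \<union> (Mv - X))"
        using finD finM by (subst card_Un_disjoint) (auto simp: D_def Mv_def)
      moreover have "card Mv = card (Mv - X) + card (Mv \<inter> X)"
        using finM by (metis add.commute card_Int_Diff)
      ultimately have "card D \<le> card (Mv \<inter> X)" using sub by linarith
      \<comment> \<open>Strict because of \<open>x\<close>, which belongs to \<open>X\<close> and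
        \<open>R\<close> but is excluded from \<open>Mv\<close>.\<close>
      also have "\<dots> < card (X \<inter> R)"
        using X(1) xR insert.prems by (intro psubset_card_mono) (auto simp: Mv_def)
      finally have "card D < card (X \<inter> R)" .
      then show ?thesis using cut[OF RH] finD unfolding D_def by fastforce
    qed
  qed
  from this[OF X(1) order_refl] show thesis
    using that unfolding M_def by auto
qed


section \<open>Regions and ends\<close>

lemma rtrancl_on_eq_rtrancl:
  assumes "r \<subseteq> F \<times> F"
  shows "(u, v) \<in> rtrancl_on F r \<longleftrightarrow> u \<in> F \<and> (u, v) \<in> r\<^sup>*"
proof
  assume "(u, v) \<in> rtrancl_on F r"
  then show "u \<in> F \<and> (u, v) \<in> r\<^sup>*"
    by (induction rule: rtrancl_on.induct) auto
next
  assume *: "u \<in> F \<and> (u, v) \<in> r\<^sup>*"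
  then have "(u, v) \<in> r\<^sup>*" "u \<in> F" by auto
  then show "(u, v) \<in> rtrancl_on F r"
    by (induction rule: rtrancl_induct)
      (use assms in \<open>auto intro: rtrancl_on_into_rtrancl_on\<close>)
qed

locale lf_graph = wf_digraph G for G :: "('v, 'e) pre_digraph" +
  assumes lf: "locally_finite G" and conn: "Digraph_Component.connected G"
begin

section \<open>Adjacency, boundaries and reachability\<close>

definition adj :: "'v \<Rightarrow> 'v \<Rightarrow> bool" where
  "adj u v \<longleftrightarrow> (\<exists>e\<in>arcs G. tail G e = u \<and> head G e = v \<or> tail G e = v \<and> head G e = u)"

definition boundary :: "'v set \<Rightarrow> 'v set" where
  "boundary D = {w \<in> verts G - D. \<exists>v\<in>D. adj v w}"

text \<open>The closure is reflexive outside \<open>P\<close> as well, so membership in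
  \<open>P\<close> is carried along separately.\<close>

definition reach :: "'v set \<Rightarrow> 'v rel" where
  "reach P = {(u, v). u \<in> P \<and> v \<in> P \<and> adj u v}\<^sup>*"

definition connset :: "'v set \<Rightarrow> bool" where
  "connset D \<longleftrightarrow> D \<noteq> {} \<and> D \<subseteq> verts G \<and> (\<forall>u\<in>D. \<forall>v\<in>D. (u, v) \<in> reach D)"

definition comp :: "'v set \<Rightarrow> 'v \<Rightarrow> 'v set" where
  "comp S v = {w. (v, w) \<in> reach (verts G - S)}"

text \<open>Vertex sets with finite boundary take over the role of the components of
  \<open>G - S\<close>: they separate the same rays, and no set \<open>S\<close> has to be
  mentioned.\<close>

definition region :: "'v set \<Rightarrow> bool" where
  "region D \<longleftrightarrow> D \<subseteq> verts G \<and> finite (boundary D)"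

text \<open>For a region it does not matter which ray of the end is tested; see
  \<open>in_end_iff\<close>.\<close>

definition in_end :: "(nat \<Rightarrow> 'v) set \<Rightarrow> 'v set \<Rightarrow> bool" where
  "in_end \<omega> D \<longleftrightarrow> (\<exists>r\<in>\<omega>. tail_in r D)"

lemma adj_sym: "adj u v \<Longrightarrow> adj v u"
  by (auto simp: adj_def)

lemma adj_verts: "adj u v \<Longrightarrow> u \<in> verts G \<and> v \<in> verts G"
  by (auto simp: adj_def)

lemma dominates_iff_adj: "u \<rightarrow>\<^bsub>with_proj (mk_symmetric G)\<^esub> v \<longleftrightarrow> adj u v"
  by (auto simp: parcs_mk_symmetric adj_def)

lemma ray_iff: "ray G r \<longleftrightarrow> inj r \<and> (\<forall>i. adj (r i) (r (Suc i)))"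
  unfolding ray_def dominates_iff_adj ..

lemma finite_adj: "finite {w. adj v w}"
proof (cases "v \<in> verts G")
  case True
  then have "finite (in_arcs G v \<union> out_arcs G v)" using lf by (simp add: locally_finite_def)
  moreover have "{w. adj v w} \<subseteq> tail G ` (in_arcs G v \<union> out_arcs G v) \<union> head G ` (in_arcs G v \<union> out_arcs G v)"
    by (auto simp: adj_def in_arcs_def out_arcs_def)
  ultimately show ?thesis by (meson finite_UnI finite_imageI finite_subset)
next
  case False
  then have "{w. adj v w} = {}" using adj_verts by blast
  then show ?thesis by simp
qed

lemma finite_boundary: "finite D \<Longrightarrow> finite (boundary D)"
  by (rule finite_subset[of _ "\<Union>v\<in>D. {w. adj v w}"]) (auto simp: boundary_def finite_adj)

lemma reach_sym: "(u, v) \<in> reach P \<Longrightarrow> (v, u) \<in> reach P"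
proof -
  have "sym {(u, v). u \<in> P \<and> v \<in> P \<and> adj u v}" by (auto intro!: symI adj_sym)
  then show "(u, v) \<in> reach P \<Longrightarrow> (v, u) \<in> reach P"
    unfolding reach_def by (meson sym_rtrancl symD)
qed

lemma reach_trans: "(u, v) \<in> reach P \<Longrightarrow> (v, w) \<in> reach P \<Longrightarrow> (u, w) \<in> reach P"
  unfolding reach_def by (rule rtrancl_trans)

lemma reach_step: "u \<in> P \<Longrightarrow> v \<in> P \<Longrightarrow> adj u v \<Longrightarrow> (u, v) \<in> reach P"
  unfolding reach_def by (rule r_into_rtrancl) auto

lemma reach_refl: "(u, u) \<in> reach P"
  by (simp add: reach_def)

lemma reach_mem: "(u, v) \<in> reach P \<Longrightarrow> u \<in> P \<Longrightarrow> v \<in> P"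
  unfolding reach_def by (induction rule: rtrancl_induct) auto

lemma reach_invariant:
  assumes "(u, v) \<in> reach P" "u \<in> D" "\<And>a b. a \<in> D \<Longrightarrow> a \<in> P \<Longrightarrow> b \<in> P \<Longrightarrow> adj a b \<Longrightarrow> b \<in> D"
  shows "v \<in> D"
  using assms(1,2) unfolding reach_def by (induction rule: rtrancl_induct) (use assms(3) in auto)

lemma reachable_mk_symmetric:
  assumes "P \<subseteq> verts G"
  shows "u \<rightarrow>\<^sup>*\<^bsub>with_proj (mk_symmetric (G \<restriction> P))\<^esub> v \<longleftrightarrow> u \<in> P \<and> (u, v) \<in> reach P"
proof -
  have eq: "arcs_ends (with_proj (mk_symmetric (G \<restriction> P))) = {(u, v). u \<in> P \<and> v \<in> P \<and> adj u v}"
    by (auto simp: parcs_mk_symmetric adj_def)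
  show ?thesis
    unfolding reachable_def eq reach_def
    by (simp add: rtrancl_on_eq_rtrancl[of _ P] subset_iff)
qed

lemma connset_verts: "connset (verts G)"
proof -
  have "{e \<in> arcs G. tail G e \<in> verts G \<and> head G e \<in> verts G} = arcs G" by auto
  then have G: "G \<restriction> verts G = G" by (simp add: induce_subgraph_def)
  have "verts G \<noteq> {}" using conn by (auto simp: connected_def strongly_connected_def)
  moreover have "u \<rightarrow>\<^sup>*\<^bsub>with_proj (mk_symmetric G)\<^esub> v" if "u \<in> verts G" "v \<in> verts G" for u v
    using conn that by (auto simp: connected_def strongly_connected_def)
  ultimately show ?thesis
    using reachable_mk_symmetric[of "verts G"] unfolding connset_def G by auto
qed

section \<open>Components after deleting vertices\<close>

lemma comp_subset: "v \<in> verts G - S \<Longrightarrow> comp S v \<subseteq> verts G - S"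
  using reach_mem by (auto simp: comp_def)

lemma comp_eq: "w \<in> comp S v \<Longrightarrow> comp S w = comp S v"
  unfolding comp_def using reach_sym reach_trans by blast

lemma comp_disjoint: "comp S v = comp S w \<or> comp S v \<inter> comp S w = {}"
  using comp_eq by blast

lemma comp_self: "v \<in> comp S v"
  by (simp add: comp_def reach_refl)

lemma boundary_comp: "boundary (comp S v) \<subseteq> S" if "v \<in> verts G - S"
proof
  fix w assume w: "w \<in> boundary (comp S v)"
  then obtain u where u: "u \<in> comp S v" "adj u w" "w \<in> verts G" "w \<notin> comp S v"
    by (auto simp: boundary_def)
  show "w \<in> S"
  proof (rule ccontr)
    assume "w \<notin> S"
    then have "(u, w) \<in> reach (verts G - S)"
      using comp_subset[OF that] u by (intro reach_step) auto
    then show False using u by (auto simp: comp_def intro: reach_trans)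
  qed
qed

lemma connset_comp:
  assumes "v \<in> verts G - S" shows "connset (comp S v)"
proof -
  have *: "(v, w) \<in> reach (comp S v)" if "w \<in> comp S v" for w
    using that[unfolded comp_def, simplified]
    unfolding reach_def[of "verts G - S"]
  proof (induction rule: rtrancl_induct)
    case base show ?case by (rule reach_refl)
  next
    case (step y z)
    have "(v, y) \<in> reach (verts G - S)" using step(1) by (simp add: reach_def)
    moreover have "(y, z) \<in> reach (verts G - S)" using step(2) by (auto intro: reach_step)
    ultimately have "y \<in> comp S v" "z \<in> comp S v"
      by (auto simp: comp_def intro: reach_trans)
    then have "(y, z) \<in> reach (comp S v)" using step(2) by (auto intro: reach_step)
    with step(3) show ?case by (rule reach_trans)
  qed
  show ?thesis unfolding connset_def
  proof (intro conjI ballI)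
    show "comp S v \<noteq> {}" using comp_self by auto
    show "comp S v \<subseteq> verts G" using comp_subset[OF assms] by auto
    show "(a, b) \<in> reach (comp S v)" if "a \<in> comp S v" "b \<in> comp S v" for a b
      using reach_trans[OF reach_sym[OF *[OF that(1)]] *[OF that(2)]] .
  qed
qed

lemma components_minus_eq: "components_minus G S = comp S ` (verts G - S)"
proof -
  let ?H = "with_proj (mk_symmetric (G \<restriction> (verts G - S)))"
  have r: "u \<rightarrow>\<^sup>*\<^bsub>?H\<^esub> v \<longleftrightarrow> u \<in> verts G - S \<and> v \<in> comp S u" for u v
    using reachable_mk_symmetric[of "verts G - S"] by (auto simp: comp_def)
  show ?thesis
  proof (intro set_eqI iffI)
    fix C assume "C \<in> components_minus G S"
    then have C: "C \<noteq> {}" "\<And>u v. u \<in> C \<Longrightarrow> v \<in> C \<Longrightarrow> u \<rightarrow>\<^sup>*\<^bsub>?H\<^esub> v"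
      "\<And>u v. u \<in> C \<Longrightarrow> v \<notin> C \<Longrightarrow> \<not> u \<rightarrow>\<^sup>*\<^bsub>?H\<^esub> v \<or> \<not> v \<rightarrow>\<^sup>*\<^bsub>?H\<^esub> u"
      unfolding components_minus_def pre_digraph.sccs_verts_def by blast+
    then obtain u where u: "u \<in> C" by auto
    have uV: "u \<in> verts G - S" using C(2)[OF u u] r by blast
    have "C = comp S u"
    proof (intro set_eqI iffI)
      fix w assume "w \<in> C" then show "w \<in> comp S u" using C(2)[OF u] r by blast
    next
      fix w assume w: "w \<in> comp S u"
      then have "u \<in> comp S w" using comp_eq[OF w] comp_self[of u S] by simp
      moreover have "w \<in> verts G - S" using w comp_subset[OF uV] by auto
      ultimately show "w \<in> C" using C(3)[OF u] w uV r by blast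
    qed
    then show "C \<in> comp S ` (verts G - S)" using uV by auto
  next
    fix C assume "C \<in> comp S ` (verts G - S)"
    then obtain u where u: "u \<in> verts G - S" "C = comp S u" by auto
    have 1: "a \<rightarrow>\<^sup>*\<^bsub>?H\<^esub> b" if "a \<in> C" "b \<in> C" for a b
      using that comp_eq comp_subset[OF u(1)] u(2) r by auto
    have 2: "b \<in> C" if "a \<in> C" "a \<rightarrow>\<^sup>*\<^bsub>?H\<^esub> b" for a b
      using that comp_eq u(2) r by auto
    show "C \<in> components_minus G S"
      unfolding components_minus_def pre_digraph.sccs_verts_def
      using 1 2 u(2) comp_self by blast
  qed
qed

text \<open>A path inside \<open>C\<close> can leave \<open>D\<close> only through
  \<open>boundary D\<close>.\<close>

lemma connset_cases:
  assumes "connset C" "C \<inter> boundary D = {}"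
  shows "C \<subseteq> D \<or> C \<inter> D = {}"
proof (rule disjCI)
  assume "C \<inter> D \<noteq> {}"
  then obtain a where a: "a \<in> C" "a \<in> D" by auto
  show "C \<subseteq> D"
  proof
    fix b assume b: "b \<in> C"
    have "(a, b) \<in> reach C" using assms a b by (auto simp: connset_def)
    then show "b \<in> D"
    proof (rule reach_invariant)
      fix x y assume "x \<in> D" "x \<in> C" "y \<in> C" "adj x y"
      then show "y \<in> D" using assms(2) adj_verts[of x y] by (auto simp: boundary_def)
    qed (rule a)
  qed
qed

section \<open>Rays and their tails\<close>

lemma ray_verts: "ray G r \<Longrightarrow> r i \<in> verts G"
  using adj_verts by (auto simp: ray_iff)

lemma ray_shift: "ray G r \<Longrightarrow> ray G (\<lambda>i. r (i + m))"
  unfolding ray_iff inj_def by (metis add_Suc add_right_cancel)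

lemma ray_eventually_avoids:
  assumes "ray G r" "finite S"
  obtains m where "\<And>i. m \<le> i \<Longrightarrow> r i \<notin> S"
proof -
  have "finite (r -` S)" using assms by (auto simp: ray_iff intro: finite_vimageI)
  then obtain m where "\<forall>i\<in>r -` S. i < m" using finite_nat_set_iff_bounded by auto
  then show thesis using that[of m] by (metis not_le vimageI)
qed

lemma ray_tail_comp:
  assumes "ray G r" "finite S"
  obtains m where "r m \<in> verts G - S" "\<And>i. m \<le> i \<Longrightarrow> r i \<in> comp S (r m)"
proof -
  obtain m where m: "\<And>i. m \<le> i \<Longrightarrow> r i \<notin> S"
    using ray_eventually_avoids[OF assms] by blast
  show thesis
  proof (rule that)
    show "r m \<in> verts G - S" using m ray_verts[OF assms(1)] by auto
    fix i assume "m \<le> i"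
    then show "r i \<in> comp S (r m)"
    proof (induction rule: dec_induct)
      case (step n)
      have "(r n, r (Suc n)) \<in> reach (verts G - S)"
        using assms(1) m step ray_verts[OF assms(1)] by (intro reach_step) (auto simp: ray_iff)
      then show ?case using step by (auto simp: comp_def intro: reach_trans)
    qed (rule comp_self)
  qed
qed

lemma tail_in_mono: "tail_in r C \<Longrightarrow> C \<subseteq> D \<Longrightarrow> tail_in r D"
  unfolding tail_in_def by blast

lemma tail_in_Int: "tail_in r C \<Longrightarrow> tail_in r D \<Longrightarrow> tail_in r (C \<inter> D)"
proof -
  assume "tail_in r C" "tail_in r D"
  then obtain m n where "\<forall>i\<ge>m. r i \<in> C" "\<forall>i\<ge>n. r i \<in> D" by (auto simp: tail_in_def)
  then show ?thesis unfolding tail_in_def by (intro exI[of _ "max m n"]) auto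
qed

lemma tail_in_nonempty: "tail_in r C \<Longrightarrow> C \<noteq> {}"
  by (auto simp: tail_in_def)

lemma ray_component:
  assumes "ray G r" "finite S"
  obtains C where "C \<in> components_minus G S" "tail_in r C"
proof -
  obtain m where "r m \<in> verts G - S" "\<And>i. m \<le> i \<Longrightarrow> r i \<in> comp S (r m)"
    using ray_tail_comp[OF assms] by blast
  then show thesis using that by (auto simp: components_minus_eq tail_in_def)
qed

lemma components_minusD:
  assumes "C \<in> components_minus G S"
  shows "connset C" "C \<subseteq> verts G - S" "boundary C \<subseteq> S"
proof -
  obtain v where "v \<in> verts G - S" "C = comp S v" using assms by (auto simp: components_minus_eq)
  then show "connset C" "C \<subseteq> verts G - S" "boundary C \<subseteq> S"
    using connset_comp comp_subset boundary_comp by metis+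
qed

lemma components_minus_unique:
  "\<lbrakk>C \<in> components_minus G S; C' \<in> components_minus G S; C \<inter> C' \<noteq> {}\<rbrakk> \<Longrightarrow> C = C'"
  using comp_disjoint by (auto simp: components_minus_eq)

text \<open>A component of \<open>G - S\<close> is a region when \<open>S\<close> is finite.
  Conversely, for a region \<open>D\<close>, every component of \<open>G - boundary D\<close> lies
  inside \<open>D\<close> or misses it. In this form the relation is visibly an equivalence on
  rays.\<close>

lemma ray_equiv_iff:
  "(r, r') \<in> ray_equiv G \<longleftrightarrow>
     ray G r \<and> ray G r' \<and> (\<forall>D. region D \<longrightarrow> tail_in r D \<longleftrightarrow> tail_in r' D)"
proof -
  have "(\<exists>S. finite S \<and> S \<subseteq> verts G \<and> separates_rays G S r r') \<longleftrightarrow>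
        (\<exists>D. region D \<and> (tail_in r D \<longleftrightarrow> \<not> tail_in r' D))" (is "?L \<longleftrightarrow> ?R")
    if rays: "ray G r" "ray G r'"
  proof
    assume ?L
    then obtain S C C' where S: "finite S" "C \<in> components_minus G S" "C' \<in> components_minus G S"
      "C \<noteq> C'" "tail_in r C" "tail_in r' C'"
      unfolding separates_rays_def by auto
    have "\<not> tail_in r' C"
      using tail_in_Int[OF S(6), of C] tail_in_nonempty components_minus_unique[OF S(2,3)] S(4) by blast
    moreover have "region C" unfolding region_def
      using components_minusD(2,3)[OF S(2)] S(1) by (auto intro: finite_subset)
    ultimately show ?R using S(5) by blast
  next
    assume ?R
    then obtain D where D: "region D" "tail_in r D \<longleftrightarrow> \<not> tail_in r' D" by auto
    have fin: "finite (boundary D)" "boundary D \<subseteq> verts G"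
      using D(1) by (auto simp: region_def boundary_def)
    obtain C where C: "C \<in> components_minus G (boundary D)" "tail_in r C"
      using ray_component[OF rays(1) fin(1)] .
    obtain C' where C': "C' \<in> components_minus G (boundary D)" "tail_in r' C'"
      using ray_component[OF rays(2) fin(1)] .
    have "C \<noteq> C'"
    proof
      assume eq: "C = C'"
      have "C \<subseteq> D \<or> C \<inter> D = {}"
        using components_minusD[OF C(1)] by (intro connset_cases) auto
      then show False
      proof
        assume "C \<subseteq> D"
        then show False using D(2) C(2) C'(2) eq tail_in_mono by blast
      next
        assume *: "C \<inter> D = {}"
        have "\<not> tail_in r D" "\<not> tail_in r' D"
          using tail_in_Int[OF C(2), of D] tail_in_Int[OF C'(2), of D] * eq tail_in_nonempty by blast+
        then show False using D(2) by simp
      qed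
    qed
    then show ?L using fin C C' unfolding separates_rays_def by blast
  qed
  then show ?thesis unfolding ray_equiv_def by blast
qed

section \<open>Ends as seen by regions\<close>

lemma end_rays: "\<omega> \<in> graph_ends G \<Longrightarrow> r \<in> \<omega> \<Longrightarrow> ray G r"
  by (auto simp: graph_ends_def quotient_def ray_equiv_iff)

lemma end_nonempty: "\<omega> \<in> graph_ends G \<Longrightarrow> \<exists>r. r \<in> \<omega>"
  by (auto simp: graph_ends_def quotient_def ray_equiv_iff)

lemma end_closed: "\<lbrakk>\<omega> \<in> graph_ends G; r \<in> \<omega>; (r, r') \<in> ray_equiv G\<rbrakk> \<Longrightarrow> r' \<in> \<omega>"
  by (auto simp: graph_ends_def quotient_def ray_equiv_iff)

lemma end_ray_equiv: "\<lbrakk>\<omega> \<in> graph_ends G; r \<in> \<omega>; r' \<in> \<omega>\<rbrakk> \<Longrightarrow> (r, r') \<in> ray_equiv G"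
  by (auto simp: graph_ends_def quotient_def ray_equiv_iff)

lemma in_end_iff:
  "\<lbrakk>\<omega> \<in> graph_ends G; r \<in> \<omega>; region D\<rbrakk> \<Longrightarrow> in_end \<omega> D \<longleftrightarrow> tail_in r D"
  unfolding in_end_def using end_ray_equiv ray_equiv_iff by blast

lemma end_distinguish:
  assumes "\<omega> \<in> graph_ends G" "\<eta> \<in> graph_ends G" "\<omega> \<noteq> \<eta>"
  obtains D where "region D" "in_end \<omega> D \<longleftrightarrow> \<not> in_end \<eta> D"
proof -
  obtain r r' where r: "r \<in> \<omega>" "r' \<in> \<eta>" using assms end_nonempty by blast
  have "(r, r') \<notin> ray_equiv G"
  proof
    assume *: "(r, r') \<in> ray_equiv G"
    have sym: "(a, b) \<in> ray_equiv G \<Longrightarrow> (b, a) \<in> ray_equiv G" for a b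
      by (auto simp: ray_equiv_iff)
    have "r' \<in> \<omega>" "r \<in> \<eta>" using end_closed assms r * sym by blast+
    then have "s \<in> \<omega> \<longleftrightarrow> s \<in> \<eta>" for s
      using assms r end_closed end_ray_equiv by blast
    then show False using assms(3) by blast
  qed
  then obtain D where "region D" "tail_in r D \<longleftrightarrow> \<not> tail_in r' D"
    using r assms(1,2) end_rays by (auto simp: ray_equiv_iff)
  then show thesis using that in_end_iff assms r by blast
qed

lemma in_end_Int:
  assumes "\<omega> \<in> graph_ends G" "in_end \<omega> D" "in_end \<omega> D'" "region D"
  shows "in_end \<omega> (D \<inter> D')"
proof -
  obtain r where "r \<in> \<omega>" "tail_in r D'" using assms(3) by (auto simp: in_end_def)
  then show ?thesis using in_end_iff[OF assms(1) _ assms(4)] assms(2) tail_in_Int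
    unfolding in_end_def by blast
qed

lemma in_end_mono: "in_end \<omega> C \<Longrightarrow> C \<subseteq> D \<Longrightarrow> in_end \<omega> D"
  unfolding in_end_def using tail_in_mono by blast

lemma in_end_nonempty: "in_end \<omega> C \<Longrightarrow> C \<noteq> {}"
  unfolding in_end_def using tail_in_nonempty by blast

lemma component_region: "\<lbrakk>finite S; C \<in> components_minus G S\<rbrakk> \<Longrightarrow> region C"
  unfolding region_def using components_minusD(2)[of C S] finite_subset[OF components_minusD(3)[of C S]]
  by auto

text \<open>Justifies the definite description: every ray has a tail in some component of
  \<open>G - S\<close>, different components are disjoint, and the rays of one end agree because
  components are regions.\<close>

lemma end_component:
  assumes "\<omega> \<in> graph_ends G" "finite S"
  shows "end_component G S \<omega> \<in> components_minus G S" "in_end \<omega> (end_component G S \<omega>)"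
proof -
  obtain r where r: "r \<in> \<omega>" using assms(1) end_nonempty by blast
  obtain C where C: "C \<in> components_minus G S" "tail_in r C"
    using ray_component[OF end_rays[OF assms(1) r] assms(2)] .
  have all: "\<forall>r\<in>\<omega>. tail_in r C"
    using in_end_iff[OF assms(1) _ component_region[OF assms(2) C(1)]] C(2) r by blast
  have "end_component G S \<omega> = C"
    unfolding end_component_def
  proof (rule the_equality)
    fix C' assume "C' \<in> components_minus G S \<and> (\<forall>r\<in>\<omega>. tail_in r C')"
    then have C': "C' \<in> components_minus G S" "tail_in r C'" using r by auto
    show "C' = C"
      using components_minus_unique[OF C'(1) C(1)] tail_in_nonempty[OF tail_in_Int[OF C'(2) C(2)]] .
  qed (use C all in blast)
  then show "end_component G S \<omega> \<in> components_minus G S" "in_end \<omega> (end_component G S \<omega>)"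
    using C r by (auto simp: in_end_def)
qed

lemma connset_subset_component:
  assumes "C \<in> components_minus G S" "connset D" "D \<inter> S = {}" "D \<inter> C \<noteq> {}"
  shows "D \<subseteq> C"
  using connset_cases[OF assms(2), of C] components_minusD(3)[OF assms(1)] assms(3,4) by blast

end


section \<open>Disjoint rays to an end\<close>

context lf_graph
begin

definition end_region :: "(nat \<Rightarrow> 'v) set \<Rightarrow> 'v set \<Rightarrow> bool" where
  "end_region \<omega> D \<longleftrightarrow> region D \<and> connset D \<and> in_end \<omega> D"

definition clos :: "'v set \<Rightarrow> 'v set" where
  "clos D = D \<union> boundary D"

lemma clos_mono: "C \<subseteq> D \<Longrightarrow> clos C \<subseteq> clos D"
  by (auto simp: boundary_def clos_def)

lemma boundary_disjoint: "D \<inter> boundary D = {}"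
  by (auto simp: boundary_def)

lemma boundary_verts: "boundary D \<subseteq> verts G"
  by (auto simp: boundary_def)

lemma end_region_verts:
  assumes "\<omega> \<in> graph_ends G" shows "end_region \<omega> (verts G)"
proof -
  obtain r where "r \<in> \<omega>" using assms end_nonempty by blast
  then have "in_end \<omega> (verts G)"
    using end_rays[OF assms] ray_verts by (auto simp: in_end_def tail_in_def)
  moreover have "boundary (verts G) = {}" by (auto simp: boundary_def)
  ultimately show ?thesis using connset_verts by (simp add: end_region_def region_def)
qed

lemma end_region_inside:
  assumes \<omega>: "\<omega> \<in> graph_ends G" and D0: "end_region \<omega> D0" and "finite Z"
  obtains D where "end_region \<omega> D" "clos D \<subseteq> D0" "D \<inter> Z = {}"
proof -
  \<comment> \<open>Deleting the neighbours of \<open>boundary D0\<close> too puts a layer between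
    \<open>C\<close> and \<open>boundary D0\<close>, so that even \<open>boundary C\<close> stays
    inside \<open>D0\<close>.\<close>
  define S where "S = Z \<union> boundary D0 \<union> boundary (boundary D0)"
  have fin: "finite S" using assms finite_boundary by (auto simp: S_def end_region_def region_def)
  define C where "C = end_component G S \<omega>"
  have C: "C \<in> components_minus G S" "in_end \<omega> C"
    using end_component[OF \<omega> fin] by (auto simp: C_def)
  have CS: "connset C" "C \<subseteq> verts G - S" using components_minusD[OF C(1)] by auto
  have "C \<inter> D0 \<noteq> {}"
    using in_end_Int[OF \<omega> C(2) _ component_region[OF fin C(1)], of D0] D0 in_end_nonempty
    by (auto simp: end_region_def)
  then have CD: "C \<subseteq> D0" using connset_cases[OF CS(1), of D0] CS(2) by (auto simp: S_def)
  have "boundary C \<subseteq> D0"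
  proof
    fix w assume w: "w \<in> boundary C"
    then obtain a where a: "a \<in> C" "adj a w" "w \<in> verts G" by (auto simp: boundary_def)
    show "w \<in> D0"
    proof (rule ccontr)
      assume "w \<notin> D0"
      then have "w \<in> boundary D0" using a CD by (auto simp: boundary_def)
      moreover have "a \<notin> boundary D0" "a \<in> verts G" using a CD CS(2) by (auto simp: boundary_def)
      ultimately have "a \<in> S" using adj_sym[OF a(2)] by (auto simp: S_def boundary_def[of "boundary D0"])
      then show False using a CS(2) by auto
    qed
  qed
  then show thesis
    using that[of C] C CS CD component_region[OF fin C(1)]
    by (auto simp: end_region_def clos_def S_def)
qed

text \<open>A cut with fewer vertices than \<open>boundary D\<close>, separating it from a smaller
  region of \<omega>, would bound a better region. Tightness thus supplies the hypothesis of
  Menger's theorem for all smaller regions at once.\<close>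

definition tight :: "(nat \<Rightarrow> 'v) set \<Rightarrow> 'v set \<Rightarrow> bool" where
  "tight \<omega> D \<longleftrightarrow> end_region \<omega> D \<and>
     (\<forall>D'. end_region \<omega> D' \<and> D' \<subseteq> D \<longrightarrow> card (boundary D) \<le> card (boundary D'))"

lemma tight_inside:
  assumes "\<omega> \<in> graph_ends G" "end_region \<omega> D0" "finite Z"
  obtains D where "tight \<omega> D" "clos D \<subseteq> D0" "D \<inter> Z = {}"
proof -
  obtain D1 where D1: "end_region \<omega> D1" "clos D1 \<subseteq> D0" "D1 \<inter> Z = {}"
    using end_region_inside[OF assms] .
  obtain D where D: "end_region \<omega> D \<and> D \<subseteq> D1"
    "\<And>D'. end_region \<omega> D' \<and> D' \<subseteq> D1 \<Longrightarrow> card (boundary D) \<le> card (boundary D')"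
    using arg_min_nat_lemma[of "\<lambda>D. end_region \<omega> D \<and> D \<subseteq> D1" D1 "\<lambda>D. card (boundary D)"] D1(1)
    by blast
  have "tight \<omega> D" unfolding tight_def using D by blast
  moreover have "clos D \<subseteq> D0" using clos_mono[of D D1] D D1 by blast
  moreover have "D \<inter> Z = {}" using D D1 by blast
  ultimately show thesis by (rule that)
qed

text \<open>Balls around a vertex: finite because the graph is locally finite, exhausting because it
  is connected.\<close>

lemma exhaustion:
  obtains E where "\<And>m::nat. finite (E m)" "mono E" "verts G \<subseteq> (\<Union>m. E m)"
proof -
  obtain v0 where v0: "v0 \<in> verts G" using connset_verts by (auto simp: connset_def)
  define E where "E m = (clos ^^ m) {v0}" for m
  have E_Suc: "E (Suc m) = E m \<union> boundary (E m)" for m by (simp add: E_def clos_def)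
  have "finite (E m)" for m
    by (induction m) (simp add: E_def, simp add: E_Suc finite_boundary)
  moreover have "mono E" by (rule mono_iff_le_Suc[THEN iffD2]) (auto simp: E_Suc)
  moreover have "v \<in> (\<Union>m. E m)" if "v \<in> verts G" for v
  proof -
    have "(v0, v) \<in> reach (verts G)" using v0 that connset_verts by (auto simp: connset_def)
    then show ?thesis
    proof (rule reach_invariant)
      show "v0 \<in> (\<Union>m. E m)" by (auto simp: E_def intro!: exI[of _ 0])
      fix a b assume "a \<in> (\<Union>m. E m)" "b \<in> verts G" "adj a b"
      then obtain m where "a \<in> E m" by auto
      then have "b \<in> E (Suc m)" using \<open>b \<in> verts G\<close> \<open>adj a b\<close> by (auto simp: E_Suc boundary_def)
      then show "b \<in> (\<Union>m. E m)" by blast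
    qed
  qed
  ultimately show thesis using that by blast
qed

text \<open>Menger's theorem in \<open>clos D\<close> from \<open>boundary D\<close> to
  \<open>clos D'\<close>. If the cut condition failed for \<open>R\<close>, the set \<open>S\<close>
  below would be smaller than \<open>boundary D\<close>, and the component of \<open>G - S\<close>
  around \<open>D'\<close> would contradict tightness. All images lie in \<open>D\<close>, so no
  orbit returns to \<open>boundary D\<close>.\<close>

lemma tight_link:
  assumes D: "tight \<omega> D" and D': "end_region \<omega> D'" "clos D' \<subseteq> D"
  shows "\<exists>\<phi>. inj_on \<phi> (clos D - clos D') \<and>
      (\<forall>v\<in>clos D - clos D'. \<phi> v \<in> D \<and> (\<phi> v = v \<or> adj v (\<phi> v))) \<and>
      finite {v. \<phi> v \<noteq> v}"
proof -
  let ?N = "\<lambda>v. {w. adj v w}"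
  let ?B = "\<lambda>R. (\<Union>v\<in>R. ?N v) \<inter> clos D - R - boundary D"
  have fin: "finite (boundary D)" and DV: "D \<subseteq> verts G" "end_region \<omega> D"
    using D by (auto simp: tight_def end_region_def region_def)
  have "boundary D \<subseteq> clos D - clos D'" using D'(2) boundary_disjoint[of D] by (auto simp: clos_def)
  moreover have "card (boundary D \<inter> R) \<le> card ((?B R))"
    if R: "R \<subseteq> clos D - clos D'" and finB: "finite (?B R)" for R
  proof (rule ccontr)
    assume "\<not> ?thesis"
    then have less: "card (?B R) < card (boundary D \<inter> R)" by simp
    \<comment> \<open>A path in \<open>clos D\<close> from \<open>boundary D\<close> to
      \<open>D'\<close> either starts outside \<open>R\<close> or has to leave \<open>R\<close>; in
      both cases it meets \<open>S\<close>.\<close>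
    define S where "S = (?B R) \<union> (boundary D - R)"
    have finS: "finite S" using finB fin by (simp add: S_def)
    have "card S \<le> card (?B R) + card (boundary D - R)" unfolding S_def by (rule card_Un_le)
    also have "\<dots> < card (boundary D \<inter> R) + card (boundary D - R)" using less by simp
    also have "\<dots> = card (boundary D)" using fin by (metis card_Int_Diff)
    finally have cardS: "card S < card (boundary D)" .
    obtain a where a: "a \<in> D'" using D' by (auto simp: end_region_def connset_def)
    have "D' \<inter> S = {}"
    proof -
      have "w \<notin> ?N v" if "w \<in> D'" "v \<in> R" for v w
      proof
        assume "w \<in> ?N v"
        then have "adj w v" "v \<in> verts G" using adj_sym adj_verts by auto
        then have "v \<in> clos D'" using that(1) by (auto simp: clos_def boundary_def)
        then show False using R that by auto
      qed
      then show ?thesis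
        using D'(2) boundary_disjoint[of D] by (auto simp: S_def clos_def)
    qed
    then have aS: "a \<in> verts G - S" using a D' by (auto simp: end_region_def region_def)
    define C where "C = comp S a"
    have C: "connset C" "C \<subseteq> verts G - S" "boundary C \<subseteq> S"
      using connset_comp[OF aS] comp_subset[OF aS] boundary_comp[OF aS] by (auto simp: C_def)
    \<comment> \<open>Walking from \<open>a\<close>, one cannot enter \<open>R\<close>, since the
      vertices of \<open>D\<close> next to \<open>R\<close> lie in \<open>S\<close>, and cannot
      leave \<open>D\<close>, since the boundary vertices outside \<open>R\<close> lie in
      \<open>S\<close>.\<close>
    have CD: "C \<subseteq> D - R"
    proof
      fix w assume "w \<in> C"
      then have "(a, w) \<in> reach (verts G - S)" by (simp add: C_def comp_def)
      then show "w \<in> D - R"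
      proof (rule reach_invariant)
        show "a \<in> D - R" using a D'(2) R by (auto simp: clos_def)
        fix x y assume xy: "x \<in> D - R" "y \<in> verts G - S" "adj x y" and xS: "x \<in> verts G - S"
        then have yD: "y \<in> clos D" by (auto simp: clos_def boundary_def)
        have "y \<notin> R"
        proof
          assume "y \<in> R"
          then have "x \<in> (?B R)" using xy adj_sym boundary_disjoint[of D] by (auto simp: clos_def)
          then show False using xS by (simp add: S_def)
        qed
        then show "y \<in> D - R" using yD xy(2) by (auto simp: clos_def S_def)
      qed
    qed
    have "D' \<subseteq> C"
      using connset_subset_component[of C S D'] aS a C_def D'(1) \<open>D' \<inter> S = {}\<close> comp_self
      by (auto simp: components_minus_eq end_region_def)
    then have "end_region \<omega> C"
      using C finS D'(1) in_end_mono by (auto simp: end_region_def region_def intro: finite_subset)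
    then have "card (boundary D) \<le> card (boundary C)" using D CD by (auto simp: tight_def)
    also have "\<dots> \<le> card S" using C(3) finS by (rule card_mono[rotated])
    finally show False using cardS by simp
  qed
  ultimately obtain \<phi> where \<phi>: "inj_on \<phi> (clos D - clos D')"
    "\<And>v. v \<in> clos D - clos D' \<Longrightarrow> \<phi> v \<in> insert v (?N v) \<inter> (clos D - boundary D)"
    "finite {v. \<phi> v \<noteq> v}"
    using menger_injection[OF fin, of "clos D" "clos D'" ?N] by blast
  have "\<forall>v\<in>clos D - clos D'. \<phi> v \<in> D \<and> (\<phi> v = v \<or> adj v (\<phi> v))"
    using \<phi>(2) by (auto simp: clos_def)
  then show ?thesis using \<phi>(1,3) by (intro exI[of _ \<phi>] conjI)
qed

text \<open>
  Take tight regions \<open>Ds 0, Ds 1, \<dots>\<close> shrinking to \<open>\<omega>\<close> and link consecutive boundaries by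
  injections \<open>\<Phi> m\<close>.  Glued together they are an injection \<open>\<phi>\<close> whose orbits from \<open>boundary (Ds 0)\<close>
  are the required rays: each \<open>\<Phi> m\<close> moves finitely many vertices, so no orbit stays between two
  levels.
\<close>

lemma end_linkage:
  assumes \<omega>: "\<omega> \<in> graph_ends G" and D0: "end_region \<omega> D0"
  obtains D r where "end_region \<omega> D" "clos D \<subseteq> D0"
    "\<And>b. b \<in> boundary D \<Longrightarrow> r b \<in> \<omega> \<and> r b 0 = b \<and> (\<forall>i>0. r b i \<in> D)"
    "\<And>b c i j. \<lbrakk>b \<in> boundary D; c \<in> boundary D; r b i = r c j\<rbrakk> \<Longrightarrow> b = c"
proof -
  obtain E :: "nat \<Rightarrow> 'v set" where E: "\<And>m. finite (E m)" "mono E" "verts G \<subseteq> (\<Union>m. E m)"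
    using exhaustion by blast
  \<comment> \<open>Avoiding the sets \<open>E m\<close> ensures that no vertex lies in all the
    regions and that every finite set is eventually missed.\<close>
  have "\<exists>Ds. \<forall>m. (tight \<omega> (Ds m) \<and> clos (Ds m) \<subseteq> D0) \<and> (clos (Ds (Suc m)) \<subseteq> Ds m \<and> Ds (Suc m) \<inter> E m = {})"
  proof (rule dependent_nat_choice)
    show "\<exists>D. tight \<omega> D \<and> clos D \<subseteq> D0"
    proof -
      obtain D where "tight \<omega> D" "clos D \<subseteq> D0"
        by (rule tight_inside[OF \<omega> D0 finite.emptyI])
      then show ?thesis by blast
    qed
    fix D m assume "tight \<omega> D \<and> clos D \<subseteq> D0"
    then have "end_region \<omega> D" "D \<subseteq> D0" by (auto simp: tight_def clos_def)
    moreover obtain D' where "tight \<omega> D'" "clos D' \<subseteq> D" "D' \<inter> E m = {}"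
      by (rule tight_inside[OF \<omega> \<open>end_region \<omega> D\<close> E(1)])
    ultimately show "\<exists>D'. (tight \<omega> D' \<and> clos D' \<subseteq> D0) \<and> clos D' \<subseteq> D \<and> D' \<inter> E m = {}"
      unfolding clos_def by blast
  qed
  then obtain Ds where Ds: "\<And>m. tight \<omega> (Ds m)" "clos (Ds 0) \<subseteq> D0"
    "\<And>m. clos (Ds (Suc m)) \<subseteq> Ds m" "\<And>m. Ds (Suc m) \<inter> E m = {}" by blast
  have er: "end_region \<omega> (Ds m)" for m using Ds(1) by (simp add: tight_def)
  have "\<exists>\<phi>. inj_on \<phi> (clos (Ds m) - clos (Ds (Suc m))) \<and>
      (\<forall>v\<in>clos (Ds m) - clos (Ds (Suc m)). \<phi> v \<in> Ds m \<and> (\<phi> v = v \<or> adj v (\<phi> v))) \<and>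
      finite {v. \<phi> v \<noteq> v}" for m
    by (rule tight_link[OF Ds(1)[of m] er Ds(3)])
  then have "\<exists>\<Phi>. \<forall>m. inj_on (\<Phi> m) (clos (Ds m) - clos (Ds (Suc m))) \<and>
      (\<forall>v\<in>clos (Ds m) - clos (Ds (Suc m)). \<Phi> m v \<in> Ds m \<and> (\<Phi> m v = v \<or> adj v (\<Phi> m v))) \<and>
      finite {v. \<Phi> m v \<noteq> v}" by (intro choice allI)
  then obtain \<Phi> where \<Phi>: "\<And>m. inj_on (\<Phi> m) (clos (Ds m) - clos (Ds (Suc m)))"
    "\<And>m v. v \<in> clos (Ds m) - clos (Ds (Suc m)) \<Longrightarrow> \<Phi> m v \<in> Ds m \<and> (\<Phi> m v = v \<or> adj v (\<Phi> m v))"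
    "\<And>m. finite {v. \<Phi> m v \<noteq> v}" by (elim exE) blast
  have sub: "Ds m \<subseteq> clos (Ds m)" for m by (auto simp: clos_def)
  have dec: "clos (Ds n) \<subseteq> clos (Ds m)" if "m \<le> n" for m n
    using that by (induction rule: dec_induct) (use Ds(3) sub in blast)+
  have dec': "clos (Ds n) \<subseteq> Ds m" if "m < n" for m n
    using dec[of "Suc m" n] Ds(3)[of m] that by auto
  \<comment> \<open>The index of the layer \<open>clos (Ds m) - clos (Ds (Suc m))\<close> that
    contains \<open>v\<close>; on this layer the injection \<open>\<Phi> m\<close> is in
    force.\<close>
  define lev where "lev v = (LEAST m. v \<notin> clos (Ds (Suc m)))" for v
  have clV: "clos (Ds m) \<subseteq> verts G" for m
    using er[of m] boundary_verts by (auto simp: end_region_def region_def clos_def)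
  have lev: "v \<in> clos (Ds (lev v)) - clos (Ds (Suc (lev v)))" if v: "v \<in> clos (Ds 0)" for v
  proof -
    have "v \<in> (\<Union>m. E m)" using clV v E(3) by blast
    then obtain m where "v \<in> E m" by blast
    then have "v \<notin> Ds (Suc m)" using Ds(4) by blast
    then have "v \<notin> clos (Ds (Suc (Suc m)))" using Ds(3) by blast
    then have "v \<notin> clos (Ds (Suc (lev v)))" unfolding lev_def by (rule LeastI)
    moreover have "v \<in> clos (Ds (lev v))"
    proof (cases "lev v")
      case 0 then show ?thesis using v by simp
    next
      case (Suc k)
      then have "k < (LEAST m. v \<notin> clos (Ds (Suc m)))" by (simp add: lev_def)
      from not_less_Least[OF this] show ?thesis using Suc by simp
    qed
    ultimately show ?thesis by simp
  qed
  have lev_ge: "m \<le> lev v" if "v \<in> clos (Ds m)" for v m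
  proof (rule ccontr)
    assume "\<not> m \<le> lev v"
    then have "clos (Ds m) \<subseteq> clos (Ds (Suc (lev v)))" by (intro dec) simp
    moreover have "v \<in> clos (Ds 0)" using that dec[of 0 m] by auto
    ultimately show False using lev that by blast
  qed
  define \<phi> where "\<phi> v = \<Phi> (lev v) v" for v
  have \<phi>: "\<phi> v \<in> Ds (lev v)" "\<phi> v = v \<or> adj v (\<phi> v)" if "v \<in> clos (Ds 0)" for v
    using \<Phi>(2)[OF lev[OF that]] by (auto simp: \<phi>_def)
  have \<phi>0: "\<phi> v \<in> Ds 0" if "v \<in> clos (Ds 0)" for v
    using \<phi>(1)[OF that] dec'[of 0 "lev v"] sub[of "lev v"] by (cases "lev v") auto
  have lev_mono: "lev v \<le> lev (\<phi> v)" if "v \<in> clos (Ds 0)" for v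
    using lev_ge \<phi>(1)[OF that] sub by blast
  \<comment> \<open>A vertex outside \<open>clos (Ds (Suc m))\<close> has no neighbour in
    \<open>Ds (Suc m)\<close>. So the images of different layers are disjoint, and the glued map is
    injective.\<close>
  have next_D: "\<phi> v \<notin> Ds (Suc (lev v))" if v: "v \<in> clos (Ds 0)" for v
  proof
    assume *: "\<phi> v \<in> Ds (Suc (lev v))"
    have "v \<notin> clos (Ds (Suc (lev v)))" "v \<in> verts G" using lev[OF v] clV v by auto
    then show False using \<phi>(2)[OF v] * adj_sym by (auto simp: clos_def boundary_def)
  qed
  have lev_lt: "\<phi> v \<noteq> \<phi> w" if "v \<in> clos (Ds 0)" "w \<in> clos (Ds 0)" "lev v < lev w" for v w
  proof
    assume "\<phi> v = \<phi> w"
    moreover have "Ds (lev w) \<subseteq> Ds (Suc (lev v))"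
      using that(3) dec'[of "Suc (lev v)" "lev w"] sub[of "lev w"]
      by (cases "lev w = Suc (lev v)") auto
    ultimately show False using next_D[OF that(1)] \<phi>(1)[OF that(2)] by auto
  qed
  have \<phi>_inj: "v = w" if "v \<in> clos (Ds 0)" "w \<in> clos (Ds 0)" "\<phi> v = \<phi> w" for v w
  proof -
    have "lev v = lev w" using lev_lt[OF that(1,2)] lev_lt[OF that(2,1)] that(3) by (metis linorder_neqE_nat)
    then show ?thesis
      using inj_onD[OF \<Phi>(1) _ lev[OF that(1)], of w] lev[OF that(2)] that(3) by (simp add: \<phi>_def)
  qed
  define r where "r b i = (\<phi> ^^ i) b" for b i
  have rS: "r b (Suc i) = \<phi> (r b i)" for b i by (simp add: r_def)
  have r0: "r b 0 = b" for b by (simp add: r_def)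
  have rH: "r b i \<in> clos (Ds 0)" if "b \<in> boundary (Ds 0)" for b i
    by (induction i) (use that \<phi>0 sub in \<open>auto simp: r0 rS clos_def\<close>)
  have rD: "r b (Suc i) \<in> Ds 0" if "b \<in> boundary (Ds 0)" for b i
    using \<phi>0[OF rH[OF that]] by (simp add: rS)
  \<comment> \<open>Cancel \<phi> until one orbit is at its start; a start lies in
    \<open>boundary (Ds 0)\<close>, which contains no image of \<phi>.\<close>
  have r_inj: "i = j \<and> b = c" if b: "b \<in> boundary (Ds 0)" and c: "c \<in> boundary (Ds 0)" and "r b i = r c j" for b c i j
    using that(3)
  proof (induction i arbitrary: j)
    case 0
    then show ?case using rD[OF c] b boundary_disjoint[of "Ds 0"] by (cases j) (auto simp: r0)
  next
    case (Suc i)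
    show ?case
    proof (cases j)
      case 0
      then show ?thesis using Suc.prems rD[OF b, of i] c boundary_disjoint[of "Ds 0"] by (auto simp: r0)
    next
      case (Suc j')
      then have "r b i = r c j'" using Suc.prems \<phi>_inj[OF rH[OF b] rH[OF c]] by (simp add: rS)
      then show ?thesis using Suc.IH Suc by simp
    qed
  qed
  have ray: "ray G (r b)" if b: "b \<in> boundary (Ds 0)" for b
  proof -
    have "adj (r b i) (r b (Suc i))" for i
      using \<phi>(2)[OF rH[OF b], of i] r_inj[OF b b, of "Suc i" i] by (auto simp: rS)
    then show ?thesis using r_inj[OF b b] by (auto simp: ray_iff inj_def)
  qed
  have tail: "tail_in (r b) (Ds m)" if b: "b \<in> boundary (Ds 0)" for b m
  proof -
    have lm: "lev (r b i) \<le> lev (r b j)" if "i \<le> j" for i j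
      using that by (induction rule: dec_induct) (use lev_mono[OF rH[OF b]] in \<open>auto simp: rS intro: order_trans\<close>)
    have "\<exists>i. m < lev (r b i)"
    proof (rule ccontr)
      assume "\<nexists>i. m < lev (r b i)"
      then have *: "lev (r b i) \<le> m" for i by (auto simp: not_less)
      have "r b i \<in> (\<Union>k\<le>m. {v. \<Phi> k v \<noteq> v})" for i
        using *[of i] r_inj[OF b b, of "Suc i" i] by (auto simp: rS \<phi>_def)
      then have "finite (range (r b))"
        using \<Phi>(3) by (intro finite_subset[of "range (r b)" "\<Union>k\<le>m. {v. \<Phi> k v \<noteq> v}"]) auto
      then show False using ray[OF b] range_inj_infinite by (auto simp: ray_iff)
    qed
    then obtain i where "m < lev (r b i)" by auto
    then have "r b j \<in> Ds m" if "i \<le> j" for j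
      using lm[OF that] lev[OF rH[OF b, of j]] dec'[of m "lev (r b j)"] by auto
    then show ?thesis by (auto simp: tail_in_def)
  qed
  obtain r0 where r0\<omega>: "r0 \<in> \<omega>" using end_nonempty[OF \<omega>] by auto
  have mem: "r b \<in> \<omega>" if b: "b \<in> boundary (Ds 0)" for b
  proof (rule end_closed[OF \<omega> r0\<omega>])
    have t0: "tail_in r0 (Ds m)" for m
      using in_end_iff[OF \<omega> r0\<omega>] er[of m] by (auto simp: end_region_def)
    \<comment> \<open>Some \<open>Ds (Suc k)\<close> misses the finite set
      \<open>boundary D\<close>, so it lies inside \<open>D\<close> or is disjoint from it. Both
      rays have tails in it, so \<open>D\<close> does not distinguish them.\<close>
    have "tail_in r0 D \<longleftrightarrow> tail_in (r b) D" if D: "region D" for D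
    proof -
      have "boundary D \<subseteq> (\<Union>m. E m)" "finite (boundary D)"
        using D E(3) boundary_verts by (auto simp: region_def)
      then obtain f where f: "\<forall>w\<in>boundary D. w \<in> E (f w)" by (metis UN_E subsetD)
      have "w \<in> E (Max (insert 0 (f ` boundary D)))" if "w \<in> boundary D" for w
      proof -
        have "f w \<le> Max (insert 0 (f ` boundary D))"
          using that \<open>finite (boundary D)\<close> by simp
        then show ?thesis using f that monoD[OF E(2)] by blast
      qed
      then obtain k where "boundary D \<subseteq> E k" by blast
      then have "Ds (Suc k) \<inter> boundary D = {}" using Ds(4) by blast
      then have "Ds (Suc k) \<subseteq> D \<or> Ds (Suc k) \<inter> D = {}"
        using er by (intro connset_cases) (auto simp: end_region_def)
      then show ?thesis
        using t0[of "Suc k"] tail[OF b, of "Suc k"] tail_in_mono tail_in_Int tail_in_nonempty by metis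
    qed
    then show "(r0, r b) \<in> ray_equiv G"
      using ray[OF b] end_rays[OF \<omega> r0\<omega>] by (auto simp: ray_equiv_iff)
  qed
  show thesis
  proof (rule that)
    show "end_region \<omega> (Ds 0)" by (rule er)
    show "clos (Ds 0) \<subseteq> D0" by (rule Ds(2))
    show "r b \<in> \<omega> \<and> r b 0 = b \<and> (\<forall>i>0. r b i \<in> Ds 0)" if "b \<in> boundary (Ds 0)" for b
      using mem[OF that] r0 rD[OF that] by (metis gr0_conv_Suc)
    show "b = c" if "b \<in> boundary (Ds 0)" "c \<in> boundary (Ds 0)" "r b i = r c j" for b c i j
      using r_inj[OF that] by simp
  qed
qed

end


section \<open>The topology of the compactification\<close>

text \<open>At most the two end points are missing. The neighbourhoods below contain the interior of
  an edge entirely or not at all, so this covers every edge they meet in its interior.\<close>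

lemma openin_unit_interval:
  fixes A :: "real set"
  assumes "{0<..<1} \<subseteq> A" "A \<subseteq> {0..1}"
  shows "openin (top_of_set {0..1}) A"
proof -
  have "x \<in> A" if "x \<in> {0..1} \<inter> - ({0, 1} - A)" for x
    using that subsetD[OF assms(1), of x] by (cases "x = 0 \<or> x = 1") auto
  then have "A = {0..1} \<inter> - ({0, 1} - A)" using assms(2) by (intro equalityI subsetI) auto
  moreover have "open (- ({0, 1} - A))" by (intro open_Compl finite_imp_closed) auto
  ultimately show ?thesis unfolding openin_open by (intro exI conjI)
qed

context lf_graph
begin

text \<open>Extends \<open>end_nbhd\<close> from components to arbitrary vertex sets. Edges between
  \<open>D\<close> and its boundary contribute their whole interior, which makes the set open for
  every region.\<close>

definition nbhd :: "'v set \<Rightarrow> ('v, 'e) point set" where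
  "nbhd D = Vertex ` D
     \<union> {Inner e t | e t. e \<in> arcs G \<and> (tail G e \<in> D \<or> head G e \<in> D) \<and> 0 < t \<and> t < 1}
     \<union> {End \<eta> | \<eta>. \<eta> \<in> graph_ends G \<and> in_end \<eta> D}"

definition closed_nbhd :: "'v set \<Rightarrow> ('v, 'e) point set" where
  "closed_nbhd D = nbhd D \<union> Vertex ` boundary D"

text \<open>The induced subgraph as a point set. Loops are left out so that the span of one vertex
  is one point; spans of disjoint vertex sets are disjoint.\<close>

definition span :: "'v set \<Rightarrow> ('v, 'e) point set" where
  "span P = Vertex ` P
     \<union> {Inner e t | e t. e \<in> arcs G \<and> tail G e \<in> P \<and> head G e \<in> P \<and> tail G e \<noteq> head G e \<and> 0 < t \<and> t < 1}"

abbreviation all_points :: "('v, 'e) point set" where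
  "all_points \<equiv> graph_points G \<union> End ` graph_ends G"

lemma nbhd_simps [simp]:
  "Vertex v \<in> nbhd D \<longleftrightarrow> v \<in> D"
  "Inner e t \<in> nbhd D \<longleftrightarrow> e \<in> arcs G \<and> (tail G e \<in> D \<or> head G e \<in> D) \<and> 0 < t \<and> t < 1"
  "End \<eta> \<in> nbhd D \<longleftrightarrow> \<eta> \<in> graph_ends G \<and> in_end \<eta> D"
  by (auto simp: nbhd_def)

lemma closed_nbhd_simps [simp]:
  "Vertex v \<in> closed_nbhd D \<longleftrightarrow> v \<in> clos D"
  "Inner e t \<in> closed_nbhd D \<longleftrightarrow> e \<in> arcs G \<and> (tail G e \<in> D \<or> head G e \<in> D) \<and> 0 < t \<and> t < 1"
  "End \<eta> \<in> closed_nbhd D \<longleftrightarrow> \<eta> \<in> graph_ends G \<and> in_end \<eta> D"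
  by (auto simp: closed_nbhd_def clos_def)

lemma span_simps [simp]:
  "Vertex v \<in> span P \<longleftrightarrow> v \<in> P"
  "Inner e t \<in> span P \<longleftrightarrow> e \<in> arcs G \<and> tail G e \<in> P \<and> head G e \<in> P \<and> tail G e \<noteq> head G e \<and> 0 < t \<and> t < 1"
  "End \<eta> \<notin> span P"
  by (auto simp: span_def)

lemma graph_points_simps [simp]:
  "Vertex v \<in> graph_points G \<longleftrightarrow> v \<in> verts G"
  "Inner e t \<in> graph_points G \<longleftrightarrow> e \<in> arcs G \<and> 0 < t \<and> t < 1"
  "End \<eta> \<notin> graph_points G"
  by (auto simp: graph_points_def)

lemma nbhd_mono: "C \<subseteq> D \<Longrightarrow> nbhd C \<subseteq> nbhd D"
  using in_end_mono by (auto simp: nbhd_def)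

lemma nbhd_subset_points: "D \<subseteq> verts G \<Longrightarrow> nbhd D \<subseteq> all_points"
  by (auto simp: nbhd_def)

lemma closed_nbhd_subset_nbhd: "clos D \<subseteq> D0 \<Longrightarrow> closed_nbhd D \<subseteq> nbhd D0"
  using nbhd_mono[of D D0] by (auto simp: closed_nbhd_def clos_def)

lemma edge_point_in_graph: "\<lbrakk>e \<in> arcs G; t \<in> {0..1}\<rbrakk> \<Longrightarrow> edge_point G e t \<in> graph_points G"
  by (auto simp: edge_point_def)

lemma edge_preimage_nbhd:
  assumes "e \<in> arcs G"
  shows "openin (top_of_set {0..1}) {t \<in> {0..1}. edge_point G e t \<in> nbhd D}"
proof (cases "tail G e \<in> D \<or> head G e \<in> D")
  case True
  then show ?thesis using assms by (intro openin_unit_interval) (auto simp: edge_point_def)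
next
  case False
  then have "{t \<in> {0..1}. edge_point G e t \<in> nbhd D} = {}" by (auto simp: edge_point_def)
  then show ?thesis by (simp only: openin_empty)
qed

lemma edge_preimage_co_closed_nbhd:
  assumes "e \<in> arcs G"
  shows "openin (top_of_set {0..1}) {t \<in> {0..1}. edge_point G e t \<in> all_points - closed_nbhd D}"
proof (cases "tail G e \<in> D \<or> head G e \<in> D")
  case True
  have "adj (tail G e) (head G e)" "adj (head G e) (tail G e)" using assms by (auto simp: adj_def)
  then have "tail G e \<in> clos D" "head G e \<in> clos D"
    using True assms by (auto simp: clos_def boundary_def)
  then have "{t \<in> {0..1}. edge_point G e t \<in> all_points - closed_nbhd D} = {}"
    using True assms by (auto simp: edge_point_def)
  then show ?thesis by (simp only: openin_empty)
next
  case False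
  then show ?thesis using assms by (intro openin_unit_interval) (auto simp: edge_point_def)
qed

lemma ray_equiv_shift:
  assumes "ray G r" shows "(r, \<lambda>i. r (i + m)) \<in> ray_equiv G"
proof -
  have "tail_in r D \<longleftrightarrow> tail_in (\<lambda>i. r (i + m)) D" for D
  proof
    assume "tail_in r D"
    then show "tail_in (\<lambda>i. r (i + m)) D" unfolding tail_in_def by (meson trans_le_add1)
  next
    assume "tail_in (\<lambda>i. r (i + m)) D"
    then obtain n where n: "\<forall>i\<ge>n. r (i + m) \<in> D" by (auto simp: tail_in_def)
    have "r i \<in> D" if "n + m \<le> i" for i
      using n[rule_format, of "i - m"] that by simp
    then show "tail_in r D" by (auto simp: tail_in_def)
  qed
  then show ?thesis using assms ray_shift by (auto simp: ray_equiv_iff)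
qed

text \<open>A ray with a tail in \<open>C\<close> can be shortened to that tail without changing its
  end.\<close>

lemma end_nbhd_eq:
  "end_nbhd G S \<omega> = nbhd (end_component G S \<omega>)"
proof -
  have "(\<exists>r\<in>\<eta>. range r \<subseteq> C) \<longleftrightarrow> in_end \<eta> C" if "\<eta> \<in> graph_ends G" for \<eta> C
  proof
    assume "in_end \<eta> C"
    then obtain r m where r: "r \<in> \<eta>" "\<And>i. m \<le> i \<Longrightarrow> r i \<in> C" by (auto simp: in_end_def tail_in_def)
    have "(\<lambda>i. r (i + m)) \<in> \<eta>"
      using end_closed[OF that r(1) ray_equiv_shift[OF end_rays[OF that r(1)]]] .
    moreover have "range (\<lambda>i. r (i + m)) \<subseteq> C" using r(2) by auto
    ultimately show "\<exists>r\<in>\<eta>. range r \<subseteq> C" by blast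
  next
    assume "\<exists>r\<in>\<eta>. range r \<subseteq> C"
    then obtain r where "r \<in> \<eta>" "range r \<subseteq> C" by blast
    then have "tail_in r C" by (auto simp: tail_in_def)
    then show "in_end \<eta> C" using \<open>r \<in> \<eta>\<close> by (auto simp: in_end_def)
  qed
  then have "{(End \<eta> :: ('v, 'e) point) | \<eta>. \<eta> \<in> graph_ends G \<and> (\<exists>r\<in>\<eta>. range r \<subseteq> C)} =
      {End \<eta> | \<eta>. \<eta> \<in> graph_ends G \<and> in_end \<eta> C}" for C :: "'v set" by metis
  then show ?thesis by (simp only: end_nbhd_def nbhd_def Let_def)
qed

section \<open>Open sets of the compactification\<close>

lemma end_component_in:
  assumes "\<omega> \<in> graph_ends G" "finite S" "C \<in> components_minus G S" "in_end \<omega> C"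
  shows "end_component G S \<omega> = C"
  using components_minus_unique[OF end_component(1)[OF assms(1,2)] assms(3)]
    in_end_nonempty[OF in_end_Int[OF assms(1) end_component(2)[OF assms(1,2)] assms(4)
      component_region[OF assms(2) end_component(1)[OF assms(1,2)]]]] .

lemma end_component_antimono:
  assumes "\<omega> \<in> graph_ends G" "finite S'" "S \<subseteq> S'"
  shows "end_component G S' \<omega> \<subseteq> end_component G S \<omega>"
proof -
  have S: "finite S" using assms finite_subset by blast
  note c = end_component[OF assms(1) S] and c' = end_component[OF assms(1,2)]
  show ?thesis
    using connset_subset_component[OF c(1) components_minusD(1)[OF c'(1)]]
      in_end_nonempty[OF in_end_Int[OF assms(1) c'(2) c(2) component_region[OF assms(2) c'(1)]]]
      components_minusD(2)[OF c'(1)] assms(3) by blast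
qed

text \<open>Replaces the generated topology by a local test. It passes to intersections because
  \<open>S \<union> S'\<close> gives a smaller component than \<open>S\<close> and
  \<open>S'\<close>, and a basic set passes it because it is the neighbourhood, for the same
  \<open>S\<close>, of each of its ends.\<close>

lemma openin_freudenthal:
  "openin (freudenthal G) W \<longleftrightarrow> W \<subseteq> all_points \<and>
     (\<forall>e\<in>arcs G. openin (top_of_set {0..1}) {t \<in> {0..1}. edge_point G e t \<in> W}) \<and>
     (\<forall>\<omega>\<in>graph_ends G. End \<omega> \<in> W \<longrightarrow> (\<exists>S. finite S \<and> S \<subseteq> verts G \<and> end_nbhd G S \<omega> \<subseteq> W))"
    (is "_ \<longleftrightarrow> ?T W")
proof -
  let ?B = "{U. openin (graph_space G) U} \<union>
      {end_nbhd G S \<omega> | S \<omega>. finite S \<and> S \<subseteq> verts G \<and> \<omega> \<in> graph_ends G}"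
  show ?thesis unfolding freudenthal_def openin_topology_generated_by_iff
  proof
    assume "generate_topology_on ?B W"
    then show "?T W"
    proof (induction rule: generate_topology_on.induct)
      case Empty
      then show ?case by simp
    next
      case (Int a b)
      have e1: "openin (top_of_set {0..1}) {t \<in> {0..1}. edge_point G e t \<in> a \<inter> b}" if "e \<in> arcs G" for e
      proof -
        have "{t \<in> {0..1}. edge_point G e t \<in> a \<inter> b} =
          {t \<in> {0..1}. edge_point G e t \<in> a} \<inter> {t \<in> {0..1}. edge_point G e t \<in> b}" by auto
        moreover have "openin (top_of_set {0..1}) ({t \<in> {0..1}. edge_point G e t \<in> a} \<inter> {t \<in> {0..1}. edge_point G e t \<in> b})"
          using Int.IH that by (intro openin_Int) auto
        ultimately show ?thesis by simp
      qed
      have e2: "\<exists>S. finite S \<and> S \<subseteq> verts G \<and> end_nbhd G S \<omega> \<subseteq> a \<inter> b"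
        if w: "\<omega> \<in> graph_ends G" "End \<omega> \<in> a \<inter> b" for \<omega>
      proof -
        have "\<exists>S. finite S \<and> S \<subseteq> verts G \<and> end_nbhd G S \<omega> \<subseteq> a"
          "\<exists>S. finite S \<and> S \<subseteq> verts G \<and> end_nbhd G S \<omega> \<subseteq> b"
          using Int.IH w by auto
        then obtain S S' where S: "finite S" "S \<subseteq> verts G" "end_nbhd G S \<omega> \<subseteq> a"
          "finite S'" "S' \<subseteq> verts G" "end_nbhd G S' \<omega> \<subseteq> b" by (elim exE conjE)
        have f: "finite (S \<union> S')" using S by simp
        have "end_nbhd G (S \<union> S') \<omega> \<subseteq> end_nbhd G S \<omega>" "end_nbhd G (S \<union> S') \<omega> \<subseteq> end_nbhd G S' \<omega>"
          unfolding end_nbhd_eq by (intro nbhd_mono end_component_antimono w f; blast)+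
        then show ?thesis using S f by (intro exI[of _ "S \<union> S'"]) auto
      qed
      have e3: "a \<inter> b \<subseteq> all_points" using Int.IH(1) by (elim conjE) (rule le_infI1)
      show ?case by (intro conjI ballI impI e1 e2 e3)
    next
      case (UN K)
      have e1: "openin (top_of_set {0..1}) {t \<in> {0..1}. edge_point G e t \<in> \<Union>K}" if "e \<in> arcs G" for e
      proof -
        have "{t \<in> {0..1}. edge_point G e t \<in> \<Union>K} = (\<Union>k\<in>K. {t \<in> {0..1}. edge_point G e t \<in> k})" by auto
        moreover have "openin (top_of_set {0..1}) (\<Union>k\<in>K. {t \<in> {0..1}. edge_point G e t \<in> k})"
          using UN that by (intro openin_Union) auto
        ultimately show ?thesis by simp
      qed
      have e3: "\<Union>K \<subseteq> all_points" using UN.IH by (intro Union_least) simp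
      have e2: "\<exists>S. finite S \<and> S \<subseteq> verts G \<and> end_nbhd G S \<omega> \<subseteq> \<Union>K"
        if w: "\<omega> \<in> graph_ends G" "End \<omega> \<in> \<Union>K" for \<omega>
      proof -
        obtain k where k: "k \<in> K" "End \<omega> \<in> k" using w(2) by (elim UnionE)
        then obtain S where "finite S" "S \<subseteq> verts G" "end_nbhd G S \<omega> \<subseteq> k" using UN.IH[OF k(1)] w(1) by auto
        then show ?thesis using k(1) by (intro exI[of _ S]) auto
      qed
      show ?case by (intro conjI ballI impI e1 e2 e3)
    next
      case (Basis s)
      then consider "openin (graph_space G) s"
        | S \<omega> where "finite S" "S \<subseteq> verts G" "\<omega> \<in> graph_ends G" "s = end_nbhd G S \<omega>" by auto
      then show ?case
      proof cases
        case 1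
        then show ?thesis by (auto simp: openin_graph_space)
      next
        case 2
        note c = end_component[OF 2(3,1)]
        have e2: "end_nbhd G S \<eta> \<subseteq> s" if "\<eta> \<in> graph_ends G" "End \<eta> \<in> s" for \<eta>
        proof -
          have "end_component G S \<eta> = end_component G S \<omega>"
            using that 2 by (intro end_component_in c(1)) (auto simp: end_nbhd_eq)
          then show ?thesis using 2 by (simp add: end_nbhd_eq)
        qed
        have e3: "s \<subseteq> all_points" unfolding 2(4) end_nbhd_eq
          using components_minusD(2)[OF c(1)] by (intro nbhd_subset_points) auto
        have e1: "openin (top_of_set {0..1}) {t \<in> {0..1}. edge_point G e t \<in> s}" if "e \<in> arcs G" for e
          unfolding 2(4) end_nbhd_eq using that by (rule edge_preimage_nbhd)
        show ?thesis by (intro conjI ballI impI e1 e2 e3 exI[of _ S] 2(1,2))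
      qed
    qed
  next
    assume T: "?T W"
    let ?K = "{end_nbhd G S \<omega> | S \<omega>. finite S \<and> S \<subseteq> verts G \<and> \<omega> \<in> graph_ends G \<and> end_nbhd G S \<omega> \<subseteq> W}"
    have "W \<subseteq> \<Union>(insert (W \<inter> graph_points G) ?K)"
    proof
      fix x assume x: "x \<in> W"
      show "x \<in> \<Union>(insert (W \<inter> graph_points G) ?K)"
      proof (cases "x \<in> graph_points G")
        case False
        then obtain \<omega> where \<omega>: "x = End \<omega>" "\<omega> \<in> graph_ends G" using T x by blast
        then obtain S where S: "finite S" "S \<subseteq> verts G" "end_nbhd G S \<omega> \<subseteq> W" using T x by blast
        have "x \<in> end_nbhd G S \<omega>"
          using end_component(2)[OF \<omega>(2) S(1)] \<omega> by (simp add: end_nbhd_eq)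
        then show ?thesis using S \<omega> by blast
      qed (use x in simp)
    qed
    then have W: "W = \<Union>(insert (W \<inter> graph_points G) ?K)" by blast
    have "{t \<in> {0..1}. edge_point G e t \<in> W \<inter> graph_points G} = {t \<in> {0..1}. edge_point G e t \<in> W}"
      if "e \<in> arcs G" for e using that edge_point_in_graph by auto
    then have "openin (graph_space G) (W \<inter> graph_points G)"
      using T by (auto simp: openin_graph_space)
    then have "generate_topology_on ?B k" if "k \<in> insert (W \<inter> graph_points G) ?K" for k
      using that by (intro generate_topology_on.Basis) blast
    then show "generate_topology_on ?B W"
      by (subst W) (rule generate_topology_on.UN)
  qed
qed

lemma openin_graph_points: "openin (freudenthal G) (graph_points G)"
proof -
  have "{t \<in> {0..1}. edge_point G e t \<in> graph_points G} = {0..1}" if "e \<in> arcs G" for e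
    using that edge_point_in_graph by auto
  then show ?thesis unfolding openin_freudenthal by (auto simp: openin_unit_interval)
qed

lemma topspace_freudenthal: "topspace (freudenthal G) = all_points"
proof
  show "topspace (freudenthal G) \<subseteq> all_points"
    using openin_freudenthal[of "topspace (freudenthal G)"] by blast
  have "x \<in> topspace (freudenthal G)" if x: "x \<in> all_points" for x
  proof (cases "x \<in> graph_points G")
    case True
    then show ?thesis using openin_subset[OF openin_graph_points] by blast
  next
    case False
    then obtain \<omega> where \<omega>: "x = End \<omega>" "\<omega> \<in> graph_ends G" using x by blast
    have "openin (freudenthal G) (end_nbhd G {} \<omega>)"
      unfolding freudenthal_def using \<omega>(2) by (intro topology_generated_by_Basis) auto
    moreover have "x \<in> end_nbhd G {} \<omega>"
      using end_component(2)[OF \<omega>(2), of "{}"] \<omega> by (simp add: end_nbhd_eq)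
    ultimately show ?thesis using openin_subset by blast
  qed
  then show "all_points \<subseteq> topspace (freudenthal G)" by blast
qed

text \<open>The graph points form an open set, so relatively open means open. This moves arcs
  between the two spaces.\<close>

lemma graph_space_eq_subtopology: "graph_space G = subtopology (freudenthal G) (graph_points G)"
  unfolding topology_eq
proof (intro allI iffI)
  fix U assume U: "openin (graph_space G) U"
  then have "openin (freudenthal G) U"
    unfolding freudenthal_def by (intro topology_generated_by_Basis) simp
  moreover have "U \<subseteq> graph_points G" using U by (simp add: openin_graph_space)
  ultimately show "openin (subtopology (freudenthal G) (graph_points G)) U"
    by (simp add: openin_open_subtopology openin_graph_points)
next
  fix U assume "openin (subtopology (freudenthal G) (graph_points G)) U"
  then have "openin (freudenthal G) U" "U \<subseteq> graph_points G"
    by (simp_all add: openin_open_subtopology openin_graph_points)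
  then show "openin (graph_space G) U"
    by (simp add: openin_freudenthal openin_graph_space)
qed

lemma end_component_region_cases:
  assumes "\<eta> \<in> graph_ends G" "region D"
  shows "end_component G (boundary D) \<eta> \<subseteq> D \<or> end_component G (boundary D) \<eta> \<inter> D = {}"
proof (rule connset_cases)
  have "finite (boundary D)" using assms(2) by (simp add: region_def)
  note C = components_minusD[OF end_component(1)[OF assms(1) this]]
  show "connset (end_component G (boundary D) \<eta>)" by (rule C)
  show "end_component G (boundary D) \<eta> \<inter> boundary D = {}" using C(2) by auto
qed

lemma openin_nbhd:
  assumes "region D" shows "openin (freudenthal G) (nbhd D)"
  unfolding openin_freudenthal
proof (intro conjI ballI impI)
  show "nbhd D \<subseteq> all_points" using assms by (intro nbhd_subset_points) (auto simp: region_def)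
  show "openin (top_of_set {0..1}) {t \<in> {0..1}. edge_point G e t \<in> nbhd D}" if "e \<in> arcs G" for e
    using that by (rule edge_preimage_nbhd)
  fix \<eta> assume \<eta>: "\<eta> \<in> graph_ends G" "End \<eta> \<in> nbhd D"
  have fin: "finite (boundary D)" using assms by (simp add: region_def)
  note c = end_component[OF \<eta>(1) fin]
  have "in_end \<eta> D" using \<eta>(2) by simp
  then have "end_component G (boundary D) \<eta> \<inter> D \<noteq> {}"
    using in_end_nonempty[OF in_end_Int[OF \<eta>(1) c(2) _ component_region[OF fin c(1)]]] by blast
  then have "end_component G (boundary D) \<eta> \<subseteq> D"
    using end_component_region_cases[OF \<eta>(1) assms] by blast
  then show "\<exists>S. finite S \<and> S \<subseteq> verts G \<and> end_nbhd G S \<eta> \<subseteq> nbhd D"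
    using fin boundary_verts nbhd_mono unfolding end_nbhd_eq by (intro exI[of _ "boundary D"]) simp
qed

text \<open>For an end outside \<open>D\<close>, its component of \<open>G - boundary D\<close>
  misses \<open>D\<close>, and no edge joins the two, since a vertex next to \<open>D\<close> lies
  in \<open>D\<close> or in its boundary.\<close>

lemma openin_co_closed_nbhd:
  assumes "region D" shows "openin (freudenthal G) (all_points - closed_nbhd D)"
  unfolding openin_freudenthal
proof (intro conjI ballI impI)
  show "openin (top_of_set {0..1}) {t \<in> {0..1}. edge_point G e t \<in> all_points - closed_nbhd D}"
    if "e \<in> arcs G" for e using that by (rule edge_preimage_co_closed_nbhd)
  fix \<eta> assume \<eta>: "\<eta> \<in> graph_ends G" "End \<eta> \<in> all_points - closed_nbhd D"
  have fin: "finite (boundary D)" using assms by (simp add: region_def)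
  define C where "C = end_component G (boundary D) \<eta>"
  have c: "C \<in> components_minus G (boundary D)" "in_end \<eta> C"
    using end_component[OF \<eta>(1) fin] by (auto simp: C_def)
  have CV: "C \<subseteq> verts G - boundary D" using components_minusD[OF c(1)] by auto
  have "\<not> in_end \<eta> D" using \<eta> by simp
  then have "\<not> C \<subseteq> D" using c(2) in_end_mono by blast
  then have CD: "C \<inter> D = {}" using end_component_region_cases[OF \<eta>(1) assms] by (auto simp: C_def)
  have *: "x \<notin> closed_nbhd D" if x: "x \<in> nbhd C" for x
  proof (cases x)
    case (Vertex v)
    then show ?thesis using x CD CV by (auto simp: clos_def)
  next
    case (Inner e t)
    have "adj (tail G e) (head G e)" "adj (head G e) (tail G e)" if "e \<in> arcs G" using that by (auto simp: adj_def)
    then show ?thesis using x Inner CD CV by (auto simp: boundary_def)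
  next
    case (End \<zeta>)
    then have "\<zeta> \<in> graph_ends G" "in_end \<zeta> C" using x by auto
    then have "\<not> in_end \<zeta> D"
      using in_end_nonempty[OF in_end_Int[of \<zeta> C D]] component_region[OF fin c(1)] CD by blast
    then show ?thesis using End by simp
  qed
  then have "nbhd C \<subseteq> all_points - closed_nbhd D"
    using nbhd_subset_points[of C] CV by blast
  then show "\<exists>S. finite S \<and> S \<subseteq> verts G \<and> end_nbhd G S \<eta> \<subseteq> all_points - closed_nbhd D"
    using fin boundary_verts unfolding end_nbhd_eq C_def by (intro exI[of _ "boundary D"]) simp
qed blast

lemma closed_nbhd_subset_points: "D \<subseteq> verts G \<Longrightarrow> closed_nbhd D \<subseteq> all_points"
  using nbhd_subset_points[of D] boundary_verts[of D] by (auto simp: closed_nbhd_def)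

lemma closedin_closed_nbhd: "region D \<Longrightarrow> closedin (freudenthal G) (closed_nbhd D)"
  using openin_co_closed_nbhd closed_nbhd_subset_points
  by (simp add: closedin_def topspace_freudenthal region_def)

lemma end_region_in_open:
  assumes "\<omega> \<in> graph_ends G" "openin (freudenthal G) W" "End \<omega> \<in> W"
  obtains D where "end_region \<omega> D" "nbhd D \<subseteq> W"
proof -
  obtain S where S: "finite S" "end_nbhd G S \<omega> \<subseteq> W"
    using assms by (auto simp: openin_freudenthal)
  then have "end_region \<omega> (end_component G S \<omega>)"
    using end_component[OF assms(1) S(1)] components_minusD(1) component_region[OF S(1)]
    by (auto simp: end_region_def)
  then show thesis using S(2) that by (simp add: end_nbhd_eq)
qed

lemma end_region_avoids_point:
  assumes "\<omega> \<in> graph_ends G" "p \<in> graph_points G"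
  obtains D where "end_region \<omega> D" "p \<notin> closed_nbhd D"
proof -
  define Z where "Z = (case p of Vertex v \<Rightarrow> {v} | Inner e t \<Rightarrow> {tail G e, head G e} | End _ \<Rightarrow> {})"
  have "finite Z" by (auto simp: Z_def split: point.split)
  then obtain D' where D': "end_region \<omega> D'" "clos D' \<subseteq> verts G" "D' \<inter> Z = {}"
    by (rule end_region_inside[OF assms(1) end_region_verts[OF assms(1)]])
  \<comment> \<open>The second step is for the boundary: \<open>D'\<close> avoids \<open>Z\<close>,
    hence so does \<open>clos D\<close>.\<close>
  obtain D where D: "end_region \<omega> D" "clos D \<subseteq> D'" "D \<inter> {} = {}"
    by (rule end_region_inside[OF assms(1) D'(1) finite.emptyI])
  have "p \<notin> closed_nbhd D"
    using D(2) D'(3) assms(2) by (cases p) (auto simp: Z_def clos_def)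
  with D(1) show thesis by (rule that)
qed

section \<open>The Hausdorff property\<close>

lemma continuous_map_graph_space_real:
  fixes h :: "('v, 'e) point \<Rightarrow> real"
  assumes "\<And>e. e \<in> arcs G \<Longrightarrow> continuous_on {0..1} (\<lambda>t. h (edge_point G e t))"
  shows "continuous_map (graph_space G) euclideanreal h"
  unfolding continuous_map topspace_graph_space[OF wf_digraph]
proof (intro conjI allI impI)
  fix U :: "real set" assume "openin euclideanreal U"
  then have U: "open U" by simp
  have "openin (top_of_set {0..1}) {t \<in> {0..1}. edge_point G e t \<in> {x \<in> graph_points G. h x \<in> U}}"
    if e: "e \<in> arcs G" for e
  proof -
    have "{t \<in> {0..1}. edge_point G e t \<in> {x \<in> graph_points G. h x \<in> U}} =
      {0..1} \<inter> (\<lambda>t. h (edge_point G e t)) -` U" using edge_point_in_graph[OF e] by auto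
    then show ?thesis using continuous_openin_preimage_gen[OF assms[OF e] U] by simp
  qed
  then show "openin (graph_space G) {x \<in> graph_points G. h x \<in> U}"
    by (auto simp: openin_graph_space)
qed auto

text \<open>The tent function at \<open>v\<close>: linear on every edge, 1 at \<open>v\<close> and 0
  at the other vertices.\<close>

definition vertex_fun :: "'v \<Rightarrow> ('v, 'e) point \<Rightarrow> real" where
  "vertex_fun v p = (case p of Vertex w \<Rightarrow> of_bool (w = v)
     | Inner e t \<Rightarrow> (1 - t) * of_bool (tail G e = v) + t * of_bool (head G e = v) | End _ \<Rightarrow> 0)"

definition edge_fun :: "(real \<Rightarrow> real) \<Rightarrow> 'e \<Rightarrow> ('v, 'e) point \<Rightarrow> real" where
  "edge_fun f e p = (case p of Inner e' t \<Rightarrow> if e' = e then f t else 0 | _ \<Rightarrow> 0)"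

lemma continuous_vertex_fun: "continuous_map (graph_space G) euclideanreal (vertex_fun v)"
proof (rule continuous_map_graph_space_real)
  fix e
  have "vertex_fun v (edge_point G e t) = (1 - t) * of_bool (tail G e = v) + t * of_bool (head G e = v)" for t
    by (auto simp: vertex_fun_def edge_point_def)
  then show "continuous_on {0..1} (\<lambda>t. vertex_fun v (edge_point G e t))"
    by (simp only:) (intro continuous_intros)
qed

lemma continuous_edge_fun:
  assumes "f 0 = 0" "f 1 = 0" "continuous_on {0..1} f"
  shows "continuous_map (graph_space G) euclideanreal (edge_fun f e)"
proof (rule continuous_map_graph_space_real)
  fix e'
  have "edge_fun f e (edge_point G e' t) = (if e' = e then f t else 0)" for t
    using assms by (auto simp: edge_fun_def edge_point_def)
  then show "continuous_on {0..1} (\<lambda>t. edge_fun f e (edge_point G e' t))"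
    using assms(3) by (cases "e' = e") simp_all
qed

text \<open>Separation in the quotient topology is obtained from real functions, whose continuity
  can be tested on each edge.\<close>

lemma graph_points_separated:
  assumes xy: "x \<in> graph_points G" "y \<in> graph_points G" "x \<noteq> y"
  obtains h where "continuous_map (graph_space G) euclideanreal h" "h x \<noteq> h y"
proof -
  define f where "f t = t * (1 - t)" for t :: real
  \<comment> \<open>\<open>f\<close> takes the same value at \<open>t\<close> and
    \<open>1 - t\<close>; wherever \<open>f\<close> agrees and is positive, the extra factor
    \<open>t\<close> of \<open>g\<close> distinguishes the points.\<close>
  define g where "g t = t * f t" for t :: real
  have cf: "continuous_map (graph_space G) euclideanreal (edge_fun f e)" for e
    by (rule continuous_edge_fun) (auto simp: f_def intro!: continuous_intros)
  have cg: "continuous_map (graph_space G) euclideanreal (edge_fun g e)" for e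
    by (rule continuous_edge_fun) (auto simp: f_def g_def intro!: continuous_intros)
  have pos: "f t > 0" if "0 < t" "t < 1" for t using that by (simp add: f_def)
  consider v w where "x = Vertex v" "y = Vertex w"
    | v e t where "x = Vertex v" "y = Inner e t" | v e t where "x = Inner e t" "y = Vertex v"
    | e t e' s where "x = Inner e t" "y = Inner e' s"
    using xy by (cases x; cases y) auto
  then show thesis
  proof cases
    case 1
    then show ?thesis using that[OF continuous_vertex_fun[of v]] xy by (auto simp: vertex_fun_def)
  next
    case (2 v e t)
    then show ?thesis using that[OF cf[of e]] xy pos[of t] by (auto simp: edge_fun_def)
  next
    case (3 v e t)
    then show ?thesis using that[OF cf[of e]] xy pos[of t] by (auto simp: edge_fun_def)
  next
    case (4 e t e' s)
    show ?thesis
    proof (cases "e = e' \<and> f t = f s")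
      case True
      then have "g t \<noteq> g s" using 4 xy pos[of t] by (auto simp: g_def)
      then show ?thesis using that[OF cg[of e]] 4 True by (auto simp: edge_fun_def)
    next
      case False
      then show ?thesis using that[OF cf[of e]] 4 xy pos[of t] by (auto simp: edge_fun_def)
    qed
  qed
qed

lemma Hausdorff_freudenthal: "Hausdorff_space (freudenthal G)"
proof -
  define sep where "sep x y \<longleftrightarrow> (\<exists>U V. openin (freudenthal G) U \<and> openin (freudenthal G) V \<and>
     x \<in> U \<and> y \<in> V \<and> disjnt U V)" for x y
  have sep_sym: "sep x y" if "sep y x" for x y
  proof -
    obtain U V where "openin (freudenthal G) U" "openin (freudenthal G) V" "y \<in> U" "x \<in> V" "disjnt U V"
      using \<open>sep y x\<close> unfolding sep_def by (elim exE conjE)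
    then show ?thesis unfolding sep_def by (intro exI[of _ V] exI[of _ U]) (simp add: disjnt_sym)
  qed
  have region_sep: "sep x y" if "region D" "x \<in> nbhd D" "y \<in> all_points - closed_nbhd D" for x y D
    unfolding sep_def using that openin_nbhd openin_co_closed_nbhd
    by (intro exI[of _ "nbhd D"] exI[of _ "all_points - closed_nbhd D"])
      (auto simp: disjnt_def closed_nbhd_def)
  have graph_end: "sep (End \<omega>) p" if \<omega>: "\<omega> \<in> graph_ends G" and p: "p \<in> graph_points G" for \<omega> p
  proof -
    obtain D where "end_region \<omega> D" "p \<notin> closed_nbhd D"
      using end_region_avoids_point[OF \<omega> p] .
    then show ?thesis using \<omega> p by (intro region_sep[of D]) (auto simp: end_region_def)
  qed
  have "sep x y" if xy: "x \<in> all_points" "y \<in> all_points" "x \<noteq> y" for x y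
  proof -
    consider "x \<in> graph_points G" "y \<in> graph_points G"
      | \<omega> where "\<omega> \<in> graph_ends G" "x = End \<omega>" "y \<in> graph_points G"
      | \<omega> where "\<omega> \<in> graph_ends G" "y = End \<omega>" "x \<in> graph_points G"
      | \<omega> \<eta> where "\<omega> \<in> graph_ends G" "\<eta> \<in> graph_ends G" "x = End \<omega>" "y = End \<eta>"
      using xy(1,2) by (elim UnE imageE; blast)
    then show ?thesis
    proof cases
      case 1
      then obtain h where h: "continuous_map (graph_space G) euclideanreal h" "h x \<noteq> h y"
        by (rule graph_points_separated[OF _ _ xy(3)])
      obtain U V where UV: "open U" "open V" "h x \<in> U" "h y \<in> V" "U \<inter> V = {}"
        using hausdorff[OF h(2)] by blast
      have o: "openin (freudenthal G) {z \<in> graph_points G. h z \<in> A}" if "open A" for A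
        using openin_continuous_map_preimage[OF h(1), of A] that
        by (simp add: topspace_graph_space[OF wf_digraph])
          (simp add: graph_space_eq_subtopology openin_open_subtopology openin_graph_points)
      show ?thesis unfolding sep_def using o[OF UV(1)] o[OF UV(2)] 1 UV
        by (intro exI[of _ "{z \<in> graph_points G. h z \<in> U}"] exI[of _ "{z \<in> graph_points G. h z \<in> V}"])
          (auto simp: disjnt_def)
    next
      case (2 \<omega>)
      then show ?thesis using graph_end by simp
    next
      case (3 \<omega>)
      then show ?thesis using graph_end[of \<omega> x] by (intro sep_sym[of y x]) simp
    next
      case (4 \<omega> \<eta>)
      then obtain D where D: "region D" "in_end \<omega> D \<longleftrightarrow> \<not> in_end \<eta> D"
        using end_distinguish[of \<omega> \<eta>] xy(3) by auto
      show ?thesis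
      proof (cases "in_end \<omega> D")
        case True
        then show ?thesis using 4 D by (intro region_sep[OF D(1)]) auto
      next
        case False
        then show ?thesis using 4 D by (intro sep_sym[of y x] region_sep[OF D(1)]) auto
      qed
    qed
  qed
  then show ?thesis unfolding Hausdorff_space_def topspace_freudenthal sep_def by simp
qed

end


section \<open>Rerouting an arc into the graph\<close>

lemma arc_from_to_start_neighbour:
  assumes "arc_from_to X p q A" "p \<noteq> q" "openin X U" "p \<in> U"
  obtains y where "y \<in> A" "y \<in> U" "y \<noteq> p"
proof -
  obtain f where f: "continuous_map (top_of_set {0..1::real}) X f" "inj_on f {0..1}"
    "f 0 = p" "f 1 = q" "A = f ` {0..1}"
    by (rule arc_from_to_unit[OF assms(1,2)])
  have "openin (top_of_set {0..1}) {t \<in> {0..1}. f t \<in> U}"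
    using openin_continuous_map_preimage[OF f(1) assms(3)] by simp
  moreover have "0 \<in> {t \<in> {0..1}. f t \<in> U}" using f(3) assms(4) by simp
  ultimately obtain e where e: "e > 0" "\<And>t. t \<in> {0..1} \<Longrightarrow> dist t 0 < e \<Longrightarrow> f t \<in> U"
    unfolding openin_euclidean_subtopology_iff by (metis (mono_tags, lifting) mem_Collect_eq)
  define t where "t = min 1 (e / 2)"
  have t: "t \<in> {0..1}" "0 < t" "dist t 0 < e" using e(1) by (auto simp: t_def)
  show thesis
  proof (rule that)
    show "f t \<in> A" using t f(5) by blast
    show "f t \<in> U" using e(2) t by blast
    show "f t \<noteq> p" using inj_onD[OF f(2), of t 0] t f(3) by auto
  qed
qed

lemma arc_from_to_degenerate:
  assumes "arc_from_to X p p A" shows "A = {p}"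
proof -
  obtain f a b where f: "a \<le> (b::real)" "continuous_map (top_of_set {a..b}) X f" "inj_on f {a..b}"
    "f a = p" "f b = p" "A = f ` {a..b}"
    using assms unfolding arc_from_to_def by blast
  then have "a = b" using inj_onD[OF f(3), of a b] by simp
  then show ?thesis using f by simp
qed

text \<open>Trims the arc at the extreme points of \<open>T\<close> in both directions, so that its
  end points belong to \<open>T\<close>. An arc ending in ends of the graph thereby gets end points
  in the graph.\<close>

lemma arc_from_to_finite_hull:
  assumes H: "Hausdorff_space X" and A: "arc_from_to X a b A" and T: "finite T" "T \<noteq> {}" "T \<subseteq> A"
  obtains p q B where "arc_from_to X p q B" "p \<in> T" "q \<in> T" "T \<subseteq> B" "B \<subseteq> A"
proof -
  have "closedin X T"
    using T arc_from_to_subset[OF A] by (intro closedin_Hausdorff_finite[OF H]) auto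
  note hit = arc_from_to_last_hit[OF _ this]
  obtain x B1 C1 where 1: "arc_from_to X a x B1" "arc_from_to X x b C1" "A = B1 \<union> C1"
    "B1 \<inter> C1 = {x}" "C1 \<inter> T = {x}"
    by (rule hit[OF A]) (use T in auto)
  have T1: "T \<subseteq> B1" using 1 T(3) by blast
  obtain y B2 C2 where 2: "arc_from_to X x y B2" "arc_from_to X y a C2" "B1 = B2 \<union> C2"
    "B2 \<inter> C2 = {y}" "C2 \<inter> T = {y}"
    by (rule hit[OF arc_from_to_sym[OF 1(1)]]) (use T T1 in auto)
  show thesis
    by (rule that[OF 2(1)]) (use 1 2 T1 in blast)+
qed

context lf_graph
begin

section \<open>Paths of the graph as arcs\<close>

lemma span_mono: "P \<subseteq> Q \<Longrightarrow> span P \<subseteq> span Q"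
  by (auto simp: span_def)

lemma span_Int: "span P \<inter> span Q = span (P \<inter> Q)"
  by (auto simp: span_def)

lemma span_empty: "span {} = {}"
  by (simp add: span_def)

lemma span_singleton: "span {v} = {Vertex v}"
  by (auto simp: span_def)

lemma span_subset_graph: "P \<subseteq> verts G \<Longrightarrow> span P \<subseteq> graph_points G"
  by (auto simp: span_def)

lemma continuous_map_edge_point:
  assumes "e \<in> arcs G"
  shows "continuous_map (top_of_set {0..1}) (freudenthal G) (edge_point G e)"
proof -
  have "continuous_map (top_of_set {0..1}) (graph_space G) (edge_point G e)"
    unfolding continuous_map topspace_graph_space[OF wf_digraph]
    using edge_point_in_graph[OF assms] assms by (auto simp: openin_graph_space)
  then show ?thesis unfolding graph_space_eq_subtopology continuous_map_in_subtopology by simp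
qed

lemma edge_arc:
  assumes "adj u v" "u \<noteq> v"
  obtains A where "arc_from_to (freudenthal G) (Vertex u) (Vertex v) A" "A \<subseteq> span {u, v}"
proof -
  obtain e where e: "e \<in> arcs G" "tail G e = u \<and> head G e = v \<or> tail G e = v \<and> head G e = u"
    using assms(1) by (auto simp: adj_def)
  have ne: "tail G e \<noteq> head G e" using e(2) assms(2) by auto
  have inj: "inj_on (edge_point G e) {0..1}"
    using ne by (auto simp: inj_on_def edge_point_def split: if_splits)
  have "arc_from_to (freudenthal G) (edge_point G e 0) (edge_point G e 1) (edge_point G e ` {0..1})"
    by (rule arc_from_toI[OF continuous_map_edge_point[OF e(1)] inj]) simp
  then have arc: "arc_from_to (freudenthal G) (Vertex (tail G e)) (Vertex (head G e)) (edge_point G e ` {0..1})"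
    by (simp add: edge_point_def)
  have sub: "edge_point G e ` {0..1} \<subseteq> span {u, v}"
    using e ne by (auto simp: edge_point_def)
  show thesis
    using e(2)
  proof (elim disjE conjE)
    assume "tail G e = u" "head G e = v"
    then show thesis using that arc sub by simp
  next
    assume "tail G e = v" "head G e = u"
    then show thesis using that arc_from_to_sym[OF arc] sub by simp
  qed
qed

lemma reach_arc:
  assumes "(u, v) \<in> reach P" "u \<in> P" "P \<subseteq> verts G"
  shows "\<exists>A. arc_from_to (freudenthal G) (Vertex u) (Vertex v) A \<and> A \<subseteq> span P"
  using assms(1) unfolding reach_def
proof (induction rule: rtrancl_induct)
  case base
  have "arc_from_to (freudenthal G) (Vertex u) (Vertex u) {Vertex u}"
    using assms by (intro arc_from_to_refl) (auto simp: topspace_freudenthal)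
  then show ?case using assms(2) by (intro exI[of _ "{Vertex u}"]) auto
next
  case (step y z)
  then obtain A where A: "arc_from_to (freudenthal G) (Vertex u) (Vertex y) A" "A \<subseteq> span P" by blast
  show ?case
  proof (cases "y = z")
    case True
    then show ?thesis using A by blast
  next
    case False
    have yz: "adj y z" "{y, z} \<subseteq> P" using step(2) by auto
    obtain B where B: "arc_from_to (freudenthal G) (Vertex y) (Vertex z) B" "B \<subseteq> span {y, z}"
      by (rule edge_arc[OF yz(1) False])
    obtain C where C: "arc_from_to (freudenthal G) (Vertex u) (Vertex z) C" "C \<subseteq> A \<union> B"
      by (rule arc_from_to_trans[OF Hausdorff_freudenthal A(1) B(1)])
    have "C \<subseteq> span P" using C(2) A(2) B(2) span_mono[OF yz(2)] by blast
    then show ?thesis using C(1) by blast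
  qed
qed

text \<open>If the last point in \<open>closed_nbhd D\<close> were in the open set
  \<open>nbhd D\<close>, the arc would stay there a little longer.\<close>

lemma hit_boundary:
  assumes "region D" "arc_from_to (freudenthal G) x q C" "C \<inter> closed_nbhd D = {x}" "q \<notin> closed_nbhd D"
  shows "x \<in> Vertex ` boundary D"
proof (rule ccontr)
  assume "x \<notin> Vertex ` boundary D"
  then have "x \<in> nbhd D" using assms(3) by (auto simp: closed_nbhd_def)
  moreover have "x \<noteq> q" using assms(3,4) by auto
  ultimately obtain y where "y \<in> C" "y \<in> nbhd D" "y \<noteq> x"
    using arc_from_to_start_neighbour[OF assms(2) _ openin_nbhd[OF assms(1)]] by metis
  then show False using assms(3) by (auto simp: closed_nbhd_def)
qed

lemma boundary_arc:
  assumes "region D" "connset D" "b \<in> boundary D" "b' \<in> boundary D"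
  obtains M where "arc_from_to (freudenthal G) (Vertex b) (Vertex b') M"
    "M \<subseteq> closed_nbhd D" "M \<subseteq> graph_points G"
proof -
  have DV: "D \<subseteq> verts G" using assms(1) by (simp add: region_def)
  obtain a a' where a: "a \<in> D" "adj a b" "a' \<in> D" "adj a' b'"
    using assms(3,4) by (auto simp: boundary_def)
  have ne: "b \<noteq> a" "a' \<noteq> b'" using a assms(3,4) by (auto simp: boundary_def)
  obtain A1 where A1: "arc_from_to (freudenthal G) (Vertex b) (Vertex a) A1" "A1 \<subseteq> span {b, a}"
    by (rule edge_arc[OF adj_sym[OF a(2)] ne(1)])
  obtain A3 where A3: "arc_from_to (freudenthal G) (Vertex a') (Vertex b') A3" "A3 \<subseteq> span {a', b'}"
    by (rule edge_arc[OF a(4) ne(2)])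
  have "(a, a') \<in> reach D" using assms(2) a by (simp add: connset_def)
  then obtain A2 where A2: "arc_from_to (freudenthal G) (Vertex a) (Vertex a') A2" "A2 \<subseteq> span D"
    using reach_arc[OF _ a(1) DV] by blast
  obtain A4 where A4: "arc_from_to (freudenthal G) (Vertex b) (Vertex a') A4" "A4 \<subseteq> A1 \<union> A2"
    by (rule arc_from_to_trans[OF Hausdorff_freudenthal A1(1) A2(1)])
  obtain M where M: "arc_from_to (freudenthal G) (Vertex b) (Vertex b') M" "M \<subseteq> A4 \<union> A3"
    by (rule arc_from_to_trans[OF Hausdorff_freudenthal A4(1) A3(1)])
  have 1: "M \<subseteq> span {b, a} \<union> span D \<union> span {a', b'}" using M(2) A4(2) A1(2) A2(2) A3(2) by blast
  have "span {b, a} \<subseteq> closed_nbhd D" "span {a', b'} \<subseteq> closed_nbhd D" "span D \<subseteq> closed_nbhd D"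
    using a assms(3,4) by (auto simp: span_def clos_def)
  moreover have "span {b, a} \<subseteq> graph_points G" "span {a', b'} \<subseteq> graph_points G" "span D \<subseteq> graph_points G"
    using a assms(3,4) DV boundary_verts by (intro span_subset_graph; blast)+
  ultimately show thesis using that[OF M(1)] 1 by blast
qed

text \<open>The regions are dealt with one at a time. A detour may enter other regions of the
  family, but it consists of graph points, so the ends still on the arc stay covered by the
  remaining regions. \<open>K\<close> is to hold the parts of a longer arc that must not be
  touched.\<close>

lemma avoid_regions:
  assumes "finite \<D>"
    "\<And>D. D \<in> \<D> \<Longrightarrow> region D \<and> connset D \<and> closed_nbhd D \<inter> (K \<union> {p, q}) = {}"
    "arc_from_to (freudenthal G) p q A" "A \<inter> K \<subseteq> {p, q}"
    "A \<subseteq> graph_points G \<union> (\<Union>D\<in>\<D>. nbhd D)"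
  shows "\<exists>A'. arc_from_to (freudenthal G) p q A' \<and> A' \<subseteq> graph_points G \<and> A' \<inter> K \<subseteq> {p, q}"
  using assms
proof (induction \<D> arbitrary: A rule: finite_induct)
  case empty
  then show ?case by auto
next
  case (insert D \<D>)
  have D: "region D" "connset D" "closed_nbhd D \<inter> (K \<union> {p, q}) = {}" using insert.prems(1) by auto
  have pq: "p \<notin> closed_nbhd D" "q \<notin> closed_nbhd D" using D(3) by auto
  have IH: "\<exists>A'. arc_from_to (freudenthal G) p q A' \<and> A' \<subseteq> graph_points G \<and> A' \<inter> K \<subseteq> {p, q}"
    if "arc_from_to (freudenthal G) p q A" "A \<inter> K \<subseteq> {p, q}"
      "A \<subseteq> graph_points G \<union> (\<Union>D\<in>\<D>. nbhd D)" for A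
    using that insert.prems(1) by (intro insert.IH) auto
  show ?case
  proof (cases "A \<inter> closed_nbhd D = {}")
    case True
    then have "A \<subseteq> graph_points G \<union> (\<Union>D\<in>\<D>. nbhd D)"
      using insert.prems(4) by (auto simp: closed_nbhd_def)
    then show ?thesis using IH insert.prems by blast
  next
    case False
    note hit = arc_from_to_last_hit[OF _ closedin_closed_nbhd[OF D(1)]]
    obtain y B1 C1 where 1: "arc_from_to (freudenthal G) p y B1" "arc_from_to (freudenthal G) y q C1"
      "A = B1 \<union> C1" "B1 \<inter> C1 = {y}" "C1 \<inter> closed_nbhd D = {y}"
      by (rule hit[OF insert.prems(2) False])
    have "y \<in> B1" "y \<in> closed_nbhd D" using 1 by auto
    then have "B1 \<inter> closed_nbhd D \<noteq> {}" by auto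
    then obtain x B2 C2 where 2: "arc_from_to (freudenthal G) y x B2" "arc_from_to (freudenthal G) x p C2"
      "B1 = B2 \<union> C2" "B2 \<inter> C2 = {x}" "C2 \<inter> closed_nbhd D = {x}"
      by (rule hit[OF arc_from_to_sym[OF 1(1)]])
    obtain b b' where b: "b \<in> boundary D" "x = Vertex b" "b' \<in> boundary D" "y = Vertex b'"
      using hit_boundary[OF D(1) 1(2,5) pq(2)] hit_boundary[OF D(1) 2(2,5) pq(1)] by auto
    obtain M where M: "arc_from_to (freudenthal G) x y M" "M \<subseteq> closed_nbhd D" "M \<subseteq> graph_points G"
      using boundary_arc[OF D(1,2) b(1,3)] b by auto
    note MD = M(2)
    \<comment> \<open>The outer pieces meet \<open>closed_nbhd D\<close> only in \<open>x\<close>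
      and \<open>y\<close>, so any arc between these inside \<open>closed_nbhd D\<close>
      fits.\<close>
    have "arc_from_to (freudenthal G) p y (C2 \<union> M)"
      by (rule arc_from_to_join[OF arc_from_to_sym[OF 2(2)] M(1)]) (use 2(5) MD in blast)
    then have arc: "arc_from_to (freudenthal G) p q (C2 \<union> M \<union> C1)"
      by (rule arc_from_to_join[OF _ 1(2)]) (use 2(3) 1(4,5) MD in blast)
    show ?thesis
    proof (rule IH[OF arc])
      show "(C2 \<union> M \<union> C1) \<inter> K \<subseteq> {p, q}" using insert.prems(3) 1(3) 2(3) MD D(3) by blast
      have *: "z \<in> graph_points G \<union> (\<Union>D\<in>\<D>. nbhd D)" if "z \<in> C1 \<union> C2" for z
      proof (cases "z \<in> nbhd D")
        case True
        then have "z \<in> {x, y}" using that 1(5) 2(5) by (auto simp: closed_nbhd_def)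
        then show ?thesis using b boundary_verts[of D] by auto
      next
        case False
        then show ?thesis using that 1(3) 2(3) insert.prems(4) by blast
      qed
      show "C2 \<union> M \<union> C1 \<subseteq> graph_points G \<union> (\<Union>D\<in>\<D>. nbhd D)"
        by (intro Un_least subsetI) (use M(3) * in simp_all, blast)
    qed
  qed
qed

text \<open>Finitely many regions suffice because the graph points are open: the ends on the arc
  form a closed subset of a compact set.\<close>

lemma arc_into_graph:
  assumes pq: "p \<in> graph_points G" "q \<in> graph_points G" and K: "closedin (freudenthal G) K"
    and A: "arc_from_to (freudenthal G) p q A" "A \<inter> K \<subseteq> {p, q}"
  shows "\<exists>A'. arc_from_to (freudenthal G) p q A' \<and> A' \<subseteq> graph_points G \<and> A' \<inter> K \<subseteq> {p, q}"
proof -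
  define \<C> where "\<C> = {D. region D \<and> connset D \<and> closed_nbhd D \<inter> (K \<union> {p, q}) = {}}"
  have At: "A \<subseteq> all_points" using arc_from_to_subset[OF A(1)] by (simp add: topspace_freudenthal)
  have "closedin (freudenthal G) (all_points - graph_points G)"
    using openin_graph_points by (metis openin_closedin_eq topspace_freudenthal)
  then have comp: "compactin (freudenthal G) ((all_points - graph_points G) \<inter> A)"
    by (rule closed_Int_compactin[OF _ arc_from_to_compactin[OF A(1)]])
  have cover: "(all_points - graph_points G) \<inter> A \<subseteq> \<Union>(nbhd ` \<C>)"
  proof
    fix z assume z: "z \<in> (all_points - graph_points G) \<inter> A"
    then obtain \<omega> where \<omega>: "z = End \<omega>" "\<omega> \<in> graph_ends G" by auto
    have "closedin (freudenthal G) (K \<union> {p, q})"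
      using pq by (intro closedin_Un K closedin_Hausdorff_finite[OF Hausdorff_freudenthal])
        (auto simp: topspace_freudenthal)
    then have W: "openin (freudenthal G) (all_points - (K \<union> {p, q}))"
      by (metis openin_diff openin_topspace topspace_freudenthal)
    have zW: "End \<omega> \<in> all_points - (K \<union> {p, q})" using z \<omega> A(2) pq by auto
    obtain D0 where D0: "end_region \<omega> D0" "nbhd D0 \<subseteq> all_points - (K \<union> {p, q})"
      by (rule end_region_in_open[OF \<omega>(2) W zW])
    obtain D where D: "end_region \<omega> D" "clos D \<subseteq> D0" "D \<inter> {} = {}"
      by (rule end_region_inside[OF \<omega>(2) D0(1) finite.emptyI])
    have "D \<in> \<C>" using D(1) closed_nbhd_subset_nbhd[OF D(2)] D0(2) by (auto simp: \<C>_def end_region_def)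
    moreover have "z \<in> nbhd D" using \<omega> D(1) by (simp add: end_region_def)
    ultimately show "z \<in> \<Union>(nbhd ` \<C>)" by blast
  qed
  have "\<exists>\<F>. finite \<F> \<and> \<F> \<subseteq> nbhd ` \<C> \<and> (all_points - graph_points G) \<inter> A \<subseteq> \<Union>\<F>"
    by (rule compactinD[OF comp _ cover]) (use openin_nbhd in \<open>auto simp: \<C>_def\<close>)
  then obtain \<F> where \<F>: "finite \<F>" "\<F> \<subseteq> nbhd ` \<C>" "(all_points - graph_points G) \<inter> A \<subseteq> \<Union>\<F>"
    by (elim exE conjE)
  have "\<exists>\<D>\<subseteq>\<C>. finite \<D> \<and> \<F> = nbhd ` \<D>" by (rule finite_subset_image[OF \<F>(1,2)])
  then obtain \<D> where \<D>: "\<D> \<subseteq> \<C>" "finite \<D>" "\<F> = nbhd ` \<D>" by (elim exE conjE)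
  have "A \<subseteq> graph_points G \<union> (\<Union>D\<in>\<D>. nbhd D)"
    using \<F>(3) At unfolding \<D>(3) by blast
  moreover have "region D \<and> connset D \<and> closed_nbhd D \<inter> (K \<union> {p, q}) = {}" if "D \<in> \<D>" for D
    using that \<D>(1) unfolding \<C>_def by blast
  ultimately show ?thesis by (intro avoid_regions[OF \<D>(2) _ A])
qed

text \<open>Cut at a point \<open>t\<close> of \<open>T\<close>. The first segment is rerouted with
  the second added to \<open>K\<close>, then the second with the new first segment added to
  \<open>K\<close>. Since \<open>t\<close> is an end point of both, each segment has to pass through
  fewer points of \<open>T\<close>.\<close>

lemma arc_into_graph_through:
  assumes "finite T" "p \<in> graph_points G" "q \<in> graph_points G" "closedin (freudenthal G) K"
    "arc_from_to (freudenthal G) p q A" "A \<inter> K \<subseteq> {p, q}" "T \<subseteq> A \<inter> graph_points G"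
  shows "\<exists>A'. arc_from_to (freudenthal G) p q A' \<and> A' \<subseteq> graph_points G \<and> A' \<inter> K \<subseteq> {p, q} \<and> T \<subseteq> A'"
  using assms
proof (induction T arbitrary: p q K A rule: finite_psubset_induct)
  case (psubset T)
  note H = Hausdorff_freudenthal
  show ?case
  proof (cases "T = {}")
    case True
    then show ?thesis using arc_into_graph[OF psubset.prems(1-5)] by auto
  next
    case False
    then obtain t where t: "t \<in> T" by auto
    then have tA: "t \<in> A" "t \<in> graph_points G" using psubset.prems(6) by auto
    obtain B C where BC: "arc_from_to (freudenthal G) p t B" "arc_from_to (freudenthal G) t q C"
      "A = B \<union> C" "B \<inter> C = {t}"
      by (rule arc_from_to_split[OF psubset.prems(4) tA(1)])
    have mem: "p \<in> B" "q \<in> C" using arc_from_to_ends BC(1,2) by metis+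
    have clC: "closedin (freudenthal G) (K \<union> C)"
      by (intro closedin_Un psubset.prems(3) arc_from_to_closedin[OF H BC(2)])
    have "\<exists>B'. arc_from_to (freudenthal G) p t B' \<and> B' \<subseteq> graph_points G \<and>
        B' \<inter> (K \<union> C) \<subseteq> {p, t} \<and> T \<inter> B - {t} \<subseteq> B'"
      by (rule psubset.IH[OF _ psubset.prems(1) tA(2) clC BC(1)])
        (use t BC(3,4) mem psubset.prems(5,6) in blast)+
    then obtain B' where B': "arc_from_to (freudenthal G) p t B'" "B' \<subseteq> graph_points G"
      "B' \<inter> (K \<union> C) \<subseteq> {p, t}" "T \<inter> B - {t} \<subseteq> B'" by blast
    have clB: "closedin (freudenthal G) (K \<union> B')"
      by (intro closedin_Un psubset.prems(3) arc_from_to_closedin[OF H B'(1)])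
    have "\<exists>C'. arc_from_to (freudenthal G) t q C' \<and> C' \<subseteq> graph_points G \<and>
        C' \<inter> (K \<union> B') \<subseteq> {t, q} \<and> T \<inter> C - {t} \<subseteq> C'"
      by (rule psubset.IH[OF _ tA(2) psubset.prems(2) clB BC(2)])
        (use t BC(3,4) mem psubset.prems(5,6) B'(3) in blast)+
    then obtain C' where C': "arc_from_to (freudenthal G) t q C'" "C' \<subseteq> graph_points G"
      "C' \<inter> (K \<union> B') \<subseteq> {t, q}" "T \<inter> C - {t} \<subseteq> C'" by blast
    have tB: "t \<in> B'" "t \<in> C'" using arc_from_to_ends B'(1) C'(1) by metis+
    have "B' \<inter> C' \<subseteq> {t}" using C'(3) B'(3) mem BC(4) by blast
    then have "arc_from_to (freudenthal G) p q (B' \<union> C')"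
      by (rule arc_from_to_join[OF B'(1) C'(1)])
    moreover have "(B' \<union> C') \<inter> K \<subseteq> {p, q}" using B'(3) C'(3) psubset.prems(5) tA(1) by blast
    moreover have "T \<subseteq> B' \<union> C'" using B'(4) C'(4) tB psubset.prems(6) BC(3) by blast
    ultimately show ?thesis using B'(2) C'(2) by blast
  qed
qed

section \<open>Graph points on an arc\<close>

lemma Hausdorff_graph_space: "Hausdorff_space (graph_space G)"
  unfolding graph_space_eq_subtopology by (rule Hausdorff_space_subtopology[OF Hausdorff_freudenthal])

text \<open>An arc between two different ends crosses the boundary of a region that separates
  them.\<close>

lemma arc_meets_graph:
  assumes A: "arc_from_to (freudenthal G) a b A" "a \<noteq> b"
  obtains x where "x \<in> A" "x \<in> graph_points G"
proof (cases "a \<in> graph_points G \<or> b \<in> graph_points G")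
  case True
  then show ?thesis using that arc_from_to_ends[OF A(1)] by blast
next
  case False
  have "a \<in> all_points" "b \<in> all_points"
    using arc_from_to_subset[OF A(1)] arc_from_to_ends[OF A(1)] unfolding topspace_freudenthal by blast+
  then have "a \<in> End ` graph_ends G" "b \<in> End ` graph_ends G" using False by simp_all
  then obtain \<omega> \<eta> where \<omega>: "a = End \<omega>" "\<omega> \<in> graph_ends G" and \<eta>: "b = End \<eta>" "\<eta> \<in> graph_ends G"
    by blast
  then obtain D where D: "region D" "in_end \<omega> D \<longleftrightarrow> \<not> in_end \<eta> D"
    using end_distinguish[of \<omega> \<eta>] A(2) by auto
  have *: thesis if A': "arc_from_to (freudenthal G) c d A" and c: "c \<in> closed_nbhd D"
    and d: "d \<notin> closed_nbhd D" for c d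
  proof -
    have "A \<inter> closed_nbhd D \<noteq> {}" using arc_from_to_ends[OF A'] c by auto
    then obtain x B C where x: "arc_from_to (freudenthal G) c x B" "arc_from_to (freudenthal G) x d C"
      "A = B \<union> C" "B \<inter> C = {x}" "C \<inter> closed_nbhd D = {x}"
      by (rule arc_from_to_last_hit[OF A' closedin_closed_nbhd[OF D(1)]])
    have "x \<in> Vertex ` boundary D" by (rule hit_boundary[OF D(1) x(2,5) d])
    then show thesis using x(3,4) boundary_verts[of D] by (intro \<open>\<And>x. x \<in> A \<Longrightarrow> x \<in> graph_points G \<Longrightarrow> thesis\<close>[of x]) auto
  qed
  show thesis
  proof (cases "in_end \<omega> D")
    case True
    then show ?thesis using * [OF A(1)] \<omega> \<eta> D(2) by simp
  next
    case False
    then show ?thesis using * [OF arc_from_to_sym[OF A(1)]] \<omega> \<eta> D(2) by simp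
  qed
qed

lemma arc_two_graph_points:
  assumes A: "arc_from_to (freudenthal G) a b A" "a \<noteq> b"
  obtains x y where "x \<in> A \<inter> graph_points G" "y \<in> A \<inter> graph_points G" "x \<noteq> y"
proof -
  obtain x where x: "x \<in> A" "x \<in> graph_points G" by (rule arc_meets_graph[OF A])
  obtain B C where BC: "arc_from_to (freudenthal G) a x B" "arc_from_to (freudenthal G) x b C"
    "A = B \<union> C" "B \<inter> C = {x}"
    by (rule arc_from_to_split[OF A(1) x(1)])
  show thesis
  proof (cases "x = b")
    case False
    obtain y where "y \<in> C" "y \<in> graph_points G" "y \<noteq> x"
      by (rule arc_from_to_start_neighbour[OF BC(2) False openin_graph_points x(2)])
    then show ?thesis using that[of x y] x BC(3) by auto
  next
    case True
    then have "x \<noteq> a" using A(2) by simp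
    obtain y where "y \<in> B" "y \<in> graph_points G" "y \<noteq> x"
      by (rule arc_from_to_start_neighbour[OF arc_from_to_sym[OF BC(1)] \<open>x \<noteq> a\<close> openin_graph_points x(2)])
    then show ?thesis using that[of x y] x BC(3) by auto
  qed
qed

lemma n_ac_graph_if_pair:
  assumes "n_ac_pair n (topspace (graph_space G)) (freudenthal G)"
  shows "n_ac n (graph_space G)"
  unfolding n_ac_def n_ac_pair_def topspace_graph_space[OF wf_digraph]
proof (intro allI impI)
  fix F assume F: "F \<subseteq> graph_points G \<and> finite F \<and> card F \<le> n"
  then obtain A where A: "arc_in (freudenthal G) A" "F \<subseteq> A"
    using assms[unfolded n_ac_pair_def topspace_graph_space[OF wf_digraph], rule_format, OF F] by blast
  obtain a b where ab: "a \<noteq> b" "arc_from_to (freudenthal G) a b A"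
    by (rule arc_in_imp_arc_from_to[OF A(1)])
  obtain x y where xy: "x \<in> A \<inter> graph_points G" "y \<in> A \<inter> graph_points G" "x \<noteq> y"
    by (rule arc_two_graph_points[OF ab(2,1)])
  \<comment> \<open>The two extra points keep the trimmed arc nondegenerate when \<open>F\<close>
    has fewer than two elements.\<close>
  define T where "T = insert x (insert y F)"
  have T: "finite T" "T \<noteq> {}" "T \<subseteq> A" "T \<subseteq> graph_points G" using F A(2) xy by (auto simp: T_def)
  obtain p q B where B: "arc_from_to (freudenthal G) p q B" "p \<in> T" "q \<in> T" "T \<subseteq> B" "B \<subseteq> A"
    by (rule arc_from_to_finite_hull[OF Hausdorff_freudenthal ab(2) T(1-3)])
  have "p \<in> graph_points G" "q \<in> graph_points G" using B T(4) by auto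
  then obtain A' where A': "arc_from_to (freudenthal G) p q A'" "A' \<subseteq> graph_points G" "T \<subseteq> A'"
    using arc_into_graph_through[OF T(1) _ _ closedin_empty B(1)] B(4) T(4) by auto
  have "p \<noteq> q"
  proof
    assume "p = q"
    then have "A' = {p}" using arc_from_to_degenerate A'(1) by metis
    then show False using A'(3) xy(3) by (auto simp: T_def)
  qed
  moreover have "arc_from_to (graph_space G) p q A'"
    unfolding graph_space_eq_subtopology arc_from_to_subtopology using A' by simp
  ultimately have "arc_in (graph_space G) A'"
    by (intro arc_from_to_imp_arc_in[OF Hausdorff_graph_space])
  then show "\<exists>A. arc_in (graph_space G) A \<and> F \<subseteq> A" using A'(3) by (auto simp: T_def)
qed

end


section \<open>Infinite concatenations and a pigeonhole principle\<close>

text \<open>The \<open>i\<close>-th arc is parametrised over the interval from \<open>i\<close> to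
  \<open>i + 1\<close>, and \<open>u / (1 - u)\<close> carries the unit interval without 1 onto the
  half-line. Continuity at 1 comes from \<open>lim\<close>.\<close>

lemma arc_from_to_infinite_join:
  fixes x :: "nat \<Rightarrow> 'a"
  assumes A: "\<And>i. arc_from_to X (x i) (x (Suc i)) (A i)" "\<And>i. x i \<noteq> x (Suc i)"
    and adjacent: "\<And>i. A i \<inter> A (Suc i) \<subseteq> {x (Suc i)}"
    and far: "\<And>i j. Suc i < j \<Longrightarrow> A i \<inter> A j = {}"
    and z: "z \<in> topspace X" "\<And>i. z \<notin> A i"
    and lim: "\<And>W. \<lbrakk>openin X W; z \<in> W\<rbrakk> \<Longrightarrow> \<exists>m. \<forall>i\<ge>m. A i \<subseteq> W"
  shows "arc_from_to X (x 0) z (insert z (\<Union>i. A i))"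
proof -
  have "\<exists>f. continuous_map (top_of_set {0..1::real}) X f \<and> inj_on f {0..1} \<and>
      f 0 = x i \<and> f 1 = x (Suc i) \<and> A i = f ` {0..1}" for i
    by (rule arc_from_to_unit[OF A(1)[of i] A(2)[of i]]) (intro exI conjI)
  then obtain f where f: "\<And>i. continuous_map (top_of_set {0..1::real}) X (f i)" "\<And>i. inj_on (f i) {0..1}"
    "\<And>i. f i 0 = x i" "\<And>i. f i 1 = x (Suc i)" "\<And>i. A i = f i ` {0..1}" by metis
  define H where "H y = f (nat \<lfloor>y\<rfloor>) (y - of_int \<lfloor>y\<rfloor>)" for y
  \<comment> \<open>At an integer the floor already selects the next arc; the values agree because
    consecutive arcs share a point.\<close>
  have H: "H y = f n (y - real n)" if "real n \<le> y" "y \<le> real n + 1" for n y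
  proof (cases "y = real n + 1")
    case True
    then have fl: "\<lfloor>y\<rfloor> = int (Suc n)" by (simp add: floor_eq_iff)
    have "nat \<lfloor>y\<rfloor> = Suc n" unfolding fl by (rule nat_int)
    moreover have "y - of_int \<lfloor>y\<rfloor> = 0" unfolding fl using True by simp
    ultimately have "H y = f (Suc n) 0" unfolding H_def by simp
    then show ?thesis using True f(3,4) by simp
  next
    case False
    then have "\<lfloor>y\<rfloor> = int n" using that by (simp add: floor_eq_iff)
    then show ?thesis by (simp add: H_def)
  qed
  have idx: "\<exists>n. real n \<le> y \<and> y < real n + 1 \<and> H y = f n (y - real n) \<and> H y \<in> A n" if y: "0 \<le> y" for y
  proof -
    have "real (nat \<lfloor>y\<rfloor>) \<le> y \<and> y < real (nat \<lfloor>y\<rfloor>) + 1" using y by linarith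
    then obtain n where 1: "real n \<le> y" "y < real n + 1" by blast
    have 2: "H y = f n (y - real n)" by (rule H[OF 1(1) less_imp_le[OF 1(2)]])
    have "f n (y - real n) \<in> A n" unfolding f(5) using 1 by (intro imageI) simp
    then show ?thesis using 1 2 by (intro exI[of _ n]) simp
  qed
  have At: "A i \<subseteq> topspace X" for i by (rule arc_from_to_subset[OF A(1)])
  have Ht: "H y \<in> topspace X" if "0 \<le> y" for y
    using idx[OF that] At by blast
  have Hc: "continuous_map (top_of_set {0..real n}) X H" for n
  proof (induction n)
    case 0
    have "H 0 \<in> topspace X" by (rule Ht) simp
    then have "continuous_map (top_of_set {0..real 0}) X (\<lambda>_. H 0)" by simp
    then show ?case by (rule continuous_map_eq) simp
  next
    case (Suc n)
    let ?I = "top_of_set {0..real (Suc n)}"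
    have s: "{y \<in> topspace ?I. y \<le> real n} = {0..real n}" "{y \<in> topspace ?I. real n \<le> y} = {real n..real n + 1}"
      by auto
    have s2: "{0..real (Suc n)} \<inter> {0..real n} = {0..real n}"
      "{0..real (Suc n)} \<inter> {real n..real n + 1} = {real n..real n + 1}" by auto
    have "continuous_map ?I X (\<lambda>y. if y \<le> real n then H y else f n (1 * y + - real n))"
    proof (rule continuous_map_cases_le)
      show "continuous_map (subtopology ?I {y \<in> topspace ?I. y \<le> real n}) X H"
        unfolding s subtopology_subtopology s2 by (rule Suc.IH)
      show "continuous_map (subtopology ?I {y \<in> topspace ?I. real n \<le> y}) X (\<lambda>y. f n (1 * y + - real n))"
        unfolding s subtopology_subtopology s2 by (rule continuous_map_affine[OF f(1)]) auto
      show "H y = f n (1 * y + - real n)" if "y \<in> topspace ?I" "y = real n" for y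
        using H[of n y] that by simp
    qed auto
    then show ?case by (rule continuous_map_eq) (use H[of n] in auto)
  qed
  define F where "F u = (if u < 1 then H (u / (1 - u)) else z)" for u :: real
  have Fc: "continuous_map (top_of_set {0..c}) X F" if c: "c < 1" for c
  proof -
    obtain N where N: "c / (1 - c) \<le> real N" using real_arch_simple by blast
    have "continuous_map (top_of_set {0..c}) (top_of_set {0..real N}) (\<lambda>u. u / (1 - u))"
    proof -
      have "u / (1 - u) \<in> {0..real N}" if "u \<in> {0..c}" for u
      proof -
        have "u / (1 - u) \<le> c / (1 - c)" using that c by (intro frac_le) auto
        then show ?thesis using that c N by auto
      qed
      moreover have "continuous_on {0..c} (\<lambda>u. u / (1 - u))" using c by (intro continuous_intros) auto
      ultimately show ?thesis by auto
    qed
    from continuous_map_compose[OF this Hc] have "continuous_map (top_of_set {0..c}) X (\<lambda>u. H (u / (1 - u)))"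
      by (simp add: o_def)
    then show ?thesis by (rule continuous_map_eq) (use c in \<open>auto simp: F_def\<close>)
  qed
  have cont: "continuous_map (top_of_set {0..1}) X F"
    unfolding continuous_map
  proof (intro conjI allI impI)
    have "F u \<in> topspace X" if "u \<in> {0..1}" for u
      using that Ht[of "u / (1 - u)"] z(1) by (auto simp: F_def)
    then show "F ` topspace (top_of_set {0..1}) \<subseteq> topspace X" by auto
    fix W assume W: "openin X W"
    let ?P = "{u \<in> topspace (top_of_set {0..1}). F u \<in> W}"
    show "openin (top_of_set {0..1}) ?P"
    proof (subst openin_subopen, intro ballI)
      fix u assume u: "u \<in> ?P"
      show "\<exists>T. openin (top_of_set {0..1}) T \<and> u \<in> T \<and> T \<subseteq> ?P"
      proof (cases "u < 1")
        case True
        define c where "c = (u + 1) / 2"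
        have c: "u < c" "c < 1" using True by (auto simp: c_def)
        have "openin (top_of_set {0..c}) {t \<in> {0..c}. F t \<in> W}"
          using openin_continuous_map_preimage[OF Fc[OF c(2)] W] by simp
        then obtain O' where O': "open O'" "{t \<in> {0..c}. F t \<in> W} = {0..c} \<inter> O'"
          unfolding openin_open by auto
        have "openin (top_of_set {0..1}) ({0..1} \<inter> (O' \<inter> {..<c}))"
          using O'(1) by (intro openin_open_Int open_Int) auto
        moreover have "u \<in> {0..1} \<inter> (O' \<inter> {..<c})"
        proof -
          have "u \<in> {t \<in> {0..c}. F t \<in> W}" using u c(1) by simp
          then show ?thesis unfolding O'(2) using u c(1) by simp
        qed
        moreover have "{0..1} \<inter> (O' \<inter> {..<c}) \<subseteq> ?P"
        proof -
          have "{0..1} \<inter> (O' \<inter> {..<c}) \<subseteq> {t \<in> {0..c}. F t \<in> W}" unfolding O'(2) by auto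
          also have "\<dots> \<subseteq> ?P" using c(2) by auto
          finally show ?thesis .
        qed
        ultimately show ?thesis by (intro exI conjI)
      next
        case False
        then have "z \<in> W" using u by (auto simp: F_def)
        then obtain m where m: "\<forall>i\<ge>m. A i \<subseteq> W" using lim[OF W] by blast
        \<comment> \<open>The parameter with \<open>c / (1 - c) = real m\<close>: beyond it only the
          arcs \<open>A i\<close> with \<open>i \<ge> m\<close> and the limit \<open>z\<close>
          occur.\<close>
        define c where "c = real m / (real m + 1)"
        have c: "c < 1" by (simp add: c_def)
        have "openin (top_of_set {0..1}) ({0..1} \<inter> {c<..})" by (intro openin_open_Int) simp
        moreover have "u \<in> {0..1} \<inter> {c<..}" using u False c by auto
        moreover have "F t \<in> W" if t: "t \<in> {0..1} \<inter> {c<..}" for t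
        proof (cases "t < 1")
          case True
          then have le: "real m \<le> t / (1 - t)" using t by (auto simp: c_def field_simps)
          have "0 \<le> t / (1 - t)" using t True by simp
          then obtain n where n: "t / (1 - t) < real n + 1" "H (t / (1 - t)) \<in> A n"
            using idx by blast
          have "m \<le> n" using le n(1) by linarith
          then have "H (t / (1 - t)) \<in> W" using m n(2) by blast
          then show ?thesis using True by (simp add: F_def)
        qed (use \<open>z \<in> W\<close> in \<open>simp add: F_def\<close>)
        ultimately show ?thesis by (intro exI[of _ "{0..1} \<inter> {c<..}"]) auto
      qed
    qed
  qed
  have H_inj: "H y \<noteq> H y'" if yy: "0 \<le> y" "y < y'" for y y'
  proof
    assume eq: "H y = H y'"
    obtain i where i: "real i \<le> y" "y < real i + 1" "H y = f i (y - real i)" "H y \<in> A i"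
      using idx[OF yy(1)] by blast
    obtain j where j: "real j \<le> y'" "y' < real j + 1" "H y' = f j (y' - real j)" "H y' \<in> A j"
      using idx[of y'] yy by auto
    have "i \<le> j" using i j yy by linarith
    then consider "i = j" | "j = Suc i" | "Suc i < j" by linarith
    then show False
    proof cases
      case 1
      have "f i (y - real i) = f i (y' - real i)" using eq i(3) j(3) 1 by simp
      from inj_onD[OF f(2) this] show False using i j 1 yy by auto
    next
      case 2
      then have "H y = x (Suc i)" using adjacent[of i] i(4) j(4) eq by auto
      then have "f i (y - real i) = f i 1" using i(3) f(4) by simp
      from inj_onD[OF f(2) this] show False using i by auto
    next
      case 3
      then show False using far[OF 3] i(4) j(4) eq by auto
    qed
  qed
  have inj: "inj_on F {0..1}"
  proof (rule linorder_inj_onI)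
    fix u u' assume u: "u < u'" "u \<in> {0..1::real}" "u' \<in> {0..1}"
    have Fu: "F u = H (u / (1 - u))" "0 \<le> u / (1 - u)" using u by (auto simp: F_def)
    show "F u \<noteq> F u'"
    proof (cases "u' < 1")
      case True
      have "u / (1 - u) < u' / (1 - u')" using u True by (simp add: field_simps)
      then show ?thesis using H_inj Fu True by (simp add: F_def)
    next
      case False
      then have "F u' = z" by (simp add: F_def)
      then show ?thesis using idx[OF Fu(2)] Fu(1) z(2) by metis
    qed
  qed auto
  have "F ` {0..1} = insert z (\<Union>i. A i)"
  proof (intro equalityI subsetI)
    fix w assume "w \<in> F ` {0..1}"
    then obtain u where u: "u \<in> {0..1}" "w = F u" by blast
    then show "w \<in> insert z (\<Union>i. A i)"
      using idx[of "u / (1 - u)"] by (cases "u < 1") (auto simp: F_def)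
  next
    fix w assume "w \<in> insert z (\<Union>i. A i)"
    then consider "w = z" | i where "w \<in> A i" by blast
    then show "w \<in> F ` {0..1}"
    proof cases
      case 1
      then have "w = F 1" by (simp add: F_def)
      then show ?thesis by simp
    next
      case 2
      then obtain s where s: "s \<in> {0..1}" "w = f i s" using f(5) by auto
      define u where "u = (real i + s) / (1 + (real i + s))"
      have u: "u \<in> {0..1}" "u < 1" "u / (1 - u) = real i + s"
        using s(1) by (auto simp: u_def field_simps)
      have "H (real i + s) = w" using H[of i "real i + s"] s by simp
      then have "w = F u" using u by (simp add: F_def)
      then show ?thesis using u(1) by simp
    qed
  qed
  moreover have "F 0 = x 0" using H[of 0 0] f(3) by (simp add: F_def)
  moreover have "F 1 = z" by (simp add: F_def)
  ultimately show ?thesis using arc_from_toI[OF cont inj] by simp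
qed

text \<open>Going left inside \<open>T\<close>, the infimum is attained because \<open>T\<close> is
  closed, and by \<open>op\<close> the walk can stop only at 0 or in \<open>S\<close>.\<close>

lemma interval_left_end:
  fixes T :: "real set"
  assumes T: "closed T" "T \<subseteq> {0..1}" "u \<in> T"
    and op: "\<And>u. u \<in> T \<Longrightarrow> u \<notin> S \<Longrightarrow> \<exists>e>0. {u - e<..<u + e} \<inter> {0..1} \<subseteq> T"
  obtains a where "a \<le> u" "{a..u} \<subseteq> T" "a = 0 \<or> a \<in> S"
proof -
  define L where "L = {a. a \<le> u \<and> {a..u} \<subseteq> T}"
  have uL: "u \<in> L" using T(3) by (simp add: L_def)
  have bd: "0 \<le> a" if "a \<in> L" for a
  proof -
    have "a \<in> T" using that by (auto simp: L_def)
    then show ?thesis using T(2) by auto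
  qed
  have bdd: "bdd_below L" by (rule bdd_belowI) (rule bd)
  define \<alpha> where "\<alpha> = Inf L"
  have le: "\<alpha> \<le> u" unfolding \<alpha>_def by (rule cInf_lower[OF uL bdd])
  have gt: "w \<in> T" if w: "\<alpha> < w" "w \<le> u" for w
  proof -
    obtain a where "a \<in> L" "a < w"
      using cInf_lessD[of L w] uL w(1) by (auto simp: \<alpha>_def)
    then show ?thesis using w(2) by (auto simp: L_def)
  qed
  have \<alpha>T: "\<alpha> \<in> T"
  proof (cases "\<alpha> = u")
    case False
    then have "\<alpha> < u" using le by simp
    then have "\<alpha> \<in> closure {\<alpha><..u}" by simp
    moreover have "closure {\<alpha><..u} \<subseteq> T" by (rule closure_minimal[OF _ T(1)]) (use gt in auto)
    ultimately show ?thesis by blast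
  qed (use T(3) in simp)
  have sub: "{\<alpha>..u} \<subseteq> T"
  proof
    fix w assume "w \<in> {\<alpha>..u}"
    then show "w \<in> T" using gt[of w] \<alpha>T by (cases "w = \<alpha>") auto
  qed
  have "\<alpha> = 0 \<or> \<alpha> \<in> S"
  proof (rule ccontr)
    assume n: "\<not> (\<alpha> = 0 \<or> \<alpha> \<in> S)"
    then obtain e where e: "e > 0" "{\<alpha> - e<..<\<alpha> + e} \<inter> {0..1} \<subseteq> T" using op[OF \<alpha>T] by auto
    have \<alpha>: "0 < \<alpha>" "\<alpha> \<le> 1" using n \<alpha>T T(2) by force+
    define b where "b = max 0 (\<alpha> - e / 2)"
    have b: "b < \<alpha>" using e \<alpha> by (auto simp: b_def)
    have "w \<in> T" if "w \<in> {b..u}" for w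
    proof (cases "w < \<alpha>")
      case True
      then have "w \<in> {\<alpha> - e<..<\<alpha> + e} \<inter> {0..1}" using that e(1) \<alpha> by (auto simp: b_def)
      then show ?thesis using e(2) by blast
    next
      case False
      then show ?thesis using that sub by auto
    qed
    then have "b \<in> L" using b le by (auto simp: L_def)
    then have "\<alpha> \<le> b" unfolding \<alpha>_def by (rule cInf_lower[OF _ bdd])
    then show False using b by simp
  qed
  then show thesis using that le sub by blast
qed

lemma interval_right_end:
  fixes T :: "real set"
  assumes T: "closed T" "T \<subseteq> {0..1}" "u \<in> T"
    and op: "\<And>u. u \<in> T \<Longrightarrow> u \<notin> S \<Longrightarrow> \<exists>e>0. {u - e<..<u + e} \<inter> {0..1} \<subseteq> T"
  obtains b where "u \<le> b" "{u..b} \<subseteq> T" "b = 1 \<or> b \<in> S"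
proof -
  let ?m = "\<lambda>x::real. 1 - x"
  have im: "x \<in> ?m ` B \<longleftrightarrow> 1 - x \<in> B" for x and B :: "real set"
    by (auto intro: image_eqI[of _ _ "1 - x"])
  have "closed (?m ` T)"
  proof -
    have "?m ` T = (\<lambda>x. 1 + - x) ` T" by simp
    also have "\<dots> = (+) 1 ` (uminus ` T)" by (simp add: image_image)
    finally show ?thesis using T(1) by (simp add: closed_negations closed_translation)
  qed
  moreover have "?m ` T \<subseteq> {0..1}" "1 - u \<in> ?m ` T" using T(2,3) by auto
  moreover have "\<exists>e>0. {w - e<..<w + e} \<inter> {0..1} \<subseteq> ?m ` T" if w: "w \<in> ?m ` T" "w \<notin> ?m ` S" for w
  proof -
    obtain e where e: "e > 0" "{1 - w - e<..<1 - w + e} \<inter> {0..1} \<subseteq> T"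
      using op[of "1 - w"] w unfolding im by auto
    have "y \<in> ?m ` T" if "y \<in> {w - e<..<w + e} \<inter> {0..1}" for y
      unfolding im using that by (intro subsetD[OF e(2)]) auto
    then show ?thesis using e(1) by blast
  qed
  ultimately obtain a where a: "a \<le> 1 - u" "{a..1 - u} \<subseteq> ?m ` T" "a = 0 \<or> a \<in> ?m ` S"
    by (rule interval_left_end)
  show thesis
  proof (rule that[of "1 - a"])
    show "{u..1 - a} \<subseteq> T"
    proof
      fix y assume "y \<in> {u..1 - a}"
      then have "1 - y \<in> ?m ` T" by (intro subsetD[OF a(2)]) auto
      then show "y \<in> T" unfolding im by simp
    qed
    show "1 - a = 1 \<or> 1 - a \<in> S" using a(3) unfolding im by auto
  qed (use a(1) in simp)
qed

text \<open>
  The components of \<open>T\<close> are intervals whose end points are \<open>0\<close>, \<open>1\<close> or boundary points \<open>t b\<close>.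
  A component containing neither \<open>0\<close> nor \<open>1\<close>, other than a single point, uses up two of the
  boundary points, so there are too few components to separate all the \<open>\<tau> b\<close>.
\<close>

lemma interval_pigeonhole:
  fixes T :: "real set" and t \<tau> :: "'b \<Rightarrow> real"
  assumes T: "closed T" "T \<subseteq> {0..1}" "T \<noteq> {0..1}" and Q: "finite Q" "\<And>b. b \<in> Q \<Longrightarrow> \<tau> b \<in> T"
    and op: "\<And>u. u \<in> T \<Longrightarrow> u \<notin> t ` Q \<Longrightarrow> \<exists>e>0. {u - e<..<u + e} \<inter> {0..1} \<subseteq> T"
    and s: "s \<in> T" "s \<notin> t ` Q"
  shows "(\<exists>b\<in>Q. \<exists>c\<in>Q. b \<noteq> c \<and> \<tau> b \<le> \<tau> c \<and> {\<tau> b..\<tau> c} \<subseteq> T) \<or>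
         (\<exists>b\<in>Q. {0..\<tau> b} \<subseteq> T \<or> {\<tau> b..1} \<subseteq> T)"
proof -
  \<comment> \<open>Both points lie in one component of \<open>T\<close>. For distinct points one of
    the two intervals is empty, so their order need not be known.\<close>
  define same where "same u v \<longleftrightarrow> {u..v} \<subseteq> T \<and> {v..u} \<subseteq> T" for u v
  have same_le: "same u v" if "u \<le> v" "{u..v} \<subseteq> T" for u v
  proof -
    have "{v..u} \<subseteq> {u..v}" using that(1) by auto
    then show ?thesis using that(2) unfolding same_def by blast
  qed
  have same_sym: "same u v \<Longrightarrow> same v u" for u v by (auto simp: same_def)
  have same_trans: "same u v \<Longrightarrow> same v w \<Longrightarrow> same u w" for u v w
    unfolding same_def subset_iff atLeastAtMost_iff by (meson linear)
  have finish: ?thesis if "b \<in> Q" "c \<in> Q" "b \<noteq> c" "same (\<tau> b) (\<tau> c)" for b c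
  proof (cases "\<tau> b \<le> \<tau> c")
    case True
    then show ?thesis using that unfolding same_def by blast
  next
    case False
    then have "\<tau> c \<le> \<tau> b" by simp
    moreover have "c \<noteq> b" "{\<tau> c..\<tau> b} \<subseteq> T" using that by (auto simp: same_def)
    ultimately show ?thesis using that(1,2) by blast
  qed
  have ends: "\<exists>\<alpha> \<beta>. \<alpha> \<le> u \<and> {\<alpha>..u} \<subseteq> T \<and> (\<alpha> = 0 \<or> \<alpha> \<in> t ` Q) \<and> u \<le> \<beta> \<and> {u..\<beta>} \<subseteq> T \<and>
      (\<beta> = 1 \<or> \<beta> \<in> t ` Q) \<and> (\<alpha> \<noteq> 0 \<or> \<beta> \<noteq> 1)" if u: "u \<in> T" for u
  proof -
    obtain \<alpha> where \<alpha>: "\<alpha> \<le> u" "{\<alpha>..u} \<subseteq> T" "\<alpha> = 0 \<or> \<alpha> \<in> t ` Q"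
      by (rule interval_left_end[OF T(1,2) u op])
    obtain \<beta> where \<beta>: "u \<le> \<beta>" "{u..\<beta>} \<subseteq> T" "\<beta> = 1 \<or> \<beta> \<in> t ` Q"
      by (rule interval_right_end[OF T(1,2) u op])
    \<comment> \<open>\<open>T\<close> is not the whole interval, so at least one end of every
      component is a boundary point.\<close>
    have "\<alpha> \<noteq> 0 \<or> \<beta> \<noteq> 1"
    proof (rule ccontr)
      assume "\<not> (\<alpha> \<noteq> 0 \<or> \<beta> \<noteq> 1)"
      then have "{0..1} \<subseteq> {\<alpha>..u} \<union> {u..\<beta>}" by auto
      then show False using T(2,3) \<alpha>(2) \<beta>(2) by blast
    qed
    then show ?thesis using \<alpha> \<beta> by blast
  qed
  have "\<exists>b'\<in>Q. same (\<tau> b) (t b')" if b: "b \<in> Q" for b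
  proof -
    obtain \<alpha> \<beta> where "\<alpha> \<le> \<tau> b" "{\<alpha>..\<tau> b} \<subseteq> T" "\<alpha> = 0 \<or> \<alpha> \<in> t ` Q" "\<tau> b \<le> \<beta>"
      "{\<tau> b..\<beta>} \<subseteq> T" "\<beta> = 1 \<or> \<beta> \<in> t ` Q" "\<alpha> \<noteq> 0 \<or> \<beta> \<noteq> 1"
      using ends[OF Q(2)[OF b]] by blast
    moreover from this have "same (\<tau> b) \<alpha>" "same (\<tau> b) \<beta>"
      using same_le same_sym by simp_all
    ultimately have "same (\<tau> b) \<alpha> \<and> \<alpha> \<in> t ` Q \<or> same (\<tau> b) \<beta> \<and> \<beta> \<in> t ` Q" by blast
    then show ?thesis by blast
  qed
  then obtain g where g: "\<And>b. b \<in> Q \<Longrightarrow> g b \<in> Q \<and> same (\<tau> b) (t (g b))" by metis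
  show ?thesis
  \<comment> \<open>If \<open>g\<close> identifies two indices, their points \<tau> share a
    component. Otherwise \<open>g\<close> permutes \<open>Q\<close>, so every boundary point shares
    its component with a point \<tau> of its own, and the component of \<open>s\<close> is
    examined.\<close>
  proof (cases "inj_on g Q")
    case False
    then obtain b c where bc: "b \<in> Q" "c \<in> Q" "b \<noteq> c" "g b = g c" by (auto simp: inj_on_def)
    then have "same (\<tau> b) (\<tau> c)" using g[of b] g[of c] same_sym same_trans by metis
    then show ?thesis using finish bc by blast
  next
    case True
    then have surj: "g ` Q = Q" using Q(1) g by (intro endo_inj_surj) auto
    obtain \<alpha> \<beta> where \<alpha>\<beta>: "\<alpha> \<le> s" "{\<alpha>..s} \<subseteq> T" "\<alpha> = 0 \<or> \<alpha> \<in> t ` Q" "s \<le> \<beta>"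
      "{s..\<beta>} \<subseteq> T" "\<beta> = 1 \<or> \<beta> \<in> t ` Q" "\<alpha> \<noteq> 0 \<or> \<beta> \<noteq> 1"
      using ends[OF s(1)] by blast
    have seg: "{\<alpha>..\<beta>} \<subseteq> T"
    proof
      fix y assume "y \<in> {\<alpha>..\<beta>}"
      then show "y \<in> T" using \<alpha>\<beta>(2,5) by (cases "y \<le> s") auto
    qed
    have hit: "\<exists>b\<in>Q. same (\<tau> b) (t b') \<and> g b = b'" if b': "b' \<in> Q" for b'
    proof -
      have "b' \<in> g ` Q" using b' surj by simp
      then obtain b where "b \<in> Q" "b' = g b" by blast
      then show ?thesis using g by blast
    qed
    consider "\<alpha> \<in> t ` Q" "\<beta> \<in> t ` Q" | "\<alpha> = 0" "\<beta> \<in> t ` Q" | "\<alpha> \<in> t ` Q" "\<beta> = 1"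
      using \<alpha>\<beta>(3,6,7) by blast
    then show ?thesis
    proof cases
      case 1
      then obtain a' b' where a'b': "a' \<in> Q" "\<alpha> = t a'" "b' \<in> Q" "\<beta> = t b'" by blast
      obtain b where b: "b \<in> Q" "same (\<tau> b) \<alpha>" "g b = a'" using hit[OF a'b'(1)] a'b'(2) by blast
      obtain c where c: "c \<in> Q" "same (\<tau> c) \<beta>" "g c = b'" using hit[OF a'b'(3)] a'b'(4) by blast
      \<comment> \<open>If both ends were the same boundary point, \<open>s\<close> would equal it,
        against the choice of \<open>s\<close>.\<close>
      have "b \<noteq> c"
      proof
        assume "b = c"
        then have "\<alpha> = \<beta>" using b c a'b' by simp
        then have "s = \<alpha>" using \<alpha>\<beta>(1,4) by simp
        then show False using s(2) 1(1) by simp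
      qed
      moreover have "same \<alpha> \<beta>" using seg \<alpha>\<beta>(1,4) by (intro same_le) simp_all
      then have "same (\<tau> b) (\<tau> c)" using b(2) c(2) same_sym same_trans by metis
      ultimately show ?thesis using finish b c by blast
    next
      case 2
      then obtain b' where b': "b' \<in> Q" "\<beta> = t b'" by blast
      obtain b where b: "b \<in> Q" "same (\<tau> b) \<beta>" using hit[OF b'(1)] b'(2) by blast
      have "{0..\<tau> b} \<subseteq> {\<alpha>..\<beta>} \<union> {\<beta>..\<tau> b}" using 2(1) by auto
      then have "{0..\<tau> b} \<subseteq> T" using seg b(2) unfolding same_def by blast
      then show ?thesis using b(1) by blast
    next
      case 3
      then obtain b' where b': "b' \<in> Q" "\<alpha> = t b'" by blast
      obtain b where b: "b \<in> Q" "same (\<tau> b) \<alpha>" using hit[OF b'(1)] b'(2) by blast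
      have "{\<tau> b..1} \<subseteq> {\<tau> b..\<alpha>} \<union> {\<alpha>..\<beta>}" using 3(2) by auto
      then have "{\<tau> b..1} \<subseteq> T" using seg b(2) unfolding same_def by blast
      then show ?thesis using b(1) by blast
    qed
  qed
qed


section \<open>Rerouting an arc through an end\<close>

context lf_graph
begin

text \<open>The edges of the ray converge to \<omega>, since every region of \<omega> contains a
  tail of the ray.\<close>

lemma ray_arc:
  assumes "\<omega> \<in> graph_ends G" "r \<in> \<omega>"
  obtains A where "arc_from_to (freudenthal G) (Vertex (r 0)) (End \<omega>) A"
    "A \<subseteq> insert (End \<omega>) (span (range r))"
proof -
  have ray: "inj r" "\<And>i. adj (r i) (r (Suc i))" using end_rays[OF assms] by (auto simp: ray_iff)
  have ne: "r i \<noteq> r (Suc i)" for i using ray(1) by (simp add: inj_eq)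
  have "\<exists>A. arc_from_to (freudenthal G) (Vertex (r i)) (Vertex (r (Suc i))) A \<and> A \<subseteq> span {r i, r (Suc i)}" for i
    by (rule edge_arc[OF ray(2) ne]) blast
  then obtain A where A: "\<And>i. arc_from_to (freudenthal G) (Vertex (r i)) (Vertex (r (Suc i))) (A i)"
    "\<And>i. A i \<subseteq> span {r i, r (Suc i)}" by metis
  have "arc_from_to (freudenthal G) (Vertex (r 0)) (End \<omega>) (insert (End \<omega>) (\<Union>i. A i))"
  proof (rule arc_from_to_infinite_join[where x = "\<lambda>i. Vertex (r i)"])
    show "arc_from_to (freudenthal G) (Vertex (r i)) (Vertex (r (Suc i))) (A i)" for i by (rule A(1))
    show "Vertex (r i) \<noteq> Vertex (r (Suc i))" for i using ne by simp
    have Int: "A i \<inter> A j \<subseteq> span ({r i, r (Suc i)} \<inter> {r j, r (Suc j)})" for i j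
      using A(2)[of i] A(2)[of j] unfolding span_Int[symmetric] by blast
    show "A i \<inter> A (Suc i) \<subseteq> {Vertex (r (Suc i))}" for i
    proof -
      have eq: "{r i, r (Suc i)} \<inter> {r (Suc i), r (Suc (Suc i))} = {r (Suc i)}"
        using ray(1) by (auto simp: inj_eq)
      show ?thesis using Int[of i "Suc i"] unfolding eq span_singleton .
    qed
    show "A i \<inter> A j = {}" if "Suc i < j" for i j
    proof -
      have eq: "{r i, r (Suc i)} \<inter> {r j, r (Suc j)} = {}" using ray(1) that by (auto simp: inj_eq)
      show ?thesis using Int[of i j] unfolding eq span_empty by simp
    qed
    show "End \<omega> \<in> topspace (freudenthal G)" using assms(1) by (simp add: topspace_freudenthal)
    show "End \<omega> \<notin> A i" for i using A(2)[of i] by auto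
    show "\<exists>m. \<forall>i\<ge>m. A i \<subseteq> W" if W: "openin (freudenthal G) W" "End \<omega> \<in> W" for W
    proof -
      obtain D where D: "end_region \<omega> D" "nbhd D \<subseteq> W" by (rule end_region_in_open[OF assms(1) W])
      then obtain m where m: "\<forall>i\<ge>m. r i \<in> D"
        using in_end_iff[OF assms] by (auto simp: end_region_def tail_in_def)
      have "A i \<subseteq> W" if "m \<le> i" for i
      proof -
        have "r i \<in> D" "r (Suc i) \<in> D" using m that by simp_all
        then have "span {r i, r (Suc i)} \<subseteq> nbhd D" by (auto simp: span_def)
        then show ?thesis using A(2) D(2) by blast
      qed
      then show ?thesis by blast
    qed
  qed
  moreover have "A i \<subseteq> span (range r)" for i
  proof -
    have "span {r i, r (Suc i)} \<subseteq> span (range r)" by (rule span_mono) auto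
    then show ?thesis using A(2) by blast
  qed
  then have "insert (End \<omega>) (\<Union>i. A i) \<subseteq> insert (End \<omega>) (span (range r))" by blast
  ultimately show thesis by (rule that)
qed

text \<open>
  An arc \<open>f\<close> reaching far towards \<open>\<omega>\<close> is rerouted through \<open>\<omega>\<close>.  Disjoint rays start at all
  boundary vertices of a region around \<open>\<omega>\<close>; each one that starts on the arc is followed from its
  last point \<open>f (\<tau> b)\<close> on the arc.  There are too few pieces of the arc inside the region for
  these points to lie on different pieces.
\<close>

lemma reroute_through_end:
  assumes \<omega>: "\<omega> \<in> graph_ends G" and W: "openin (freudenthal G) W" "End \<omega> \<in> W"
  obtains D where "end_region \<omega> D" "closed_nbhd D \<subseteq> W"
    "\<And>v A a. \<lbrakk>v \<in> D; arc_in (freudenthal G) A; Vertex v \<in> A; End \<omega> \<notin> A; a \<in> A; a \<notin> W\<rbrakk>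
       \<Longrightarrow> \<exists>A'. arc_in (freudenthal G) A' \<and> End \<omega> \<in> A' \<and> A - W \<subseteq> A' \<and>
             A' - graph_points G \<subseteq> insert (End \<omega>) A"
proof -
  note H = Hausdorff_freudenthal
  obtain D0 where D0: "end_region \<omega> D0" "nbhd D0 \<subseteq> W" by (rule end_region_in_open[OF \<omega> W])
  obtain D r where D: "end_region \<omega> D" "clos D \<subseteq> D0"
    and r: "\<And>b. b \<in> boundary D \<Longrightarrow> r b \<in> \<omega> \<and> r b 0 = b \<and> (\<forall>i>0. r b i \<in> D)"
    and disj: "\<And>b c i j. \<lbrakk>b \<in> boundary D; c \<in> boundary D; r b i = r c j\<rbrakk> \<Longrightarrow> b = c"
    using end_linkage[OF \<omega> D0(1)] by blast
  have reg: "region D" using D(1) by (simp add: end_region_def)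
  have DW: "closed_nbhd D \<subseteq> W" using closed_nbhd_subset_nbhd[OF D(2)] D0(2) by blast
  have clD: "closedin (freudenthal G) (closed_nbhd D)" by (rule closedin_closed_nbhd[OF reg])
  have "\<exists>R. arc_from_to (freudenthal G) (Vertex b) (End \<omega>) R \<and> R \<subseteq> insert (End \<omega>) (span (range (r b)))"
    if "b \<in> boundary D" for b
  proof -
    have rb: "r b \<in> \<omega>" "r b 0 = b" using r[OF that] by auto
    obtain R where "arc_from_to (freudenthal G) (Vertex (r b 0)) (End \<omega>) R"
      "R \<subseteq> insert (End \<omega>) (span (range (r b)))" by (rule ray_arc[OF \<omega> rb(1)])
    then show ?thesis using rb(2) by auto
  qed
  then obtain R where R: "\<And>b. b \<in> boundary D \<Longrightarrow> arc_from_to (freudenthal G) (Vertex b) (End \<omega>) (R b)"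
    "\<And>b. b \<in> boundary D \<Longrightarrow> R b \<subseteq> insert (End \<omega>) (span (range (r b)))" by metis
  have R_disj: "R b \<inter> R c \<subseteq> {End \<omega>}" if "b \<in> boundary D" "c \<in> boundary D" "b \<noteq> c" for b c
  proof -
    have "range (r b) \<inter> range (r c) = {}" using disj[OF that(1,2)] that(3) by auto
    then have *: "span (range (r b)) \<inter> span (range (r c)) = {}" by (simp only: span_Int span_empty)
    have "R b \<inter> R c \<subseteq> insert (End \<omega>) (span (range (r b))) \<inter> insert (End \<omega>) (span (range (r c)))"
      by (rule Int_mono[OF R(2)[OF that(1)] R(2)[OF that(2)]])
    also have "\<dots> = insert (End \<omega>) (span (range (r b)) \<inter> span (range (r c)))" by (rule insert_inter_insert)
    finally show ?thesis unfolding * .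
  qed
  have range_r: "range (r b) \<subseteq> insert b D" if "b \<in> boundary D" for b
  proof
    fix w assume "w \<in> range (r b)"
    then obtain i where "w = r b i" by blast
    then show "w \<in> insert b D" using r[OF that] by (cases i) auto
  qed
  have R_closed: "R b \<subseteq> closed_nbhd D" if b: "b \<in> boundary D" for b
  proof -
    have "span (insert b D) \<subseteq> closed_nbhd D"
      using b boundary_disjoint[of D] by (auto simp: span_def clos_def)
    moreover have "End \<omega> \<in> closed_nbhd D" using \<omega> D(1) by (simp add: end_region_def)
    ultimately show ?thesis using R(2)[OF b] span_mono[OF range_r[OF b]] by blast
  qed
  have R_graph: "R b - graph_points G \<subseteq> {End \<omega>}" if b: "b \<in> boundary D" for b
  proof -
    have "insert b D \<subseteq> verts G" using b boundary_verts[of D] reg by (auto simp: region_def)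
    then have "span (range (r b)) \<subseteq> graph_points G"
      using range_r[OF b] by (intro span_subset_graph) blast
    then show ?thesis using R(2)[OF b] by blast
  qed
  have main: "\<exists>A'. arc_in (freudenthal G) A' \<and> End \<omega> \<in> A' \<and> A - W \<subseteq> A' \<and>
             A' - graph_points G \<subseteq> insert (End \<omega>) A"
    if v: "v \<in> D" and A: "arc_in (freudenthal G) A" "Vertex v \<in> A" "End \<omega> \<notin> A" and a: "a \<in> A" "a \<notin> W"
    for v A a
  proof -
    obtain p q where pq: "p \<noteq> q" "arc_from_to (freudenthal G) p q A"
      by (rule arc_in_imp_arc_from_to[OF A(1)])
    obtain f where f: "continuous_map (top_of_set {0..1::real}) (freudenthal G) f" "inj_on f {0..1}"
      "f 0 = p" "f 1 = q" "A = f ` {0..1}"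
      by (rule arc_from_to_unit[OF pq(2,1)])
    have clA: "closedin (freudenthal G) A" by (rule arc_from_to_closedin[OF H pq(2)])
    define T where "T = {u \<in> {0..1}. f u \<in> closed_nbhd D}"
    \<comment> \<open>Only the rays that start on the arc are used; this makes the number of rays
      equal to the number of boundary points of pieces that are available.\<close>
    define Q where "Q = {b \<in> boundary D. Vertex b \<in> A}"
    have QD: "b \<in> boundary D" if "b \<in> Q" for b using that by (simp add: Q_def)
    have "\<forall>b\<in>Q. \<exists>u\<in>{0..1}. f u = Vertex b" unfolding Q_def f(5) by auto
    then obtain t where t: "\<And>b. b \<in> Q \<Longrightarrow> t b \<in> {0..1} \<and> f (t b) = Vertex b" by metis
    \<comment> \<open>As \<omega> is not on the arc, the rest \<open>C\<close> of the ray beyond its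
      last point on the arc leads to \<omega> without touching the arc again.\<close>
    have "\<exists>\<tau> C. \<tau> \<in> {0..1} \<and> arc_from_to (freudenthal G) (f \<tau>) (End \<omega>) C \<and> C \<subseteq> R b \<and> C \<inter> A = {f \<tau>}"
      if b: "b \<in> Q" for b
    proof -
      have "R b \<inter> A \<noteq> {}" using arc_from_to_ends[OF R(1)[OF QD[OF b]]] b by (auto simp: Q_def)
      then obtain x B C where x: "arc_from_to (freudenthal G) (Vertex b) x B"
        "arc_from_to (freudenthal G) x (End \<omega>) C" "R b = B \<union> C" "B \<inter> C = {x}" "C \<inter> A = {x}"
        by (rule arc_from_to_last_hit[OF R(1)[OF QD[OF b]] clA])
      then have "x \<in> f ` {0..1}" using f(5) by auto
      then obtain \<tau> where "\<tau> \<in> {0..1}" "x = f \<tau>" by blast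
      then show ?thesis using x by blast
    qed
    then obtain \<tau> C where \<tau>: "\<And>b. b \<in> Q \<Longrightarrow> \<tau> b \<in> {0..1}"
      and C: "\<And>b. b \<in> Q \<Longrightarrow> arc_from_to (freudenthal G) (f (\<tau> b)) (End \<omega>) (C b)"
        "\<And>b. b \<in> Q \<Longrightarrow> C b \<subseteq> R b" "\<And>b. b \<in> Q \<Longrightarrow> C b \<inter> A = {f (\<tau> b)}" by metis
    have sub: "arc_from_to (freudenthal G) (f c) (f d) (f ` {c..d})" if "0 \<le> c" "c \<le> d" "d \<le> 1" for c d
    proof (rule arc_from_toI)
      have cd: "{c..d} \<subseteq> {0..1}" using that by auto
      show "continuous_map (top_of_set {c..d}) (freudenthal G) f"
        by (rule continuous_map_from_subtopology_mono[OF f(1) cd])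
      show "inj_on f {c..d}" by (rule inj_on_subset[OF f(2) cd])
    qed (rule that(2))
    have outside: "u \<in> {0..1} - T" if "u \<in> {0..1}" "f u \<notin> W" for u
      using that DW by (auto simp: T_def)
    have subA: "f ` {c..d} \<subseteq> A" if "0 \<le> c" "d \<le> 1" for c d
      unfolding f(5) using that by (intro image_mono) auto
    have C_A: "x = f (\<tau> b)" if "b \<in> Q" "x \<in> C b" "x \<in> A" for b x
      using C(3)[OF that(1)] that(2,3) by blast
    have C_ends: "f (\<tau> b) \<in> C b" "End \<omega> \<in> C b" if "b \<in> Q" for b
      using arc_from_to_ends[OF C(1)[OF that]] by auto
    have C_graph: "C b - graph_points G \<subseteq> {End \<omega>}" if "b \<in> Q" for b
      using R_graph[OF QD[OF that]] C(2)[OF that] by blast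
    have f_in: "f u \<in> f ` {c..d} \<longleftrightarrow> u \<in> {c..d}" if "u \<in> {0..1}" "0 \<le> c" "d \<le> 1" for u c d
    proof
      assume "f u \<in> f ` {c..d}"
      then obtain w where w: "w \<in> {c..d}" "f u = f w" by blast
      then have "w \<in> {0..1}" using that by auto
      then have "u = w" using inj_onD[OF f(2) w(2) that(1)] by blast
      then show "u \<in> {c..d}" using w(1) by simp
    qed blast
    have fA: "f u \<in> A" if "u \<in> {0..1}" for u using that f(5) by blast
    have "(\<exists>b\<in>Q. \<exists>c\<in>Q. b \<noteq> c \<and> \<tau> b \<le> \<tau> c \<and> {\<tau> b..\<tau> c} \<subseteq> T) \<or>
         (\<exists>b\<in>Q. {0..\<tau> b} \<subseteq> T \<or> {\<tau> b..1} \<subseteq> T)"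
    proof -
      obtain s where s: "s \<in> {0..1}" "f s = Vertex v" using A(2) f(5) by auto
      obtain u0 where u0: "u0 \<in> {0..1}" "f u0 = a" using a(1) f(5) by auto
      show ?thesis
      proof (rule interval_pigeonhole[where t = t and s = s])
        have "closedin (top_of_set {0..1}) T"
          using closedin_continuous_map_preimage[OF f(1) clD] by (simp add: T_def)
        then show "closed T" using closedin_closed_trans closed_atLeastAtMost by blast
        show "T \<subseteq> {0..1}" by (auto simp: T_def)
        \<comment> \<open>The point \<open>a\<close> off \<open>W\<close> witnesses that the arc is
          not contained in \<open>closed_nbhd D\<close>.\<close>
        show "T \<noteq> {0..1}" using outside[of u0] u0 a(2) by auto
        show "finite Q" using reg by (simp add: Q_def region_def)
        show "\<tau> b \<in> T" if "b \<in> Q" for b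
          using \<tau>[OF that] C_ends(1)[OF that] C(2)[OF that] R_closed[OF QD[OF that]] by (auto simp: T_def)
        show "s \<in> T" using s v by (simp add: T_def clos_def)
        show "s \<notin> t ` Q"
        proof
          assume "s \<in> t ` Q"
          then obtain b where b: "b \<in> Q" "s = t b" by blast
          then have "Vertex v = (Vertex b :: ('v, 'e) point)" using t[OF b(1)] s(2) by simp
          then show False using QD[OF b(1)] v by (auto simp: boundary_def)
        qed
        \<comment> \<open>Boundary vertices on the arc are exactly the points
          \<open>f (t b)\<close>; every other point of the arc in \<open>closed_nbhd D\<close> lies
          in the open set \<open>nbhd D\<close>.\<close>
        show "\<exists>e>0. {u - e<..<u + e} \<inter> {0..1} \<subseteq> T" if u: "u \<in> T" "u \<notin> t ` Q" for u
        proof -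
          have u01: "u \<in> {0..1}" "f u \<in> closed_nbhd D" using u(1) by (auto simp: T_def)
          have "f u \<notin> Vertex ` boundary D"
          proof
            assume "f u \<in> Vertex ` boundary D"
            then obtain b where b: "b \<in> boundary D" "f u = Vertex b" by blast
            then have "b \<in> Q" using fA[OF u01(1)] by (simp add: Q_def)
            then have "u = t b" using inj_onD[OF f(2), of u "t b"] t[of b] b(2) u01(1) by auto
            then show False using u(2) \<open>b \<in> Q\<close> by blast
          qed
          then have "f u \<in> nbhd D" using u01(2) by (simp add: closed_nbhd_def)
          have "openin (top_of_set {0..1}) {w \<in> {0..1}. f w \<in> nbhd D}"
            using openin_continuous_map_preimage[OF f(1) openin_nbhd[OF reg]] by simp
          then obtain O' where O': "open O'" "{w \<in> {0..1}. f w \<in> nbhd D} = {0..1} \<inter> O'"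
            unfolding openin_open by auto
          have "u \<in> {w \<in> {0..1}. f w \<in> nbhd D}" using u01(1) \<open>f u \<in> nbhd D\<close> by simp
          then have "u \<in> O'" unfolding O'(2) by simp
          then obtain e where e: "e > 0" "ball u e \<subseteq> O'" using O'(1) by (meson openE)
          have "{u - e<..<u + e} \<subseteq> O'" using e(2) by (simp add: ball_eq_greaterThanLessThan)
          then have "{u - e<..<u + e} \<inter> {0..1} \<subseteq> {w \<in> {0..1}. f w \<in> nbhd D}" unfolding O'(2) by blast
          also have "\<dots> \<subseteq> T" by (auto simp: T_def closed_nbhd_def)
          finally show ?thesis using e(1) by blast
        qed
      qed
    qed
    then consider b c where "b \<in> Q" "c \<in> Q" "b \<noteq> c" "\<tau> b \<le> \<tau> c" "{\<tau> b..\<tau> c} \<subseteq> T"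
      | b where "b \<in> Q" "{0..\<tau> b} \<subseteq> T" | b where "b \<in> Q" "{\<tau> b..1} \<subseteq> T" by blast
    then show ?thesis
    proof cases
      case (1 b c)
      have CC: "C b \<inter> C c \<subseteq> {End \<omega>}"
        using R_disj[OF QD[OF 1(1)] QD[OF 1(2)] 1(3)] C(2)[OF 1(1)] C(2)[OF 1(2)] by blast
      \<comment> \<open>A common last point would lie on two of the rays, so it would be \<omega>,
        which is not on the arc.\<close>
      have "f (\<tau> b) \<noteq> f (\<tau> c)"
        using CC C_ends(1)[OF 1(1)] C_ends(1)[OF 1(2)] A(3) fA[OF \<tau>[OF 1(1)]] by auto
      then have lt: "\<tau> b < \<tau> c" using 1(4) by (cases "\<tau> b = \<tau> c") auto
      have bnd: "0 \<le> \<tau> b" "\<tau> b \<le> 1" "0 \<le> \<tau> c" "\<tau> c \<le> 1" using \<tau>[OF 1(1)] \<tau>[OF 1(2)] by auto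
      define P1 P2 where "P1 = f ` {0..\<tau> b}" and "P2 = f ` {\<tau> c..1}"
      note sub1 = sub[of 0 "\<tau> b", folded P1_def] and sub2 = sub[of "\<tau> c" 1, folded P2_def]
      have P: "P1 \<subseteq> A" "P2 \<subseteq> A" unfolding P1_def P2_def using subA bnd by simp_all
      have n1: "f (\<tau> c) \<notin> P1" "f (\<tau> b) \<notin> P2" unfolding P1_def P2_def using f_in bnd lt by simp_all
      have PP: "P1 \<inter> P2 = {}"
      proof -
        have "f u \<notin> P2" if "u \<in> {0..\<tau> b}" for u unfolding P2_def using f_in[of u "\<tau> c" 1] that bnd lt by simp
        then show ?thesis unfolding P1_def by blast
      qed
      have j1: "arc_from_to (freudenthal G) (f 0) (End \<omega>) (P1 \<union> C b)"
        by (rule arc_from_to_join[OF sub1 C(1)[OF 1(1)]]) (use bnd P C_A[OF 1(1)] in auto)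
      have "(P1 \<union> C b) \<inter> C c \<subseteq> {End \<omega>}"
        using P CC C_A[OF 1(2)] n1 by blast
      from arc_from_to_join[OF j1 arc_from_to_sym[OF C(1)[OF 1(2)]] this]
      have j2: "arc_from_to (freudenthal G) (f 0) (f (\<tau> c)) ((P1 \<union> C b) \<union> C c)" .
      have "((P1 \<union> C b) \<union> C c) \<inter> P2 \<subseteq> {f (\<tau> c)}"
        using P PP C_A[OF 1(1)] C_A[OF 1(2)] n1 by blast
      from arc_from_to_join[OF j2 sub2 this] bnd
      have arc: "arc_from_to (freudenthal G) (f 0) (f 1) (((P1 \<union> C b) \<union> C c) \<union> P2)" by simp
      \<comment> \<open>The replaced segment has all its parameters in \<open>T\<close>, hence lies
        in \<open>W\<close>: no point off \<open>W\<close> is lost.\<close>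
      have "x \<in> ((P1 \<union> C b) \<union> C c) \<union> P2" if x: "x \<in> A - W" for x
      proof -
        obtain u where u: "u \<in> {0..1}" "x = f u" using x f(5) by blast
        then have "u \<notin> {\<tau> b..\<tau> c}" using outside[of u] x 1(5) by auto
        then have "u \<in> {0..\<tau> b} \<or> u \<in> {\<tau> c..1}" using u(1) by auto
        then show ?thesis using u(2) unfolding P1_def P2_def by blast
      qed
      moreover have "(((P1 \<union> C b) \<union> C c) \<union> P2) - graph_points G \<subseteq> insert (End \<omega>) A"
        using P C_graph[OF 1(1)] C_graph[OF 1(2)] by blast
      moreover have "arc_in (freudenthal G) (((P1 \<union> C b) \<union> C c) \<union> P2)"
        using arc_from_to_imp_arc_in[OF H arc] pq(1) f(3,4) by simp
      ultimately show ?thesis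
        using C_ends(2)[OF 1(1)] by (intro exI[of _ "((P1 \<union> C b) \<union> C c) \<union> P2"]) blast
    next
      \<comment> \<open>Here the piece contains the initial point of the arc: the beginning is
        discarded and the new arc starts at \<omega>.\<close>
      case (2 b)
      have bnd: "0 \<le> \<tau> b" "\<tau> b \<le> 1" using \<tau>[OF 2(1)] by auto
      let ?P2 = "f ` {\<tau> b..1}"
      have P: "?P2 \<subseteq> A" using subA bnd by simp
      have arc: "arc_from_to (freudenthal G) (End \<omega>) (f 1) (C b \<union> ?P2)"
        by (rule arc_from_to_join[OF arc_from_to_sym[OF C(1)[OF 2(1)]] sub])
          (use bnd P C_A[OF 2(1)] in auto)
      have "x \<in> C b \<union> ?P2" if x: "x \<in> A - W" for x
      proof -
        obtain u where u: "u \<in> {0..1}" "x = f u" using x f(5) by blast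
        then have "u \<notin> {0..\<tau> b}" using outside[of u] x 2(2) by auto
        then have "u \<in> {\<tau> b..1}" using u(1) by auto
        then show ?thesis using u(2) by blast
      qed
      moreover have "(C b \<union> ?P2) - graph_points G \<subseteq> insert (End \<omega>) A"
        using P C_graph[OF 2(1)] by blast
      moreover have "arc_in (freudenthal G) (C b \<union> ?P2)"
      proof (rule arc_from_to_imp_arc_in[OF H arc])
        show "End \<omega> \<noteq> f 1" using A(3) fA[of 1] by auto
      qed
      ultimately show ?thesis
        using C_ends(2)[OF 2(1)] by (intro exI[of _ "C b \<union> ?P2"]) blast
    next
      case (3 b)
      have bnd: "0 \<le> \<tau> b" "\<tau> b \<le> 1" using \<tau>[OF 3(1)] by auto
      let ?P1 = "f ` {0..\<tau> b}"
      have P: "?P1 \<subseteq> A" using subA bnd by simp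
      have arc: "arc_from_to (freudenthal G) (f 0) (End \<omega>) (?P1 \<union> C b)"
        by (rule arc_from_to_join[OF sub C(1)[OF 3(1)]]) (use bnd P C_A[OF 3(1)] in auto)
      have "x \<in> ?P1 \<union> C b" if x: "x \<in> A - W" for x
      proof -
        obtain u where u: "u \<in> {0..1}" "x = f u" using x f(5) by blast
        then have "u \<notin> {\<tau> b..1}" using outside[of u] x 3(2) by auto
        then have "u \<in> {0..\<tau> b}" using u(1) by auto
        then show ?thesis using u(2) by blast
      qed
      moreover have "(?P1 \<union> C b) - graph_points G \<subseteq> insert (End \<omega>) A"
        using P C_graph[OF 3(1)] by blast
      moreover have "arc_in (freudenthal G) (?P1 \<union> C b)"
      proof (rule arc_from_to_imp_arc_in[OF H arc])
        show "f 0 \<noteq> End \<omega>" using A(3) fA[of 0] by auto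
      qed
      ultimately show ?thesis
        using C_ends(2)[OF 3(1)] by (intro exI[of _ "?P1 \<union> C b"]) blast
    qed
  qed
  show thesis by (rule that[OF D(1) DW main])
qed

text \<open>Induction on the number of ends in \<open>F\<close>: one end is exchanged for a vertex
  near it and put back by rerouting. The last conjunct keeps the exchanged end off the arc given by
  the induction hypothesis.\<close>

lemma arc_through_ends:
  assumes n: "n_ac n (graph_space G)"
    and F: "finite F" "F \<subseteq> all_points" "card F \<le> n"
  shows "\<exists>A. arc_in (freudenthal G) A \<and> F \<subseteq> A \<and> A - graph_points G \<subseteq> F"
  using F
proof (induction "card (F - graph_points G)" arbitrary: F rule: less_induct)
  case less
  note H = Hausdorff_freudenthal
  show ?case
  proof (cases "F \<subseteq> graph_points G")
    case True
    then obtain A where A: "arc_in (graph_space G) A" "F \<subseteq> A"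
      using n[unfolded n_ac_def n_ac_pair_def topspace_graph_space[OF wf_digraph], rule_format, of F]
        less.prems by auto
    obtain p q where pq: "p \<noteq> q" "arc_from_to (graph_space G) p q A"
      by (rule arc_in_imp_arc_from_to[OF A(1)])
    then have "arc_from_to (freudenthal G) p q A" "A \<subseteq> graph_points G"
      unfolding graph_space_eq_subtopology arc_from_to_subtopology by auto
    then show ?thesis using A(2) arc_from_to_imp_arc_in[OF H _ pq(1)] by blast
  next
    case False
    then obtain \<omega> where \<omega>: "End \<omega> \<in> F" "\<omega> \<in> graph_ends G" using less.prems(2) by blast
    define Fo where "Fo = F - {End \<omega>}"
    show ?thesis
    \<comment> \<open>With no other point to keep there is no \<open>a\<close> off \<open>W\<close>
      for the rerouting; a ray together with its end is already an arc.\<close>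
    proof (cases "Fo = {}")
      case True
      then have F: "F = {End \<omega>}" using \<omega>(1) by (auto simp: Fo_def)
      obtain r where r: "r \<in> \<omega>" using end_nonempty[OF \<omega>(2)] by blast
      obtain A where A: "arc_from_to (freudenthal G) (Vertex (r 0)) (End \<omega>) A"
        "A \<subseteq> insert (End \<omega>) (span (range r))" by (rule ray_arc[OF \<omega>(2) r])
      have "span (range r) \<subseteq> graph_points G"
        using ray_verts[OF end_rays[OF \<omega>(2) r]] by (intro span_subset_graph) auto
      then have "A - graph_points G \<subseteq> F" using A(2) F by blast
      moreover have "arc_in (freudenthal G) A" by (rule arc_from_to_imp_arc_in[OF H A(1)]) simp
      moreover have "F \<subseteq> A" using F arc_from_to_ends[OF A(1)] by simp
      ultimately show ?thesis by blast
    next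
      case False
      then obtain a where a: "a \<in> Fo" by auto
      \<comment> \<open>Everything except the points to be kept, so a rerouting that preserves the
        arc off \<open>W\<close> loses none of them.\<close>
      define W where "W = all_points - Fo"
      have "closedin (freudenthal G) Fo"
        using less.prems by (intro closedin_Hausdorff_finite[OF H]) (auto simp: Fo_def topspace_freudenthal)
      then have W: "openin (freudenthal G) W"
        unfolding W_def topspace_freudenthal[symmetric] by (rule openin_diff[OF openin_topspace])
      have \<omega>W: "End \<omega> \<in> W" using \<omega> by (simp add: W_def Fo_def)
      show ?thesis
      proof (rule reroute_through_end[OF \<omega>(2) W \<omega>W])
        fix D
        assume D: "end_region \<omega> D" "closed_nbhd D \<subseteq> W"
          "\<And>v A a. \<lbrakk>v \<in> D; arc_in (freudenthal G) A; Vertex v \<in> A; End \<omega> \<notin> A; a \<in> A; a \<notin> W\<rbrakk>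
            \<Longrightarrow> \<exists>A'. arc_in (freudenthal G) A' \<and> End \<omega> \<in> A' \<and> A - W \<subseteq> A' \<and>
               A' - graph_points G \<subseteq> insert (End \<omega>) A"
        obtain v where v: "v \<in> D" using D(1) by (auto simp: end_region_def connset_def)
        have vG: "v \<in> verts G" using v D(1) by (auto simp: end_region_def region_def)
        \<comment> \<open>One end fewer than \<open>F\<close> and no more points, so the induction
          hypothesis applies with the same \<open>n\<close>.\<close>
        define F' where "F' = insert (Vertex v) Fo"
        have fin: "finite Fo" using less.prems(1) by (simp add: Fo_def)
        have cardFo: "Suc (card Fo) = card F"
          unfolding Fo_def by (rule card_Suc_Diff1[OF less.prems(1) \<omega>(1)])
        have "F' - graph_points G \<subseteq> F - graph_points G"
        proof
          fix x assume "x \<in> F' - graph_points G"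
          then show "x \<in> F - graph_points G" using vG by (cases "x = Vertex v") (simp_all add: F'_def Fo_def)
        qed
        moreover have "End \<omega> \<in> F - graph_points G" "End \<omega> \<notin> F' - graph_points G"
          using \<omega>(1) by (simp_all add: F'_def Fo_def)
        ultimately have "F' - graph_points G \<subset> F - graph_points G" by blast
        then have "card (F' - graph_points G) < card (F - graph_points G)"
          using less.prems(1) by (intro psubset_card_mono) auto
        moreover have "card F' \<le> n"
          unfolding F'_def card_insert_if[OF fin] using cardFo less.prems(3) by simp
        moreover have "finite F'" "F' \<subseteq> all_points"
          using fin less.prems(2) vG by (auto simp: F'_def Fo_def)
        ultimately have "\<exists>A. arc_in (freudenthal G) A \<and> F' \<subseteq> A \<and> A - graph_points G \<subseteq> F'"
          using less.hyps[of F'] by simp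
        then obtain A where A: "arc_in (freudenthal G) A" "F' \<subseteq> A" "A - graph_points G \<subseteq> F'"
          by (elim exE conjE)
        have "End \<omega> \<notin> F'" "End \<omega> \<notin> graph_points G" by (simp_all add: F'_def Fo_def)
        then have n\<omega>: "End \<omega> \<notin> A" using A(3) by blast
        have av: "a \<in> A" "Vertex v \<in> A" using a A(2) unfolding F'_def by blast+
        have aW: "a \<notin> W" using a by (simp add: W_def)
        obtain A' where A': "arc_in (freudenthal G) A'" "End \<omega> \<in> A'" "A - W \<subseteq> A'"
          "A' - graph_points G \<subseteq> insert (End \<omega>) A"
          using D(3)[OF v A(1) av(2) n\<omega> av(1) aW] by (elim exE conjE)
        have "Fo \<subseteq> A - W" using A(2) unfolding F'_def W_def by blast
        then have "F \<subseteq> A'" using A'(2,3) unfolding Fo_def by blast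
        moreover have "A' - graph_points G \<subseteq> F"
        proof
          fix x assume x: "x \<in> A' - graph_points G"
          then consider "x = End \<omega>" | "x \<in> A - graph_points G" using A'(4) by blast
          then show "x \<in> F"
          proof cases
            case 2
            then have "x \<in> F'" using A(3) by blast
            moreover have "x \<noteq> Vertex v" using x vG by auto
            ultimately show ?thesis by (auto simp: F'_def Fo_def)
          qed (use \<omega>(1) in simp)
        qed
        ultimately show ?thesis using A'(1) by blast
      qed
    qed
  qed
qed

lemma n_ac_freudenthal_if_graph:
  assumes "n_ac n (graph_space G)" shows "n_ac n (freudenthal G)"
  unfolding n_ac_def n_ac_pair_def topspace_freudenthal
  using arc_through_ends[OF assms] by meson

end

theorem theorem2p3:
  fixes G :: "('v,'e) pre_digraph" and n :: nat
  assumes "wf_digraph G"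
    and "locally_finite G"
    and "Digraph_Component.connected G"
  shows "(n_ac n (freudenthal G) \<longleftrightarrow> n_ac_pair n (topspace (graph_space G)) (freudenthal G))
       \<and> (n_ac_pair n (topspace (graph_space G)) (freudenthal G) \<longleftrightarrow> n_ac n (graph_space G))"
proof -
  interpret wf_digraph G by (rule assms(1))
  interpret lf_graph G by unfold_locales (rule assms(2), rule assms(3))
  have "topspace (graph_space G) \<subseteq> topspace (freudenthal G)"
    unfolding topspace_freudenthal topspace_graph_space[OF assms(1)] by blast
  then have "n_ac n (freudenthal G) \<Longrightarrow> n_ac_pair n (topspace (graph_space G)) (freudenthal G)"
    unfolding n_ac_def n_ac_pair_def by (meson subset_trans)
  then show ?thesis
    using n_ac_graph_if_pair[of n] n_ac_freudenthal_if_graph[of n] by blast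
qed

end
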